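(* Let $\gamma\subset\mathbf R^2$ be a centrally-symmetric simple convex closed $C^2$ curve of positive curvature, oriented counterclockwise, with phase cylinder $\mathbf A$ and billiard ball map $T:\mathbf A\to\mathbf A$. Assume there exists a continuous rotational $T$-invariant curve $\alpha\subset\mathbf A$ of rotation number $1/4$ that consists of $4$-periodic orbits, and let $\mathcal A\subset\mathbf A$ be the domain between $\alpha$ and the boundary component $\{\delta=0\}$. If $\gamma$ is not an ellipse, then, for each of the two vertical foliations $\{s=\mathrm{const}\}$ and $\{\varphi=\mathrm{const}\}$ of $\mathbf A$, there exist a point $x\in\mathcal A$, a non-zero vertical tangent vector $v\in T_x\mathcal A$ and a positive integer $n$ such that the vector $DT^n(v)$ is again vertical (vertical meaning tangent to the leaves of the chosen foliation). In particular, choosing the foliation $\{\varphi=\mathrm{const}\}$, there is an (infinitesimal) beam of parallel lines which after $n$ reflections becomes infinitesimally parallel again.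
   Context: The phase cylinder $\mathbf A$ is the space of all oriented lines intersecting the interior of the domain bounded by $\gamma$. It carries two systems of coordinates. (1) $(\cos\delta,s)$: $s$ is the arclength parameter (modulo the length of $\gamma$) of the point $\gamma(s)$ at which the line enters the domain and $\delta\in(0,\pi)$ is the angle between $\gamma'(s)$ and the direction of the line; the boundary components of $\mathbf A$ are $\{\delta=0\}$ and $\{\delta=\pi\}$. (2) $(p,\varphi)$: $\varphi\in\mathbf R/2\pi\mathbf Z$ is the angle between the right unit normal of the oriented line and the horizontal axis, and $p$ is the signed distance from the origin to the line in the direction of this normal. The leaves of $\{s=\mathrm{const}\}$ consist of lines entering at a common point, and those of $\{\varphi=\mathrm{const}\}$ of parallel lines. The billiard ball map $T$ sends an oriented line to the oriented line obtained from it by reflection in $\gamma$ at the point where it leaves the domain. A curve in $\mathbf A$ is rotational if it is simple, closed and winds once around the cylinder; it is invariant if $T$ maps it onto itself; the rotation number is normalized so that an orbit with rotation number $1/4$ consisting of $4$-periodic points makes exactly one counterclockwise turn around $\gamma$ in $4$ reflections. Circles are regarded as ellipses. *)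

theory Defs
  imports "HOL-Complex_Analysis.Winding_Numbers"
begin

text \<open>The plane is \<^typ>\<open>complex\<close>. A closed curve is given by its arclength parametrization,
  an \<open>L\<close>-periodic function on the whole real line, where \<open>L\<close> is the length.\<close>

abbreviation velocity :: "(real \<Rightarrow> complex) \<Rightarrow> real \<Rightarrow> complex" where
  "velocity \<gamma> s \<equiv> vector_derivative \<gamma> (at s)"

abbreviation acceleration :: "(real \<Rightarrow> complex) \<Rightarrow> real \<Rightarrow> complex" where
  "acceleration \<gamma> s \<equiv> vector_derivative (velocity \<gamma>) (at s)"

definition simple_closed_C2_curve :: "(real \<Rightarrow> complex) \<Rightarrow> real \<Rightarrow> bool" where
  "simple_closed_C2_curve \<gamma> L \<longleftrightarrow>
     L > 0 \<and> (\<forall>s. \<gamma> (s + L) = \<gamma> s) \<and> inj_on \<gamma> {0..<L} \<and>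
     (\<forall>s. \<gamma> differentiable (at s)) \<and> (\<forall>s. norm (velocity \<gamma> s) = 1) \<and>
     (\<forall>s. velocity \<gamma> differentiable (at s)) \<and> continuous_on UNIV (acceleration \<gamma>)"

abbreviation table :: "(real \<Rightarrow> complex) \<Rightarrow> complex set" where
  "table \<gamma> \<equiv> inside (range \<gamma>)"

definition counterclockwise :: "(real \<Rightarrow> complex) \<Rightarrow> real \<Rightarrow> bool" where
  "counterclockwise \<gamma> L \<longleftrightarrow> (\<forall>z\<in>table \<gamma>. winding_number (\<lambda>t. \<gamma> (L * t)) z = 1)"

text \<open>The determinant of velocity and acceleration: the signed curvature of an
  arclength-parametrized curve.\<close>

definition curvature :: "(real \<Rightarrow> complex) \<Rightarrow> real \<Rightarrow> real" where
  "curvature \<gamma> s = Im (cnj (velocity \<gamma> s) * acceleration \<gamma> s)"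

definition centrally_symmetric :: "complex set \<Rightarrow> bool" where
  "centrally_symmetric S \<longleftrightarrow> (\<exists>c. (\<lambda>z. 2 * c - z) ` S = S)"

definition is_ellipse :: "complex set \<Rightarrow> bool" where
  "is_ellipse S \<longleftrightarrow> (\<exists>c \<theta> a b. a > 0 \<and> b > 0 \<and>
     S = range (\<lambda>t. c + cis \<theta> * Complex (a * cos t) (b * sin t)))"

text \<open>An oriented line is the pair of its right unit normal \<open>cis \<phi>\<close> and its signed distance \<open>p\<close>
  from the origin along that normal; a unit complex number thus stands for
  \<open>\<phi>\<close> modulo \<open>2\<pi>\<close>. The space of oriented lines is the cylinder (unit circle) \<open>\<times>\<close> \<open>\<real>\<close> inside
  \<^typ>\<open>complex \<times> real\<close>, from which it takes its topology and its smooth structure.\<close>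

type_synonym oriented_line = "complex \<times> real"

abbreviation normal :: "oriented_line \<Rightarrow> complex" where
  "normal \<equiv> fst"

definition direction :: "oriented_line \<Rightarrow> complex" where
  "direction l = \<i> * normal l"

definition points :: "oriented_line \<Rightarrow> complex set" where
  "points l = {z. z \<bullet> normal l = snd l}"

definition line_through :: "complex \<Rightarrow> complex \<Rightarrow> oriented_line" where
  "line_through z u = (- \<i> * u, z \<bullet> (- \<i> * u))"

definition phase_cylinder :: "(real \<Rightarrow> complex) \<Rightarrow> oriented_line set" where
  "phase_cylinder \<gamma> = {l. norm (normal l) = 1 \<and> points l \<inter> table \<gamma> \<noteq> {}}"

text \<open>The boundary component \<open>{\<delta> = 0}\<close> of the phase cylinder: the positively oriented tangent
  lines.\<close>

definition boundary0 :: "(real \<Rightarrow> complex) \<Rightarrow> oriented_line set" where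
  "boundary0 \<gamma> = range (\<lambda>s. line_through (\<gamma> s) (velocity \<gamma> s))"

definition enters_at :: "(real \<Rightarrow> complex) \<Rightarrow> oriented_line \<Rightarrow> complex \<Rightarrow> bool" where
  "enters_at \<gamma> l z \<longleftrightarrow> z \<in> points l \<inter> range \<gamma> \<and>
     (\<forall>\<^sub>F t in at_right 0. z + of_real t * direction l \<in> table \<gamma>)"

definition leaves_at :: "(real \<Rightarrow> complex) \<Rightarrow> oriented_line \<Rightarrow> complex \<Rightarrow> bool" where
  "leaves_at \<gamma> l z \<longleftrightarrow> z \<in> points l \<inter> range \<gamma> \<and>
     (\<forall>\<^sub>F t in at_right 0. z - of_real t * direction l \<in> table \<gamma>)"

text \<open>For a unit vector \<open>\<tau>\<close>, the map \<open>u \<mapsto> \<tau>\<^sup>2 * cnj u\<close> is the reflection in the line spanned by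
  \<open>\<tau>\<close>. Outside the phase cylinder the values of the following functions are irrelevant.\<close>

definition billiard_map :: "(real \<Rightarrow> complex) \<Rightarrow> oriented_line \<Rightarrow> oriented_line" where
  "billiard_map \<gamma> l = (THE l'. \<exists>s. leaves_at \<gamma> l (\<gamma> s) \<and>
     l' = line_through (\<gamma> s) ((velocity \<gamma> s)\<^sup>2 * cnj (direction l)))"

definition entry_parameter :: "(real \<Rightarrow> complex) \<Rightarrow> real \<Rightarrow> oriented_line \<Rightarrow> real" where
  "entry_parameter \<gamma> L l = (THE s. 0 \<le> s \<and> s < L \<and> enters_at \<gamma> l (\<gamma> s))"

text \<open>The leaves through \<open>x\<close> of \<open>{s = const}\<close> and of \<open>{\<phi> = const}\<close>.\<close>

definition s_leaf :: "(real \<Rightarrow> complex) \<Rightarrow> real \<Rightarrow> oriented_line \<Rightarrow> oriented_line set" where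
  "s_leaf \<gamma> L x = {l \<in> phase_cylinder \<gamma>. entry_parameter \<gamma> L l = entry_parameter \<gamma> L x}"

definition phi_leaf :: "(real \<Rightarrow> complex) \<Rightarrow> oriented_line \<Rightarrow> oriented_line set" where
  "phi_leaf \<gamma> x = {l \<in> phase_cylinder \<gamma>. normal l = normal x}"

text \<open>Velocities at \<open>x\<close> of curves in \<open>M\<close>; this is the usual tangent space when \<open>M\<close> is a
  submanifold without boundary.\<close>

definition tangent_vectors :: "'a::real_normed_vector set \<Rightarrow> 'a \<Rightarrow> 'a set" where
  "tangent_vectors M x = {v. \<exists>c. c 0 = x \<and> (\<forall>\<^sub>F t in nhds (0::real). c t \<in> M) \<and>
     (c has_vector_derivative v) (at 0)}"

text \<open>The winding around the cylinder is measured by the angular coordinate \<open>\<phi>\<close>; a curve has no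
  preferred orientation, whence the two signs.\<close>

definition rotational_curve :: "(real \<Rightarrow> complex) \<Rightarrow> oriented_line set \<Rightarrow> bool" where
  "rotational_curve \<gamma> \<alpha> \<longleftrightarrow> \<alpha> \<subseteq> phase_cylinder \<gamma> \<and>
     (\<exists>g. simple_path g \<and> pathfinish g = pathstart g \<and> path_image g = \<alpha> \<and>
        winding_number (normal \<circ> g) 0 \<in> {1, -1})"

text \<open>Length of the arc of the curve, followed counterclockwise, from the point where the line
  enters to the point where it leaves.\<close>

definition arc_step :: "(real \<Rightarrow> complex) \<Rightarrow> real \<Rightarrow> oriented_line \<Rightarrow> real" where
  "arc_step \<gamma> L l = (THE d. 0 < d \<and> d < L \<and>
     (\<exists>s. enters_at \<gamma> l (\<gamma> s) \<and> leaves_at \<gamma> l (\<gamma> (s + d))))"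

text \<open>Mean number of counterclockwise turns around the curve per reflection.\<close>

definition has_rotation_number ::
    "(real \<Rightarrow> complex) \<Rightarrow> real \<Rightarrow> oriented_line set \<Rightarrow> real \<Rightarrow> bool" where
  "has_rotation_number \<gamma> L \<alpha> \<rho> \<longleftrightarrow>
     (\<forall>x\<in>\<alpha>. (\<lambda>k. (\<Sum>i<k. arc_step \<gamma> L ((billiard_map \<gamma> ^^ i) x)) / (real k * L))
        \<longlonglongrightarrow> \<rho>)"

text \<open>The domain between \<open>\<alpha>\<close> and \<open>{\<delta> = 0}\<close>: the lines which, in the phase cylinder with this
  boundary component adjoined, are not separated from it by \<open>\<alpha>\<close>.\<close>

definition lower_domain :: "(real \<Rightarrow> complex) \<Rightarrow> oriented_line set \<Rightarrow> oriented_line set" where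
  "lower_domain \<gamma> \<alpha> = {x \<in> phase_cylinder \<gamma>.
     \<exists>b\<in>boundary0 \<gamma>. connected_component ((phase_cylinder \<gamma> \<union> boundary0 \<gamma>) - \<alpha>) b x}"

text \<open>The Frechet derivative within the cylinder is determined only on tangent vectors of the
  cylinder, which is where it is used.\<close>

definition vertical_returns_to_vertical ::
    "(real \<Rightarrow> complex) \<Rightarrow> (oriented_line \<Rightarrow> oriented_line set) \<Rightarrow> oriented_line \<Rightarrow> nat \<Rightarrow> bool" where
  "vertical_returns_to_vertical \<gamma> leaf x n \<longleftrightarrow>
     (\<exists>v D. v \<noteq> 0 \<and> v \<in> tangent_vectors (leaf x) x \<and>
        (billiard_map \<gamma> ^^ n has_derivative D) (at x within phase_cylinder \<gamma>) \<and>
        D v \<in> tangent_vectors (leaf ((billiard_map \<gamma> ^^ n) x)) ((billiard_map \<gamma> ^^ n) x))"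

end

theory Submission
  imports Defs "HOL-Analysis.Analysis" "HOL-Complex_Analysis.Riemann_Mapping"
begin

text \<open>A beam which is vertical at a line \<open>x\<close> and never becomes vertical again gives a Jacobi field which
  is positive along the orbit of \<open>x\<close>. If this happens for every \<open>x\<close> in the domain, the second
  variation of the generating function \<open>2 h(\<psi>) sin \<delta>\<close> of Bialy and Mironov is negative along every
  orbit, up to boundary terms. Evaluate it on the momentum \<open>p\<close>: the Birkhoff sums are bounded above, so
  by invariance of the area \<open>d\<phi> dp\<close> the integral of the quadratic form over the domain is at most zero.

  The orbits of \<open>\<alpha>\<close> are parallelograms whose vertices have the normal angles
  \<open>\<psi>, \<psi> + \<pi>/2, \<psi> + \<pi>, \<psi> + 3\<pi>/2\<close>. Hence \<open>h(\<psi>)\<^sup>2 + h(\<psi> + \<pi>/2)\<^sup>2 = R\<^sup>2\<close>, and the domain lies over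
  \<open>0 < \<delta> < w(\<psi>)\<close> with \<open>h = R sin w\<close>. For \<open>y = cos (2w)\<close> the integral equals \<open>\<pi> R\<^sup>4/256\<close> times the
  integral of \<open>y''\<^sup>2 - 4y'\<^sup>2\<close> over \<open>[0, 2\<pi>]\<close>. By Wirtinger's inequality it is positive unless \<open>y\<close> is a
  multiple of a translate of \<open>cos 2\<psi>\<close>, that is, unless \<open>\<gamma>\<close> is an ellipse.\<close>

text \<open>The usual form of Hopf's method builds an invariant positive Jacobi field as a limit and
  integrates its slope, which must then be measurable. Here only forward orbits and finite sums from
  time 1 to \<open>N\<close> occur: the slope terms telescope, and the two that remain are bounded
  uniformly in the line because the neighbouring values of the field have a sign. The field is
  chosen at each line separately, without regularity. One inequality serves both foliations, since
  of a field only the sign of its angular component matters; parallel beams start with component 0,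
  pencils with 1. The number 1/4 enters through the complementary angles \<open>w\<close> and
  \<open>pi/2 - w\<close> at the ends of a quarter turn. The integrals over fibres contain
  \<open>w\<close> itself beside its sine and cosine; the sum over two such points is a total
  derivative plus a form with constant coefficients. For a table that is only
  \<open>C\<^sup>2\<close>, \<open>y''\<close> is the last derivative available, and the
  integrations by parts stay within it.\<close>

lemma periodic_int:
  fixes f :: "real \<Rightarrow> 'a"
  assumes per: "\<And>t. f (t + c) = f t"
  shows "f (t + of_int n * c) = f t"
proof -
  have nat: "f (t + real n * c) = f t" for n t
  proof (induction n)
    case (Suc n)
    have "t + real (Suc n) * c = (t + real n * c) + c" by (simp add: algebra_simps)
    then show ?case using Suc per[of "t + real n * c"] by (simp only:)
  qed simp
  show ?thesis
  proof (cases "n \<ge> 0")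
    case True then show ?thesis using nat[of t "nat n"] by simp
  next
    case False then show ?thesis using nat[of "t + of_int n * c" "nat (- n)"] by simp
  qed
qed

lemma reduce_mod_period:
  fixes s a c :: real
  assumes c: "c > 0"
  shows "\<exists>n::int. a \<le> s + of_int n * c \<and> s + of_int n * c < a + c"
proof -
  let ?n = "\<lfloor>(s - a) / c\<rfloor>"
  have "of_int ?n \<le> (s - a) / c" by (rule of_int_floor_le)
  then have 1: "of_int ?n * c \<le> s - a" by (simp only: pos_le_divide_eq[OF c])
  have "(s - a) / c < of_int ?n + 1" by linarith
  then have "s - a < (of_int ?n + 1) * c" by (simp only: pos_divide_less_eq[OF c])
  then show ?thesis using 1 by (intro exI[of _ "- ?n"]) (simp add: algebra_simps)
qed

text \<open>Integrals over a period are handled as increments of antiderivatives, so that they can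
  be compared by differentiating.\<close>

lemma continuous_antiderivative:
  fixes f :: "real \<Rightarrow> real"
  assumes "continuous_on UNIV f"
  shows "\<exists>F. \<forall>x. (F has_real_derivative f x) (at x)"
proof -
  have "\<exists>F. \<forall>x :: real. - \<infinity> < ereal x \<longrightarrow> ereal x < \<infinity> \<longrightarrow> (F has_vector_derivative f x) (at x)"
    using assms by (intro einterval_antiderivative) (auto simp: continuous_on_eq_continuous_at)
  then show ?thesis by (auto simp: has_real_derivative_iff_has_vector_derivative)
qed

section \<open>Ovals and the billiard map in support coordinates\<close>

text \<open>An oval in terms of the angle \<open>t\<close> of its outer normal: \<open>h\<close> is the support function, \<open>h1\<close> its
  derivative and \<open>r = h + h''\<close> the radius of curvature.\<close>

locale oval =
  fixes h h1 r :: "real \<Rightarrow> real"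
  assumes h_deriv: "(h has_real_derivative h1 t) (at t)"
    and h1_deriv: "(h1 has_real_derivative r t - h t) (at t)"
    and r_cont: "continuous_on UNIV r"
    and r_pos: "r t > 0"
    and h_periodic: "h (t + 2 * pi) = h t"
begin

text \<open>The components along \<open>cis f\<close> and along \<open>\<i> cis f\<close> of the boundary point with outer normal
  \<open>cis t\<close>.\<close>

definition k :: "real \<Rightarrow> real \<Rightarrow> real" where
  "k t f = h t * cos (f - t) + h1 t * sin (f - t)"

definition q :: "real \<Rightarrow> real \<Rightarrow> real" where
  "q t f = h1 t * cos (f - t) - h t * sin (f - t)"

text \<open>The boundary point moves with velocity \<open>r t\<close> times
  \<open>\<i> cis t\<close>, whose component along \<open>cis f\<close> is
  \<open>sin (f - t)\<close>.\<close>

lemma k_deriv: "((\<lambda>t. k t f) has_real_derivative r t * sin (f - t)) (at t)"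
  unfolding k_def
  by (auto intro!: derivative_eq_intros h_deriv[of t] h1_deriv[of t] simp: algebra_simps)

lemma k_deriv2: "((\<lambda>f. k t f) has_real_derivative q t f) (at f)"
  unfolding k_def q_def by (auto intro!: derivative_eq_intros)

lemma k_cont1: "continuous_on S (\<lambda>t. k t f)"
  by (rule DERIV_continuous_on) (rule has_field_derivative_at_within[OF k_deriv])

lemma k_self [simp]: "k t t = h t" by (simp add: k_def)
lemma h_cont: "continuous_on UNIV h"
  by (rule DERIV_continuous_on) (rule has_field_derivative_at_within[OF h_deriv])
lemma h1_cont: "continuous_on UNIV h1"
  by (rule DERIV_continuous_on) (rule has_field_derivative_at_within[OF h1_deriv])

lemma h1_periodic: "h1 (t + 2 * pi) = h1 t"
proof -
  have "((\<lambda>t. h (t + 2*pi)) has_real_derivative h1 (t + 2*pi)) (at t)"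
    using h_deriv[of "t+2*pi"] by (simp add: DERIV_shift)
  then show ?thesis using h_deriv[of t] DERIV_unique by (simp add: h_periodic)
qed

lemma r_periodic: "r (t + 2 * pi) = r t"
proof -
  have "((\<lambda>t. h1 (t + 2*pi)) has_real_derivative (r (t + 2*pi) - h (t+2*pi))) (at t)"
    using h1_deriv[of "t+2*pi"] by (simp add: DERIV_shift)
  then show ?thesis using h1_deriv[of t] DERIV_unique by (fastforce simp add: h1_periodic h_periodic)
qed

lemma k_periodic: "k (t + 2 * pi) f = k t f"
proof -
  have "f - (t + 2*pi) = (f - t) - 2*pi" by simp
  then show ?thesis unfolding k_def by (simp only: h_periodic h1_periodic) (simp add: cos_diff sin_diff)
qed

text \<open>With \<open>k_strict_inc\<close> this is how convexity is used: on each half turn of the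
  normal away from \<open>f\<close> the height along \<open>cis f\<close> is monotone, so a line
  crosses each of the two arcs once.\<close>

lemma k_strict_dec: assumes "f \<le> a" "a < b" "b \<le> f + pi" shows "k b f < k a f"
proof (rule DERIV_neg_imp_decreasing_open[OF assms(2)])
  fix x assume x: "a < x" "x < b"
  have "sin (x - f) > 0" using x assms by (intro sin_gt_zero) auto
  then have "sin (f - x) < 0" using sin_minus[of "x - f"] by simp
  then show "\<exists>y. ((\<lambda>t. k t f) has_real_derivative y) (at x) \<and> y < 0"
    using k_deriv[of f x] r_pos[of x] mult_pos_neg[of "r x" "sin (f - x)"] by auto
next
  show "continuous_on {a..b} (\<lambda>t. k t f)"
by (rule k_cont1)
qed

lemma k_strict_inc: assumes "f - pi \<le> a" "a < b" "b \<le> f" shows "k a f < k b f"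
proof (rule DERIV_pos_imp_increasing_open[OF assms(2)])
  fix x assume x: "a < x" "x < b"
  have "sin (f - x) > 0" using x assms by (intro sin_gt_zero) auto
  then show "\<exists>y. ((\<lambda>t. k t f) has_real_derivative y) (at x) \<and> 0 < y"
    using k_deriv[of f x] r_pos[of x] mult_pos_pos[of "r x" "sin (f - x)"] by auto
next
  show "continuous_on {a..b} (\<lambda>t. k t f)"
by (rule k_cont1)
qed

lemma k_less_h: assumes "f - pi \<le> t" "t \<le> f + pi" "t \<noteq> f" shows "k t f < h f"
  using k_strict_inc[of f t f] k_strict_dec[of f f t] assms by (cases "t < f") auto

end

locale symmetric_oval = oval +
  assumes h_pi: "h (t + pi) = h t"
begin

lemma h1_pi: "h1 (t + pi) = h1 t"
proof -
  have "((\<lambda>t. h (t + pi)) has_real_derivative h1 (t + pi)) (at t)"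
    using h_deriv[of "t+pi"] by (simp add: DERIV_shift)
  then show ?thesis using h_deriv[of t] DERIV_unique by (simp add: h_pi)
qed

lemma r_pi: "r (t + pi) = r t"
proof -
  have "((\<lambda>t. h1 (t + pi)) has_real_derivative (r (t + pi) - h (t+pi))) (at t)"
    using h1_deriv[of "t+pi"] by (simp add: DERIV_shift)
  then show ?thesis using h1_deriv[of t] DERIV_unique by (fastforce simp add: h1_pi h_pi)
qed

lemma k_pi: "k (t + pi) f = - k t f"
proof -
  have "f - (t + pi) = (f - t) - pi" by simp
  then show ?thesis unfolding k_def by (simp only: h_pi h1_pi) (simp add: cos_diff sin_diff algebra_simps)
qed

lemma k_pi2: "k t (f + pi) = - k t f"
proof -
  have "f + pi - t = (f - t) + pi" by simp
  then show ?thesis unfolding k_def by (simp only: cos_periodic_pi sin_periodic_pi)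
qed

lemma k_mpi: "k (t - pi) f = - k t f"
  using k_pi[of "t - pi" f] by simp

lemma q_pi: "q (t + pi) f = - q t f"
proof -
  have "f - (t + pi) = (f - t) - pi" by simp
  then show ?thesis unfolding q_def by (simp only: h_pi h1_pi) (simp add: cos_diff sin_diff algebra_simps)
qed

lemma h_pos: "h t > 0"
  using k_less_h[of t "t + pi"] k_pi[of t t] by simp

text \<open>A pair \<open>(\<phi>, p)\<close> is a lifted oriented line, with \<open>\<phi>\<close> a real number rather than an angle
  modulo \<open>2\<pi>\<close>. The closure \<open>clines\<close> contains the tangent lines.\<close>

definition lines :: "(real \<times> real) set" where
  "lines = {x. \<bar>snd x\<bar> < h (fst x)}"

definition clines :: "(real \<times> real) set" where
  "clines = {x. \<bar>snd x\<bar> \<le> h (fst x)}"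

lemma lines_subset: "lines \<subseteq> clines"
  by (auto simp: lines_def clines_def)

text \<open>The normal angles \<open>lv x\<close> and (below) \<open>ev x\<close> of the points where the line leaves and enters,
  chosen within \<open>\<pi>\<close> of \<open>\<phi>\<close>; by central symmetry one determines the other.\<close>

definition lv :: "real \<times> real \<Rightarrow> real" where
  "lv x = (THE t. fst x \<le> t \<and> t \<le> fst x + pi \<and> k t (fst x) = snd x)"

lemma lv_ex1:
  assumes "x \<in> clines" shows "\<exists>!t. fst x \<le> t \<and> t \<le> fst x + pi \<and> k t (fst x) = snd x"
proof -
  obtain f p where x: "x = (f,p)" by (cases x)
  have "\<exists>t\<ge>f. t \<le> f + pi \<and> k t f = p"
  proof (rule IVT2')
    show "k (f + pi) f \<le> p" "p \<le> k f f" using assms by (auto simp: clines_def x k_pi)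
    show "continuous_on {f..f + pi} (\<lambda>t. k t f)"
  by (rule k_cont1)
  qed simp
  moreover have "t = t'" if "f \<le> t" "t \<le> f + pi" "k t f = p" "f \<le> t'" "t' \<le> f + pi" "k t' f = p" for t t'
    using that k_strict_dec[of f t t'] k_strict_dec[of f t' t] by (metis less_irrefl linorder_neqE)
  ultimately show ?thesis unfolding x by auto
qed

lemma lv_props:
  assumes "x \<in> clines"
  shows "fst x \<le> lv x" "lv x \<le> fst x + pi" "k (lv x) (fst x) = snd x"
  using theI'[OF lv_ex1[OF assms]] unfolding lv_def by auto

lemma lv_eqI:
  assumes "f \<le> t" "t \<le> f + pi" "k t f = p" shows "(f,p) \<in> clines" "lv (f,p) = t"
proof -
  have "k t f \<le> k f f" using k_strict_dec[of f f t] assms by (cases "t = f") auto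
  moreover have "k (f+pi) f \<le> k t f" using k_strict_dec[of f t "f + pi"] assms by (cases "t = f+pi") auto
  ultimately show c: "(f,p) \<in> clines" using assms by (auto simp: clines_def k_pi)
  show "lv (f,p) = t" using lv_ex1[OF c] lv_props[OF c] assms by auto
qed

lemma lv_lines:
  assumes "x \<in> lines" shows "fst x < lv x" "lv x < fst x + pi"
proof -
  have c: "x \<in> clines" using assms lines_subset by auto
  have "lv x \<noteq> fst x" "lv x \<noteq> fst x + pi" using lv_props(3)[OF c] assms by (auto simp: lines_def k_pi)
  then show "fst x < lv x" "lv x < fst x + pi" using lv_props[OF c] by auto
qed

lemma lv_eqI':
  assumes "f < t" "t < f + pi" "k t f = p" shows "(f,p) \<in> lines" "lv (f,p) = t"
proof -
  have "k t f < k f f" using k_strict_dec[of f f t] assms by auto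
  moreover have "k (f+pi) f < k t f" using k_strict_dec[of f t "f + pi"] assms by auto
  ultimately show c: "(f,p) \<in> lines" using assms by (auto simp: lines_def k_pi)
  show "lv (f,p) = t" using lv_eqI assms by auto
qed

section \<open>Regularity of the end points of a chord\<close>

lemma h_cont'[continuous_intros]:
  assumes "continuous_on S a" shows "continuous_on S (\<lambda>x. h (a x))"
  by (rule continuous_on_compose2[OF h_cont assms subset_UNIV])

lemma h1_cont'[continuous_intros]:
  assumes "continuous_on S a" shows "continuous_on S (\<lambda>x. h1 (a x))"
  by (rule continuous_on_compose2[OF h1_cont assms subset_UNIV])

lemma r_cont'[continuous_intros]:
  assumes "continuous_on S a" shows "continuous_on S (\<lambda>x. r (a x))"
  by (rule continuous_on_compose2[OF r_cont assms subset_UNIV])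

lemma k_cont[continuous_intros]:
  fixes S :: "'a::t2_space set" assumes "continuous_on S a" "continuous_on S b" shows "continuous_on S (\<lambda>x. k (a x) (b x))"
  unfolding k_def by (intro continuous_intros assms)

lemma q_cont[continuous_intros]:
  fixes S :: "'a::t2_space set" assumes "continuous_on S a" "continuous_on S b" shows "continuous_on S (\<lambda>x. q (a x) (b x))"
  unfolding q_def by (intro continuous_intros assms)

text \<open>The derivative of \<open>k\<close> vanishes at tangent lines, so the implicit function
  theorem does not reach the boundary of \<open>clines\<close>. Instead a strict inequality for
  \<open>k\<close> at a fixed angle, which persists nearby, is turned by monotonicity into one for
  \<open>lv\<close>; angles outside the half turn are excluded by the range of
  \<open>lv\<close>.\<close>

lemma lv_cont: "continuous_on clines lv"
  unfolding continuous_on_def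
proof (intro ballI)
  fix x assume x: "x \<in> clines"
  have sub: "\<forall>\<^sub>F y in at x within clines. y \<in> clines" by (simp add: eventually_at_filter)
  have fstl: "(fst \<longlongrightarrow> fst x) (at x within clines)" by (intro tendsto_intros)
  have ky: "((\<lambda>y. k s (fst y) - snd y) \<longlongrightarrow> k s (fst x) - snd x) (at x within clines)" for s
  proof -
    have "continuous_on UNIV (\<lambda>y. k s (fst y) - snd y)" by (intro continuous_intros)
    then show ?thesis unfolding continuous_on_def by (meson UNIV_I tendsto_within_subset[OF _ subset_UNIV])
  qed
  show "(lv \<longlongrightarrow> lv x) (at x within clines)"
  proof (rule order_tendstoI)
    fix a assume a: "a < lv x"
    show "\<forall>\<^sub>F y in at x within clines. a < lv y"
    proof (cases "a < fst x")
      case True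
      then have "\<forall>\<^sub>F y in at x within clines. a < fst y" using fstl order_tendstoD by blast
      with sub show ?thesis by eventually_elim (use lv_props(1) in force)
    next
      case False
      let ?m = "(a + lv x)/2"
      have "k ?m (fst x) > snd x" using k_strict_dec[of "fst x" ?m "lv x"] a False lv_props[OF x] by auto
      then have "\<forall>\<^sub>F y in at x within clines. 0 < k ?m (fst y) - snd y" using order_tendstoD(1)[OF ky, of 0 ?m] by simp
      moreover have "\<forall>\<^sub>F y in at x within clines. ?m - pi < fst y"
      proof (rule order_tendstoD(1)[OF fstl])
        show "?m - pi < fst x" using lv_props(2)[OF x] a by argo
      qed
      ultimately show ?thesis using sub
      proof eventually_elim
        case (elim y)
        have "?m \<le> fst y + pi" using elim(2) by argo
        then show ?case using k_strict_dec[of "fst y" "lv y" ?m] lv_props[OF elim(3)] a elim(1) by (cases "lv y \<le> a") auto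
      qed
    qed
  next
    fix a assume a: "lv x < a"
    show "\<forall>\<^sub>F y in at x within clines. lv y < a"
    proof (cases "a > fst x + pi")
      case True
      then have "\<forall>\<^sub>F y in at x within clines. a - pi > fst y" using order_tendstoD(2)[OF fstl, of "a - pi"] by simp
      with sub show ?thesis by eventually_elim (use lv_props(2) in force)
    next
      case False
      let ?m = "(a + lv x)/2"
      have "k ?m (fst x) < snd x" using k_strict_dec[of "fst x" "lv x" ?m] a False lv_props[OF x] by auto
      then have "\<forall>\<^sub>F y in at x within clines. 0 > k ?m (fst y) - snd y" using order_tendstoD(2)[OF ky, of ?m 0] by simp
      moreover have "\<forall>\<^sub>F y in at x within clines. ?m > fst y"
      proof (rule order_tendstoD(2)[OF fstl])
        show "fst x < ?m" using lv_props(1)[OF x] a by argo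
      qed
      ultimately show ?thesis using sub
      proof eventually_elim
        case (elim y)
        have "fst y \<le> ?m" using elim(2) by argo
        then show ?case using k_strict_dec[of "fst y" ?m "lv y"] lv_props[OF elim(3)] a elim(1) by (cases "lv y \<ge> a") auto
      qed
    qed
  qed
qed

lemma lines_open: "open lines"
proof -
  have "continuous_on UNIV (\<lambda>x::real\<times>real. h (fst x) - \<bar>snd x\<bar>)" by (intro continuous_intros)
  then have "open {x::real\<times>real. 0 < h (fst x) - \<bar>snd x\<bar>}" by (intro open_Collect_less) auto
  then show ?thesis by (simp add: lines_def)
qed

lemma lv_isCont: "x \<in> lines \<Longrightarrow> isCont lv x"
  using continuous_on_subset[OF lv_cont lines_subset] lines_open continuous_on_eq_continuous_at by blast

lemma sin_lv_pos: assumes "x \<in> lines" shows "sin (lv x - fst x) > 0"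
  using lv_lines[OF assms] by (intro sin_gt_zero) auto

lemma k_has_derivative:
  "((\<lambda>z. k (fst z) (snd z)) has_derivative
     (\<lambda>u. r (fst z) * sin (snd z - fst z) * fst u + q (fst z) (snd z) * snd u)) (at z)"
proof -
  have 1: "((\<lambda>z::real\<times>real. h (fst z)) has_derivative (\<lambda>u. h1 (fst z) * fst u)) (at z)"
    by (rule has_derivative_compose[OF has_derivative_fst[OF has_derivative_ident], of h, simplified])
       (use h_deriv[of "fst z"] in \<open>simp add: has_field_derivative_def\<close>)
  have 2: "((\<lambda>z::real\<times>real. h1 (fst z)) has_derivative (\<lambda>u. (r (fst z) - h (fst z)) * fst u)) (at z)"
    by (rule has_derivative_compose[OF has_derivative_fst[OF has_derivative_ident], of h1, simplified])
       (use h1_deriv[of "fst z"] in \<open>simp add: has_field_derivative_def\<close>)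
  show ?thesis unfolding k_def q_def
    by (rule derivative_eq_intros 1 2 refl)+ (simp add: fun_eq_iff algebra_simps)
qed

text \<open>The pair \<open>(lv x, fst x)\<close> inverts \<open>?F\<close>, which sends a boundary
  point and a direction to the line through it. Continuity of the inverse is already known, so an
  invertible differential of \<open>?F\<close> is enough.\<close>

lemma lv_has_derivative:
  assumes x: "x \<in> lines"
  shows "(lv has_derivative (\<lambda>u. (q (lv x) (fst x) * fst u - snd u) / (r (lv x) * sin (lv x - fst x)))) (at x)"
proof -
  let ?F = "\<lambda>z. (snd z, k (fst z) (snd z))"
  let ?g = "\<lambda>x. (lv x, fst x)"
  let ?c = "r (lv x) * sin (lv x - fst x)"
  let ?F' = "\<lambda>u. (snd u, - ?c * fst u + q (lv x) (fst x) * snd u)"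
  let ?g' = "\<lambda>u. ((q (lv x) (fst x) * fst u - snd u) / ?c, fst u)"
  have c: "?c > 0" using sin_lv_pos[OF x] r_pos by simp
  have "(?g has_derivative ?g') (at x)"
  proof (rule has_derivative_inverse_basic[where f = ?F and f' = ?F' and T = lines])
    have "r (lv x) * sin (fst x - lv x) = - ?c" using sin_minus[of "lv x - fst x"] by simp
    then show "(?F has_derivative ?F') (at (?g x))"
      using has_derivative_Pair[OF has_derivative_snd[OF has_derivative_ident] k_has_derivative[of "(lv x, fst x)"]]
      by simp
    show "bounded_linear ?g'"
      unfolding linear_conv_bounded_linear[symmetric]
      by (rule linearI) (auto simp: algebra_simps add_divide_distrib diff_divide_distrib)
    show "?g' \<circ> ?F' = id" using c by (auto simp: fun_eq_iff)
    show "continuous (at x) ?g" by (intro continuous_intros lv_isCont[OF x])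
    show "open lines" by (rule lines_open)
    show "?F (?g z) = z" if "z \<in> lines" for z using lv_props(3)[of z] that lines_subset by auto
  qed (use x in simp)
  from has_derivative_fst[OF this] show ?thesis by simp
qed

definition ev :: "real \<times> real \<Rightarrow> real" where
  "ev x = lv (fst x, - snd x) - pi"

lemma lines_neg: "x \<in> lines \<Longrightarrow> (fst x, - snd x) \<in> lines"
  by (auto simp: lines_def)
lemma clines_neg: "x \<in> clines \<Longrightarrow> (fst x, - snd x) \<in> clines"
  by (auto simp: clines_def)

lemma ev_props:
  assumes "x \<in> clines"
  shows "fst x - pi \<le> ev x" "ev x \<le> fst x" "k (ev x) (fst x) = snd x"
  using lv_props[OF clines_neg[OF assms]] by (auto simp: ev_def k_mpi)

lemma ev_lines:
  assumes "x \<in> lines" shows "fst x - pi < ev x" "ev x < fst x"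
  using lv_lines[OF lines_neg[OF assms]] by (auto simp: ev_def)

lemma ev_eqI:
  assumes "f - pi \<le> t" "t \<le> f" "k t f = p" shows "(f,p) \<in> clines" "ev (f,p) = t"
  using lv_eqI[of f "t + pi" "- p"] assms by (auto simp: ev_def k_pi clines_def)

lemma ev_eqI':
  assumes "f - pi < t" "t < f" "k t f = p" shows "(f,p) \<in> lines" "ev (f,p) = t"
  using lv_eqI'[of f "t + pi" "- p"] assms by (auto simp: ev_def k_pi lines_def)

lemma ev_cont: "continuous_on clines ev"
  unfolding ev_def
  by (intro continuous_intros continuous_on_compose2[OF lv_cont]) (auto simp: clines_def)

lemma ev_has_derivative:
  assumes x: "x \<in> lines"
  shows "(ev has_derivative (\<lambda>u. (snd u - q (ev x) (fst x) * fst u) / (r (ev x) * sin (fst x - ev x)))) (at x)"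
proof -
  have n: "(fst x, - snd x) \<in> lines" using lines_neg[OF x] .
  have l: "lv (fst x, - snd x) = ev x + pi" by (simp add: ev_def)
  have "((\<lambda>x. (fst x, - snd x)) has_derivative (\<lambda>u. (fst u, - snd u))) (at x)"
    by (intro derivative_intros)
  from has_derivative_compose[OF this lv_has_derivative[OF n]]
  have "((\<lambda>x. lv (fst x, - snd x)) has_derivative
     (\<lambda>u. (- q (ev x) (fst x) * fst u + snd u) / (r (ev x) * sin (ev x + pi - fst x)))) (at x)"
    by (simp add: l r_pi q_pi)
  moreover have "sin (ev x + pi - fst x) = sin (fst x - ev x)"
    using sin_periodic_pi[of "ev x - fst x"] sin_minus[of "fst x - ev x"] by (simp add: algebra_simps)
  ultimately have "((\<lambda>x. lv (fst x, - snd x)) has_derivative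
     (\<lambda>u. (snd u - q (ev x) (fst x) * fst u) / (r (ev x) * sin (fst x - ev x)))) (at x)"
    by (simp add: algebra_simps)
  from has_derivative_diff[OF this has_derivative_const[of pi]]
  show ?thesis unfolding ev_def[abs_def] by simp
qed

text \<open>The billiard map: reflection at the point with normal angle \<open>\<psi>\<close> sends \<open>\<phi>\<close> to \<open>2\<psi> - \<phi>\<close>.\<close>

definition T :: "real \<times> real \<Rightarrow> real \<times> real" where
  "T x = (2 * lv x - fst x, k (lv x) (2 * lv x - fst x))"

lemma T_clines: assumes "x \<in> clines" shows "T x \<in> clines" "ev (T x) = lv x"
  unfolding T_def using lv_props[OF assms] by (intro ev_eqI; simp)+

lemma T_lines: assumes "x \<in> lines" shows "T x \<in> lines"
  unfolding T_def using lv_lines[OF assms] by (intro ev_eqI'; simp)+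

lemma T_cont: "continuous_on clines T"
  unfolding T_def by (intro continuous_intros lv_cont)

lemma fst_T_gt: assumes "x \<in> lines" shows "fst (T x) > fst x"
  using lv_lines[OF assms] by (simp add: T_def)

lemma T_boundary: "T (f, h f) = (f, h f)"
  using lv_eqI[of f f "h f"] by (simp add: T_def)

lemma Tn_boundary: "(T ^^ n) (f, h f) = (f, h f)"
  by (induction n) (auto simp: T_boundary)

lemma Tn_lines: "x \<in> lines \<Longrightarrow> (T ^^ n) x \<in> lines"
  by (induction n) (auto simp: T_lines)

lemma Tn_clines: "x \<in> clines \<Longrightarrow> (T ^^ n) x \<in> clines"
  by (induction n) (auto simp: T_clines)

lemma Tn_cont: "continuous_on clines (T ^^ n)"
proof (induction n)
  case (Suc n)
  then show ?case using Tn_clines by (auto intro!: continuous_on_compose2[OF T_cont, of _ "T ^^ n"] simp: o_def)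
qed (simp add: id_def)

definition dT :: "real \<times> real \<Rightarrow> real \<times> real \<Rightarrow> real \<times> real" where
  "dT x u = (let t = lv x; d = t - fst x; dt = (q t (fst x) * fst u - snd u) / (r t * sin d);
      df = 2 * dt - fst u in (df, r t * sin d * dt + q t (t + d) * df))"

lemma T_has_derivative:
  assumes x: "x \<in> lines" shows "(T has_derivative dT x) (at x)"
proof -
  note L = lv_has_derivative[OF x]
  let ?D = "\<lambda>u. (q (lv x) (fst x) * fst u - snd u) / (r (lv x) * sin (lv x - fst x))"
  have 1: "((\<lambda>x. 2 * lv x - fst x) has_derivative (\<lambda>u. 2 * ?D u - fst u)) (at x)"
    by (intro derivative_intros L)
  have "((\<lambda>x. (lv x, 2 * lv x - fst x)) has_derivative (\<lambda>u. (?D u, 2 * ?D u - fst u))) (at x)"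
    by (intro has_derivative_Pair L 1)
  from has_derivative_compose[OF this k_has_derivative]
  have "((\<lambda>x. k (lv x) (2 * lv x - fst x)) has_derivative
     (\<lambda>u. r (lv x) * sin (2 * lv x - fst x - lv x) * ?D u + q (lv x) (2 * lv x - fst x) * (2 * ?D u - fst u))) (at x)"
    by simp
  from has_derivative_Pair[OF 1 this]
  show ?thesis unfolding T_def[abs_def] dT_def Let_def by (simp add: algebra_simps)
qed

primrec dTn :: "nat \<Rightarrow> real \<times> real \<Rightarrow> real \<times> real \<Rightarrow> real \<times> real" where
  "dTn 0 x u = u"
| "dTn (Suc n) x u = dT ((T ^^ n) x) (dTn n x u)"

lemma Tn_has_derivative:
  assumes x: "x \<in> lines" shows "((T ^^ n) has_derivative dTn n x) (at x)"
proof (induction n)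
  case 0 then show ?case by (simp add: id_def[symmetric] dTn.simps[abs_def])
next
  case (Suc n)
  from has_derivative_compose[OF Suc T_has_derivative[OF Tn_lines[OF x]]]
  show ?case by (simp add: o_def dTn.simps[abs_def])
qed

end

section \<open>Curves of 4-periodic orbits\<close>

lemma funpow_commute: "(f ^^ m) ((f ^^ n) x) = (f ^^ n) ((f ^^ m) x)"
  by (metis add.commute comp_apply funpow_add)

section \<open>The twist condition\<close>

context oval begin

lemma k_add: "k t (f + d) = k t f * cos d + q t f * sin d"
proof -
  have "f + d - t = (f - t) + d" by simp
  then show ?thesis unfolding k_def q_def by (simp only: cos_add sin_add) (simp add: algebra_simps)
qed

lemma k_less_h': assumes "f - 2 * pi < t" "t < f + 2 * pi" "t \<noteq> f" shows "k t f < h f"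
proof -
  consider "t < f - pi" | "f - pi \<le> t" "t \<le> f + pi" | "f + pi < t" by linarith
  then show ?thesis
  proof cases
    case 1 then show ?thesis using k_less_h[of f "t + 2 * pi"] k_periodic[of t f] assms by auto
  next
    case 2 then show ?thesis using k_less_h assms by auto
  next
    case 3 then show ?thesis using k_less_h[of f "t - 2 * pi"] k_periodic[of "t - 2 * pi" f] assms by auto
  qed
qed

end

context symmetric_oval begin

text \<open>The chord cut out by a line has length \<open>q (lv x) (fst x) - q (ev x) (fst x)\<close>.\<close>

lemma chord_pos:
  assumes x: "x \<in> lines" shows "q (lv x) (fst x) - q (ev x) (fst x) > 0"
proof -
  let ?d = "lv x - fst x"
  have c: "x \<in> clines" using x lines_subset by auto
  \<comment> \<open>The entry point lies strictly below the tangent line at the exit point; since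
    both ends have the same height along \<open>cis (fst x)\<close>, only their \<open>q\<close>
    values can make this difference.\<close>
  have "k (ev x) (lv x) < h (lv x)"
    using lv_lines[OF x] ev_lines[OF x] by (intro k_less_h') auto
  moreover have "k (ev x) (fst x + ?d) = snd x * cos ?d + q (ev x) (fst x) * sin ?d"
    using ev_props[OF c] by (subst k_add) simp
  moreover have "k (lv x) (fst x + ?d) = snd x * cos ?d + q (lv x) (fst x) * sin ?d"
    using lv_props[OF c] by (subst k_add) simp
  ultimately have "0 < (q (lv x) (fst x) - q (ev x) (fst x)) * sin ?d" by (simp add: algebra_simps)
  then show ?thesis using sin_lv_pos[OF x] by (simp add: zero_less_mult_iff)
qed

text \<open>The twist condition. When the chord of \<open>x\<close> is turned about its entry point
  by \<open>?e\<close>, the height of the old exit point exceeds that of the new line by the chord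
  length times \<open>sin ?e\<close>; by monotonicity of \<open>k\<close> the new exit point comes
  later.\<close>

lemma lv_less:
  assumes x: "x \<in> lines" and y: "y \<in> lines" and e: "ev x = ev y" and l: "fst x < fst y"
  shows "lv x < lv y"
proof -
  let ?e = "fst y - fst x"
  have c: "x \<in> clines" "y \<in> clines" using x y lines_subset by auto
  have "k (lv x) (fst x + ?e) - k (ev x) (fst x + ?e) = (q (lv x) (fst x) - q (ev x) (fst x)) * sin ?e"
    using ev_props[OF c(1)] lv_props[OF c(1)] by (subst k_add, subst k_add) (simp add: algebra_simps)
  moreover have "sin ?e > 0" using l ev_lines[OF x] ev_lines[OF y] e by (intro sin_gt_zero) auto
  ultimately have "k (lv x) (fst y) - k (ev x) (fst y) > 0" using chord_pos[OF x] by simp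
  then have *: "k (lv x) (fst y) > k (lv y) (fst y)" using ev_props[OF c(2)] lv_props[OF c(2)] e by simp
  show ?thesis
  proof (rule ccontr)
    assume "\<not> lv x < lv y"
    then show False
      using k_strict_dec[of "fst y" "lv y" "lv x"] * lv_lines[OF x] lv_lines[OF y] l
      by (cases "lv y = lv x") auto
  qed
qed

lemma lines_clines: "x \<in> lines \<Longrightarrow> x \<in> clines"
  using lines_subset by auto

lemma line_eqI: assumes "x \<in> lines" "y \<in> lines" "ev x = ev y" "lv x = lv y" shows "x = y"
proof -
  have "fst x = fst y" using lv_less[of x y] lv_less[of y x] assms by (cases "fst x" "fst y" rule: linorder_cases) auto
  then show ?thesis
    using assms ev_props(3)[OF lines_clines[OF assms(1)]] ev_props(3)[OF lines_clines[OF assms(2)]]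
    by (auto intro: prod_eqI)
qed

lemma ev_less:
  assumes "x \<in> lines" "y \<in> lines" "lv x = lv y" "fst x < fst y"
  shows "ev x < ev y"
  using lv_less[OF lines_neg[OF assms(1)] lines_neg[OF assms(2)]] assms by (simp add: ev_def)

text \<open>The orbits share a reflection point and the neighbours of \<open>y\<close> do not run
  ahead of those of \<open>x\<close>. By the twist condition the previous neighbour gives
  \<open>fst y \<le> fst x\<close> and the next one \<open>fst (T y) \<le> fst (T x)\<close>; the
  reflection law reverses the second inequality.\<close>

lemma touching:
  assumes x: "x \<in> lines" and y: "y \<in> lines"
    and "lv y = lv x" "ev y \<le> ev x" "lv (T y) \<le> lv (T x)"
  shows "y = x"
proof -
  have e: "ev (T x) = lv x" "ev (T y) = lv y" using T_clines(2) lines_clines x y by blast+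
  have "fst y \<le> fst x" using ev_less[OF x y] assms by fastforce
  moreover have "fst (T y) \<le> fst (T x)" using lv_less[OF T_lines[OF x] T_lines[OF y]] e assms by fastforce
  ultimately have "fst y = fst x" using assms(3) by (simp add: T_def)
  then show ?thesis using lv_props(3)[OF lines_clines[OF x]] lv_props(3)[OF lines_clines[OF y]] assms
    by (auto intro: prod_eqI)
qed

section \<open>Equivariance under the central symmetry\<close>

lemma lines_shift: "x \<in> lines \<Longrightarrow> x + (pi, 0) \<in> lines"
  by (cases x) (auto simp: lines_def h_pi)

lemma lv_shift: assumes "x \<in> clines" shows "lv (x + (pi, 0)) = lv x + pi"
  using lv_props[OF assms] lv_eqI(2)[of "fst x + pi" "lv x + pi" "snd x"]
  by (cases x) (auto simp: k_pi k_pi2)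

lemma ev_shift: assumes "x \<in> clines" shows "ev (x + (pi, 0)) = ev x + pi"
  using lv_shift[OF clines_neg[OF assms]] by (cases x) (simp add: ev_def)

lemma T_shift: assumes "x \<in> clines" shows "T (x + (pi, 0)) = T x + (pi, 0)"
proof -
  have "2 * (lv x + pi) - (fst x + pi) = 2 * lv x - fst x + pi" by simp
  moreover have "k (lv x + pi) (2 * lv x - fst x + pi) = k (lv x) (2 * lv x - fst x)"
    by (simp only: k_pi k_pi2 minus_minus)
  ultimately show ?thesis by (simp only: T_def lv_shift[OF assms] fst_add fst_conv) simp
qed

lemma Tn_shift: assumes "x \<in> lines" shows "(T ^^ n) (x + (pi, 0)) = (T ^^ n) x + (pi, 0)"
  using assms by (induction n) (simp_all add: T_shift Tn_clines lines_subset[THEN subsetD])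

lemma shift2: "x + (2 * pi, 0) = (x + (pi, 0)) + (pi, 0)" for x :: "real \<times> real"
  by (cases x) simp

lemma lines_shift2: "x \<in> lines \<Longrightarrow> x + (2 * pi, 0) \<in> lines"
  unfolding shift2 by (intro lines_shift)
lemma ev_shift2: "x \<in> lines \<Longrightarrow> ev (x + (2 * pi, 0)) = ev x + 2 * pi"
  unfolding shift2 by (subst ev_shift; simp add: lines_shift lines_subset[THEN subsetD] ev_shift)
lemma lv_shift2: "x \<in> lines \<Longrightarrow> lv (x + (2 * pi, 0)) = lv x + 2 * pi"
  unfolding shift2 by (subst lv_shift; simp add: lines_shift lines_subset[THEN subsetD] lv_shift)
lemma Tn_shift2: "x \<in> lines \<Longrightarrow> (T ^^ n) (x + (2 * pi, 0)) = (T ^^ n) x + (2 * pi, 0)"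
  unfolding shift2 by (simp only: Tn_shift lines_shift)

end

text \<open>The lift \<open>g\<close> of the invariant curve. The period \<open>2 * pi\<close> of its orbits encodes the rotation
  number \<open>1/4\<close>.\<close>

locale quarter_curve = symmetric_oval +
  fixes g :: "real \<Rightarrow> real \<times> real"
  assumes g_cont: "continuous_on UNIV g"
    and g_lines: "g t \<in> lines"
    and g_period: "(T ^^ 4) (g t) = g t + (2 * pi, 0)"
    and g_shift: "g (t + 1) = g t + (2 * pi, 0)"
    and g_inj: "inj g"
begin

definition y :: "nat \<Rightarrow> real \<Rightarrow> real" where "y i t = ev ((T ^^ i) (g t))"

lemma y_cont: "continuous_on UNIV (y i)"
proof -
  have 1: "continuous_on UNIV (\<lambda>t. (T ^^ i) (g t))"
    by (rule continuous_on_compose2[OF Tn_cont g_cont]) (use g_lines lines_subset in auto)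
  show ?thesis unfolding y_def
    by (rule continuous_on_compose2[OF ev_cont 1]) (use Tn_lines[OF g_lines] lines_subset in auto)
qed

lemma y_shift: "y i (t + 1) = y i t + 2 * pi"
  unfolding y_def g_shift by (simp add: Tn_shift2 g_lines ev_shift2 Tn_lines)

lemma y_shift_nat: "y i (t + real n) = y i t + 2 * pi * real n"
proof (induction n)
  case (Suc n) then show ?case using y_shift[of i "t + real n"] by (simp add: algebra_simps)
qed simp

lemma y_shift_nat': "y i (t - real n) = y i t - 2 * pi * real n"
  using y_shift_nat[of i "t - real n" n] by simp

text \<open>Move the orbits of the curve up from below until one of them first touches the orbit of \<open>x\<close>;
  by \<open>touching\<close> it is the orbit of \<open>x\<close>.\<close>

lemma touch_first:
  assumes x: "x \<in> lines" and per: "(T ^^ 4) x = x + (2 * pi, 0)"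
  obtains t0 where "g t0 = x" "\<And>t i. t < t0 \<Longrightarrow> i < 4 \<Longrightarrow> y i t < ev ((T ^^ i) x)"
proof -
  define X where "X i = ev ((T ^^ i) x)" for i
  define S where "S = {t. \<exists>i<4. y i t \<ge> X i}"
  have yp: "y (i + 4) t = y i t + 2 * pi" for i t
    by (simp add: y_def funpow_add g_period Tn_shift2 g_lines ev_shift2 Tn_lines)
  have Xp: "X (i + 4) = X i + 2 * pi" for i
    by (simp add: X_def funpow_add per Tn_shift2 x ev_shift2 Tn_lines)
  have "S = (\<Union>i<4. {t. X i \<le> y i t})" by (auto simp: S_def)
  moreover have "closed {t. X i \<le> y i t}" for i
    by (intro closed_Collect_le continuous_intros y_cont)
  ultimately have cl: "closed S" by (simp add: closed_UN)
  have ne: "S \<noteq> {}"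
  proof -
    obtain n :: nat where "X 0 - y 0 0 \<le> real n" using real_arch_simple[of "X 0 - y 0 0"] by blast
    moreover have "real n \<le> 2 * pi * real n" using pi_gt3 by (simp add: mult_le_cancel_right1)
    ultimately have "X 0 \<le> y 0 (0 + real n)" unfolding y_shift_nat by simp
    then have "0 + real n \<in> S" unfolding S_def by (intro CollectI exI[of _ 0]) simp
    then show ?thesis by blast
  qed
  have bd: "bdd_below S"
  proof -
    have ex: "\<exists>B. \<forall>t\<in>U. B \<le> t" if "i < 4" "U = {t. X i \<le> y i t}" for i U
    proof -
      have "compact (y i ` {0..1})" by (intro compact_continuous_image continuous_on_subset[OF y_cont]) auto
      then obtain M where M: "\<And>t. 0 \<le> t \<Longrightarrow> t \<le> 1 \<Longrightarrow> y i t \<le> M"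
        using bounded_has_Sup(1)[OF compact_imp_bounded] by (metis (no_types, lifting) atLeastAtMost_iff empty_iff image_eqI)
      obtain n :: nat where n: "M - X i < real n" using reals_Archimedean2 by blast
      have "- real n \<le> t" if "t \<in> U" for t
      proof (rule ccontr)
        assume "\<not> - real n \<le> t"
        define m where "m = nat (- \<lfloor>t\<rfloor>)"
        have fl: "real_of_int \<lfloor>t\<rfloor> \<le> t" "t < real_of_int \<lfloor>t\<rfloor> + 1" by linarith+
        have m: "real m = - real_of_int \<lfloor>t\<rfloor>" "real n \<le> real m"
          using \<open>\<not> - real n \<le> t\<close> fl unfolding m_def by linarith+
        have "y i t = y i (t + real m) - 2 * pi * real m" using y_shift_nat by simp
        also have "\<dots> \<le> M - real m"
        proof -
          have "y i (t + real m) \<le> M" using fl m by (intro M) linarith+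
          moreover have "real m \<le> 2 * pi * real m" using pi_gt3 by (simp add: mult_le_cancel_right1)
          ultimately show ?thesis by simp
        qed
        also have "\<dots> < X i" using n m by simp
        finally show False using that \<open>U = _\<close> by auto
      qed
      then show ?thesis by blast
    qed
    have "bdd_below {t. X i \<le> y i t}" if "i < 4" for i using ex[OF that refl] by (auto simp: bdd_below_def)
    then have "bdd_below (\<Union>i<4. {t. X i \<le> y i t})" by (intro bdd_below_UN[THEN iffD2]) auto
    moreover have "S = (\<Union>i<4. {t. X i \<le> y i t})" by (auto simp: S_def)
    ultimately show ?thesis by simp
  qed
  define t0 where "t0 = Inf S"
  have t0S: "t0 \<in> S" unfolding t0_def by (rule closed_contains_Inf[OF ne bd cl])
  have below: "y i t < X i" if "t < t0" "i < 4" for t i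
    using that cInf_lower[OF _ bd, of t] by (force simp: S_def t0_def)
  have le4: "y i t0 \<le> X i" if "i < 4" for i
  proof (rule tendsto_upperbound)
    show "(y i \<longlongrightarrow> y i t0) (at_left t0)"
      using y_cont[of i] by (meson UNIV_I continuous_on_def tendsto_within_subset[OF _ subset_UNIV])
    show "\<forall>\<^sub>F t in at_left t0. y i t \<le> X i"
      unfolding eventually_at_filter using below that by (intro always_eventually) force
  qed simp
  \<comment> \<open>Periodicity extends the inequality to all indices. \<open>touching\<close> needs
    the neighbours of the index \<open>j + 4\<close>, chosen so that a predecessor exists even for
    \<open>j = 0\<close>.\<close>
  have le: "y i t0 \<le> X i" for i
  proof (induction i rule: less_induct)
    case (less i)
    show ?case
    proof (cases "i < 4")
      case False
      then have "y (i - 4 + 4) t0 \<le> X (i - 4 + 4)" unfolding yp Xp using less[of "i - 4"] by simp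
      then show ?thesis using False by simp
    qed (rule le4)
  qed
  obtain j where j': "j < 4" "X j \<le> y j t0" using t0S unfolding S_def by blast
  then have j: "j < 4" "y j t0 = X j" using le[of j] by auto
  let ?y = "(T ^^ (j + 3)) (g t0)" and ?x = "(T ^^ (j + 3)) x"
  have sub: "z \<in> lines \<Longrightarrow> z \<in> clines" for z using lines_subset by auto
  have lvT: "lv z = ev (T z)" if "z \<in> lines" for z using T_clines(2)[OF sub[OF that]] by simp
  have "?y = ?x"
  proof (rule touching)
    show yx: "?x \<in> lines" "?y \<in> lines" using Tn_lines x g_lines by auto
    have "lv ?y = y (j + 4) t0" by (subst lvT[OF yx(2)]) (simp add: y_def eval_nat_numeral)
    moreover have "lv ?x = X (j + 4)" by (subst lvT[OF yx(1)]) (simp add: X_def eval_nat_numeral)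
    ultimately show "lv ?y = lv ?x" using j by (simp add: yp Xp)
    show "ev ?y \<le> ev ?x" using le[of "j + 3"] by (simp add: y_def X_def)
    have "lv (T ?y) = y (j + 5) t0" by (subst lvT[OF T_lines[OF yx(2)]]) (simp add: y_def eval_nat_numeral)
    moreover have "lv (T ?x) = X (j + 5)" by (subst lvT[OF T_lines[OF yx(1)]]) (simp add: X_def eval_nat_numeral)
    ultimately show "lv (T ?y) \<le> lv (T ?x)" using le by simp
  qed
  \<comment> \<open>Injectivity of \<open>T\<close> is avoided: carried on to time 8, both orbits
    are their starting lines translated by two turns.\<close>
  then have "(T ^^ (5 - j)) ?y = (T ^^ (5 - j)) ?x" by simp
  then have "(T ^^ (4 + 4)) (g t0) = (T ^^ (4 + 4)) x"
    using j by (simp only: funpow_add[symmetric] o_apply[symmetric, of "T ^^ (5 - j)"]) simp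
  then have "g t0 = x" by (simp only: funpow_add o_apply g_period per Tn_shift2 x g_lines add_right_cancel)
  then show ?thesis using that below by (auto simp: X_def)
qed

lemma touch_ex:
  assumes "x \<in> lines" "(T ^^ 4) x = x + (2 * pi, 0)"
  shows "\<exists>t. g t = x"
  by (rule touch_first[OF assms]) (rule exI)

text \<open>By injectivity of \<open>g\<close> the first orbit to touch that of \<open>g t\<close>
  is that orbit itself, so all earlier ones lie strictly behind it.\<close>

lemma y_strict: assumes "s < t" "i < 4" shows "y i s < y i t"
proof -
  from touch_first[OF g_lines g_period[of t]] obtain t0 where
    t0: "g t0 = g t" "\<And>u i. u < t0 \<Longrightarrow> i < 4 \<Longrightarrow> y i u < ev ((T ^^ i) (g t))" by blast
  then have "t0 = t" using g_inj by (auto dest: injD)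
  then show ?thesis using t0(2) assms by (simp add: y_def)
qed

text \<open>On the totally ordered family of orbits \<open>T\<^sup>2\<close> and the central symmetry commute and have the same
  square, hence they agree: the orbits are parallelograms.\<close>

lemma T2_g: "(T ^^ 2) (g t) = g t + (pi, 0)"
proof -
  have "(T ^^ 4) (g t + (pi, 0)) = (g t + (pi, 0)) + (2 * pi, 0)"
    by (simp only: Tn_shift[OF g_lines] g_period) simp
  from touch_ex[OF lines_shift[OF g_lines] this] obtain a where a: "g a = g t + (pi, 0)" by blast
  have "(T ^^ 4) ((T ^^ 2) (g t)) = (T ^^ 2) ((T ^^ 4) (g t))"
    by (rule funpow_commute)
  then have "(T ^^ 4) ((T ^^ 2) (g t)) = (T ^^ 2) (g t) + (2 * pi, 0)"
    by (simp only: g_period Tn_shift2[OF g_lines])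
  from touch_ex[OF Tn_lines[OF g_lines] this] obtain b where b: "g b = (T ^^ 2) (g t)" by blast
  have sub: "z \<in> lines \<Longrightarrow> z \<in> clines" for z using lines_subset by auto
  have y0b: "y 0 b = y 2 t" by (simp add: y_def b)
  have y0a: "y 0 a = y 0 t + pi" by (simp add: y_def a ev_shift g_lines sub)
  have y2a: "y 2 a = y 2 t + pi" unfolding y_def a by (subst Tn_shift) (simp_all add: g_lines Tn_lines sub ev_shift)
  have "(T ^^ 2) ((T ^^ 2) (g t)) = (T ^^ 4) (g t)"
    using fun_cong[OF funpow_add[of 2 2 T], of "g t"] by simp
  then have y2b: "y 2 b = y 0 t + 2 * pi" unfolding y_def b by (simp add: g_period ev_shift2 g_lines)
  \<comment> \<open>If \<open>b < a\<close>, the order at index 0 says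
    \<open>y 2 t < y 0 t + pi\<close> and at index 2 the opposite; likewise for
    \<open>a < b\<close>.\<close>
  have "b = a"
  proof (cases b a rule: linorder_cases)
    case less then show ?thesis using y_strict[OF less, of 0] y_strict[OF less, of 2] y0a y0b y2a y2b by simp
  next
    case greater then show ?thesis using y_strict[OF greater, of 0] y_strict[OF greater, of 2] y0a y0b y2a y2b by simp
  qed
  then show ?thesis using a b by simp
qed

text \<open>By \<open>T2_g\<close> two reflections add \<open>pi\<close> to \<open>fst\<close>,
  while by the reflection law they add twice the difference of the two normal angles. Starting one
  step earlier, at \<open>g b\<close>, places this difference at the ends of the chord
  \<open>g t\<close>.\<close>

lemma quarter_step: "lv (g t) = ev (g t) + pi / 2"
proof -
  have "(T ^^ 4) ((T ^^ 3) (g t)) = (T ^^ 3) ((T ^^ 4) (g t))"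
    by (rule funpow_commute)
  then have "(T ^^ 4) ((T ^^ 3) (g t)) = (T ^^ 3) (g t) + (2 * pi, 0)"
    by (simp only: g_period Tn_shift2[OF g_lines])
  from touch_ex[OF Tn_lines[OF g_lines] this] obtain b where b: "g b = (T ^^ 3) (g t)" by blast
  have T1: "T (g b) = g t + (2 * pi, 0)" unfolding b g_period[of t, symmetric] by (simp add: eval_nat_numeral)
  have T2: "fst (T (T (g b))) = fst (g b) + pi" using T2_g[of b] by (simp add: eval_nat_numeral)
  have "fst (T (T (g b))) = 2 * lv (T (g b)) - (2 * lv (g b) - fst (g b))" by (simp add: T_def)
  then have "lv (T (g b)) - lv (g b) = pi / 2" using T2 by simp
  moreover have "lv (g b) = ev (T (g b))" using T_clines(2)[OF lines_clines[OF g_lines]] by simp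
  ultimately show ?thesis unfolding T1 by (simp add: ev_shift2 lv_shift2 g_lines)
qed

lemma ev_g_surj: "\<exists>t. ev (g t) = s"
proof -
  obtain n :: nat where n: "\<bar>s - y 0 0\<bar> \<le> real n" using real_arch_simple[of "\<bar>s - y 0 0\<bar>"] by blast
  have "real n \<le> 2 * pi * real n" using pi_gt3 by (simp add: mult_le_cancel_right1)
  then have "y 0 (0 - real n) \<le> s" "s \<le> y 0 (0 + real n)" unfolding y_shift_nat y_shift_nat' using n by auto
  then have "\<exists>t\<ge>0 - real n. t \<le> 0 + real n \<and> y 0 t = s"
    by (intro IVT' continuous_on_subset[OF y_cont]) auto
  then show ?thesis by (auto simp: y_def)
qed

text \<open>Two consecutive chords lead from \<open>s\<close> to \<open>s + pi / 2\<close> and on to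
  \<open>s + pi\<close>. Each gives an equation, its ends having equal height along its normal; the
  relations are the sum and the difference of the two.\<close>

lemma quarter_relations:
  obtains d where "0 < d" "d < pi / 2"
    "h s * cos d = h (s + pi / 2) * sin d" "h1 s * sin d = - h1 (s + pi / 2) * cos d"
proof -
  obtain t where t: "ev (g t) = s" using ev_g_surj by blast
  define d where "d = fst (g t) - s"
  have sub: "z \<in> lines \<Longrightarrow> z \<in> clines" for z using lines_subset by auto
  have f: "fst (g t) = s + d" by (simp add: d_def)
  have l: "lv (g t) = s + pi / 2" using quarter_step t by simp
  have d: "0 < d" "d < pi / 2" using ev_lines[OF g_lines, of t] lv_lines[OF g_lines, of t] t l f by auto
  have e1: "k s (s + d) = k (s + pi/2) (s + d)"
    using ev_props(3)[OF sub[OF g_lines], of t] lv_props(3)[OF sub[OF g_lines], of t] t l f by simp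
  have TL: "T (g t) \<in> lines" using T_lines g_lines by auto
  have f1: "fst (T (g t)) = s + (pi - d)" by (simp add: T_def l f)
  have "T (T (g t)) = g t + (pi, 0)" using T2_g[of t] by (simp add: eval_nat_numeral)
  then have "lv (T (g t)) = ev (g t) + pi"
    using T_clines(2)[OF sub[OF TL]] ev_shift[OF sub[OF g_lines], of t] by simp
  then have e2: "k (s + pi/2) (s + (pi - d)) = k (s + pi) (s + (pi - d))"
    using ev_props(3)[OF sub[OF TL]] lv_props(3)[OF sub[OF TL]] T_clines(2)[OF sub[OF g_lines], of t] l f1 t by simp
  have a1: "s + d - (s + pi/2) = - (pi/2 - d)" "s + (pi - d) - (s + pi/2) = pi/2 - d" "s + (pi - d) - (s + pi) = - d" by auto
  have "h s * cos d + h1 s * sin d = h (s + pi/2) * sin d - h1 (s + pi/2) * cos d"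
    using e1 unfolding k_def a1 by (simp add: cos_diff sin_diff)
  moreover have "h (s + pi/2) * sin d + h1 (s + pi/2) * cos d = h s * cos d - h1 s * sin d"
    using e2 unfolding k_def a1 h_pi h1_pi by (simp add: cos_diff sin_diff)
  ultimately show ?thesis using d by (intro that[of d]) (auto simp: algebra_simps)
qed

text \<open>Multiplied together, the two relations lose \<open>d\<close> up to the factor
  \<open>cos d * sin d\<close> and say that the derivative of the sum vanishes. Geometrically, the
  corners of all circumscribed rectangles lie on a circle of radius \<open>R\<close> about the
  centre.\<close>

lemma sum_squares_const: "\<exists>R>0. \<forall>s. (h s)\<^sup>2 + (h (s + pi / 2))\<^sup>2 = R\<^sup>2"
proof -
  let ?F = "\<lambda>s. (h s)\<^sup>2 + (h (s + pi / 2))\<^sup>2"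
  have "(?F has_real_derivative 0) (at s)" for s
  proof -
    obtain d where d: "0 < d" "d < pi / 2" "h s * cos d = h (s + pi / 2) * sin d" "h1 s * sin d = - h1 (s + pi / 2) * cos d"
      using quarter_relations .
    have "sin d > 0" "cos d > 0" using d by (auto intro!: sin_gt_zero cos_gt_zero)
    moreover have "(h s * h1 s + h (s + pi/2) * h1 (s + pi/2)) * (cos d * sin d) = 0"
    proof -
      have "(h s * h1 s) * (cos d * sin d) = (h s * cos d) * (h1 s * sin d)" by simp
      also have "\<dots> = - (h (s + pi / 2) * h1 (s + pi/2)) * (cos d * sin d)" unfolding d by simp
      finally show ?thesis by (simp add: algebra_simps)
    qed
    ultimately have z: "h s * h1 s + h (s + pi/2) * h1 (s + pi/2) = 0" by simp
    have "((\<lambda>s. h (s + pi/2)) has_real_derivative h1 (s + pi/2)) (at s)"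
      using h_deriv[of "s + pi/2"] by (simp add: DERIV_shift)
    then have "(?F has_real_derivative 2 * (h s * h1 s + h (s + pi/2) * h1 (s + pi/2))) (at s)"
      by (auto intro!: derivative_eq_intros h_deriv[of s] simp: algebra_simps)
    then show ?thesis using z by simp
  qed
  then have "?F s = ?F 0" for s by (rule DERIV_isconst_all[rule_format])
  moreover have "?F 0 > 0" using h_pos[of 0] by (simp add: add_pos_nonneg)
  ultimately show ?thesis by (intro exI[of _ "sqrt (?F 0)"]) auto
qed

end

section \<open>Positive Jacobi fields\<close>

text \<open>If \<open>f'\<close> were negative at \<open>b\<close>, then \<open>f\<close> would
  exceed \<open>f b\<close> just before \<open>b\<close> and be smaller near \<open>a\<close>, so it
  would take the value \<open>f b\<close> once more and Rolle's theorem would give a zero of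
  \<open>f'\<close>. The interval is open at \<open>a\<close> because the leaves to which this is
  applied end at a tangent line, where no differential is available.\<close>

lemma rolle_from_endpoint:
  fixes f f' :: "real \<Rightarrow> real"
  assumes "a < b"
    and der: "\<And>t. a < t \<Longrightarrow> t \<le> b \<Longrightarrow> (f has_real_derivative f' t) (at t)"
    and nz: "\<And>t. a < t \<Longrightarrow> t \<le> b \<Longrightarrow> f' t \<noteq> 0"
    and gt: "\<And>t. a < t \<Longrightarrow> t \<le> b \<Longrightarrow> f t > c"
    and lim: "(f \<longlongrightarrow> c) (at_right a)"
  shows "f' b > 0"
proof (rule ccontr)
  assume "\<not> f' b > 0"
  then have neg: "f' b < 0" using nz[of b] assms(1) by auto
  from DERIV_neg_dec_left[OF der[of b] neg] obtain e where e: "e > 0" "\<And>h. 0 < h \<Longrightarrow> h < e \<Longrightarrow> f b < f (b - h)"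
    using assms(1) by auto
  define u where "u = b - min e (b - a) / 2"
  have u: "a < u" "u < b" "f b < f u"
    using e(2)[of "min e (b - a) / 2"] e(1) assms(1) by (auto simp: u_def min_def field_simps)
  have "\<forall>\<^sub>F t in at_right a. f t < f b" using order_tendstoD(2)[OF lim] gt[of b] assms(1) by auto
  moreover have "\<forall>\<^sub>F t in at_right a. t < u" by (rule eventually_at_rightI[of a u]) (use u in auto)
  moreover have "\<forall>\<^sub>F t in at_right a. t > a" by (rule eventually_at_right_less)
  ultimately have "\<forall>\<^sub>F t in at_right a. f t < f b \<and> t < u \<and> a < t" by eventually_elim auto
  then obtain v where v: "f v < f b" "v < u" "a < v"
    using eventually_happens'[OF trivial_limit_at_right_real] by blast
  have cont: "continuous_on {s..b} f" if "a < s" for s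
    using der that by (intro DERIV_continuous_on[where D = f'])
      (auto intro: has_field_derivative_at_within)
  obtain w where w: "v \<le> w" "w \<le> u" "f w = f b"
    using IVT'[of f v "f b" u] v u continuous_on_subset[OF cont[of v]] by force
  have "\<exists>z>w. z < b \<and> (f has_real_derivative 0) (at z)"
  proof (rule Rolle)
    show "w < b" "f w = f b" "continuous_on {w..b} f" using w u v cont by auto
    show "f differentiable (at x)" if "w < x" "x < b" for x
      using der[of x] that w v by (auto simp: real_differentiable_def)
  qed
  then obtain z where z: "w < z" "z < b" "(f has_real_derivative 0) (at z)" by blast
  have "a < z" "z \<le> b" using z w v by auto
  then show False using DERIV_unique[OF z(3) der[of z]] nz[of z] by auto
qed

context symmetric_oval begin

text \<open>Coordinates \<open>(s, d)\<close>: the line entering, respectively leaving, at the point with normal angle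
  \<open>s\<close> at the angle \<open>d\<close> to the tangent.\<close>

definition enter :: "real \<Rightarrow> real \<Rightarrow> real \<times> real" where
  "enter s d = (s + d, k s (s + d))"

definition leave :: "real \<Rightarrow> real \<Rightarrow> real \<times> real" where
  "leave s d = (s - d, k s (s - d))"

lemma enter_lines: assumes "0 < d" "d < pi" shows "enter s d \<in> lines" "ev (enter s d) = s"
  unfolding enter_def by (rule ev_eqI'; use assms in simp)+

lemma leave_lines: assumes "0 < d" "d < pi" shows "leave s d \<in> lines" "lv (leave s d) = s"
  unfolding leave_def by (rule lv_eqI'; use assms in simp)+

lemma enter_ev: "x \<in> lines \<Longrightarrow> enter (ev x) (fst x - ev x) = x"
  using ev_props(3)[OF lines_clines] by (simp add: enter_def)

lemma T_leave: assumes "0 < d" "d < pi" shows "T (leave s d) = enter s d"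
proof -
  have "2 * s - (s - d) = s + d" by simp
  then show ?thesis unfolding T_def leave_lines(2)[OF assms] by (simp only: leave_def enter_def fst_conv)
qed

lemma enter_cont: "continuous_on S (\<lambda>z. enter (fst z) (snd z))" for S :: "(real \<times> real) set"
  unfolding enter_def by (intro continuous_intros)

lemma leave_cont: "continuous_on S (\<lambda>z. leave (fst z) (snd z))" for S :: "(real \<times> real) set"
  unfolding leave_def by (intro continuous_intros)

lemma enter_has_vector_derivative:
  "((\<lambda>d. enter s d) has_vector_derivative (1, q s (s + d))) (at d)"
proof -
  have "((\<lambda>d. k s (s + d)) has_real_derivative q s (s + d)) (at d)"
  proof -
    have "((\<lambda>d. s + d) has_real_derivative 1) (at d)" by (auto intro!: derivative_eq_intros)
    from DERIV_chain2[OF k_deriv2 this] show ?thesis by simp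
  qed
  then show ?thesis unfolding enter_def
    by (intro has_vector_derivative_Pair) (auto simp: has_real_derivative_iff_has_vector_derivative intro!: derivative_eq_intros)
qed

text \<open>Since the chords of the invariant curve of \<open>4\<close>-periodic orbits turn out to span exactly a quarter
  turn of the normal, these are the lines below it.\<close>

definition low :: "(real \<times> real) set" where
  "low = {x \<in> lines. lv x - ev x < pi / 2}"

lemma low_lines: "x \<in> low \<Longrightarrow> x \<in> lines"
  by (simp add: low_def)

lemma low_open: "open low"
proof -
  have "continuous_on lines (\<lambda>x. lv x - ev x)"
    by (intro continuous_intros continuous_on_subset[OF lv_cont] continuous_on_subset[OF ev_cont] lines_subset)
  from continuous_open_preimage[OF this lines_open, of "{..<pi/2}"]
  have "open (lines \<inter> (\<lambda>x. lv x - ev x) -` {..<pi/2})" by simp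
  moreover have "low = lines \<inter> (\<lambda>x. lv x - ev x) -` {..<pi/2}" by (auto simp: low_def)
  ultimately show ?thesis by simp
qed

text \<open>Moving a line outwards parallel to itself shrinks its arc at both ends. So a leaf
  \<open>fst = const\<close> that meets \<open>low\<close> meets it in an interval reaching up to
  the tangent line.\<close>

lemma low_upward:
  assumes "(f, p) \<in> low" "p \<le> p'" "p' < h f" shows "(f, p') \<in> low"
proof -
  have l: "(f,p) \<in> lines" using assms by (auto simp: low_def)
  then have l': "(f,p') \<in> lines" using assms by (auto simp: lines_def)
  have "lv (f, p') \<le> lv (f, p)"
  proof (rule ccontr)
    assume "\<not> ?thesis"
    then show False using k_strict_dec[of f "lv (f,p)" "lv (f,p')"] assms(2)
        lv_props[OF lines_clines[OF l]] lv_props[OF lines_clines[OF l']] by auto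
  qed
  moreover have "ev (f, p) \<le> ev (f, p')"
  proof (rule ccontr)
    assume "\<not> ?thesis"
    then show False using k_strict_inc[of f "ev (f,p')" "ev (f,p)"] assms(2)
        ev_props[OF lines_clines[OF l]] ev_props[OF lines_clines[OF l']] by auto
  qed
  ultimately show ?thesis using l' assms(1) by (auto simp: low_def)
qed

lemma fst_Tn_gt: assumes "x \<in> lines" "n > 0" shows "fst ((T ^^ n) x) > fst x"
  using assms(2)
proof (induction n)
  case (Suc n)
  then show ?case using fst_T_gt[OF Tn_lines[OF assms(1)], of n] by (cases "n = 0") auto
qed simp

lemma ev_Tn_gt: assumes "x \<in> lines" "n > 0" shows "ev ((T ^^ n) x) > ev x"
  using assms(2)
proof (induction n)
  case (Suc n)
  have "ev (T ((T ^^ n) x)) > ev ((T ^^ n) x)"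
    using T_clines(2)[OF lines_clines[OF Tn_lines[OF assms(1)]]] ev_lines[OF Tn_lines[OF assms(1)], of n] lv_lines[OF Tn_lines[OF assms(1)], of n] by simp
  then show ?case using Suc by (cases "n = 0") auto
qed simp

lemma Tn_limit_boundary:
  assumes "isCont c a" "c a = (f, h f)" "\<forall>\<^sub>F t in at_right a. c t \<in> lines"
  shows "((\<lambda>t. (T ^^ n) (c t)) \<longlongrightarrow> (f, h f)) (at_right (a::real))"
proof -
  have b: "(f, h f) \<in> clines" using h_pos[of f] by (simp add: clines_def)
  have "continuous (at (f, h f) within clines) (T ^^ n)"
    using Tn_cont b by (simp add: continuous_on_eq_continuous_within)
  then have "((T ^^ n) \<longlongrightarrow> (f, h f)) (at (f, h f) within clines)"
    by (simp add: continuous_within Tn_boundary)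
  moreover have "filterlim c (at (f, h f) within clines) (at_right a)"
    unfolding filterlim_at
  proof (intro conjI)
    show "(c \<longlongrightarrow> (f, h f)) (at_right a)" using tendsto_within_subset[OF assms(1)[unfolded isCont_def] subset_UNIV] assms(2) by simp
    show "\<forall>\<^sub>F x in at_right a. c x \<in> clines \<and> c x \<noteq> (f, h f)"
      using assms(3) by eventually_elim (auto simp: lines_def clines_def)
  qed
  ultimately show ?thesis by (rule filterlim_compose)
qed

text \<open>Along a vertical leaf the angle of the \<open>n\<close>-th line exceeds its value on the boundary, where the
  billiard map is the identity; without critical points it has to be monotone.\<close>

lemma parallel_beam_positive:
  assumes nc: "\<And>x n. x \<in> low \<Longrightarrow> n > 0 \<Longrightarrow> fst (dTn n x (0, - 1)) \<noteq> 0"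
    and x: "x \<in> low" and n: "n > 0"
  shows "fst (dTn n x (0, - 1)) > 0"
proof -
  obtain f p where xx: "x = (f, p)" by (cases x)
  \<comment> \<open>Run from the tangent line inwards: the velocity is \<open>(0, - 1)\<close>, and
    the boundary is the left end required by \<open>rolle_from_endpoint\<close>.\<close>
  let ?c = "\<lambda>t. (f, h f - t)"
  have p: "p < h f" using x xx by (auto simp: low_def lines_def)
  have low: "?c t \<in> low" if "0 < t" "t \<le> h f - p" for t using low_upward[of f p "h f - t"] x xx that by auto
  have "fst (dTn n (?c (h f - p)) (0, - 1)) > 0"
  proof (rule rolle_from_endpoint[where a = 0 and f = "\<lambda>t. fst ((T ^^ n) (?c t))" and c = f and f' = "\<lambda>t. fst (dTn n (?c t) (0, -1))"])
    fix t assume t: "0 < t" "t \<le> h f - p"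
    have "(?c has_vector_derivative (0, - 1)) (at t)"
      by (intro has_vector_derivative_Pair) (auto intro!: derivative_eq_intros)
    then have "(?c has_derivative (\<lambda>s. s *\<^sub>R (0, - 1))) (at t)" by (simp add: has_vector_derivative_def)
    from has_derivative_compose[OF this Tn_has_derivative[OF low_lines[OF low[OF t]], of n]]
    have "((\<lambda>t. (T ^^ n) (?c t)) has_derivative (\<lambda>s. dTn n (?c t) (s *\<^sub>R (0, - 1)))) (at t)" .
    moreover have "linear (dTn n (?c t))" using Tn_has_derivative[OF low_lines[OF low[OF t]], of n] by (rule has_derivative_linear)
    ultimately have "((\<lambda>t. (T ^^ n) (?c t)) has_vector_derivative dTn n (?c t) (0, - 1)) (at t)"
      by (simp only: has_vector_derivative_def linear_scale[of "dTn n (?c t)"])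
    from bounded_linear.has_vector_derivative[OF bounded_linear_fst this]
    show "((\<lambda>t. fst ((T ^^ n) (?c t))) has_real_derivative fst (dTn n (?c t) (0, - 1))) (at t)"
      by (simp add: has_real_derivative_iff_has_vector_derivative)
    show "fst (dTn n (?c t) (0, - 1)) \<noteq> 0" using nc low[OF t] n by blast
    show "f < fst ((T ^^ n) (?c t))" using fst_Tn_gt[OF low_lines[OF low[OF t]] n] by simp
  next
    have "\<forall>\<^sub>F t in at_right 0. ?c t \<in> lines"
      by (rule eventually_at_rightI[of 0 "h f - p"]) (use low low_lines p in auto)
    then have "((\<lambda>t. (T ^^ n) (?c t)) \<longlongrightarrow> (f, h f)) (at_right 0)"
      by (intro Tn_limit_boundary continuous_intros) auto
    from tendsto_fst[OF this] show "((\<lambda>t. fst ((T ^^ n) (?c t))) \<longlongrightarrow> f) (at_right 0)" by simp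
  qed (use p in simp)
  then show ?thesis using xx by simp
qed

text \<open>The differentials of \<open>ev\<close> and \<open>lv\<close> at \<open>x\<close>.\<close>

definition dev :: "real \<times> real \<Rightarrow> real \<times> real \<Rightarrow> real" where
  "dev x u = (snd u - q (ev x) (fst x) * fst u) / (r (ev x) * sin (fst x - ev x))"

definition dlv :: "real \<times> real \<Rightarrow> real \<times> real \<Rightarrow> real" where
  "dlv x u = (q (lv x) (fst x) * fst u - snd u) / (r (lv x) * sin (lv x - fst x))"

lemma dT_alt:
  "dT x u = (2 * dlv x u - fst u,
     r (lv x) * sin (lv x - fst x) * dlv x u + q (lv x) (fst (T x)) * (2 * dlv x u - fst u))"
proof -
  have "fst (T x) = lv x + (lv x - fst x)" by (simp add: T_def)
  then show ?thesis unfolding dT_def Let_def dlv_def by simp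
qed

lemma dev_dT: assumes "x \<in> lines" shows "dev (T x) (dT x u) = dlv x u"
proof -
  have "fst (T x) - ev (T x) = lv x - fst x" "ev (T x) = lv x"
    using T_clines(2)[OF lines_clines[OF assms]] by (auto simp: T_def)
  then show ?thesis using sin_lv_pos[OF assms] r_pos[of "lv x"] by (simp add: dev_def dT_alt)
qed

text \<open>A chord turns by the difference of the displacements of its ends across it, divided by
  its length. The entry point is displaced along the curve by \<open>r\<close> times
  \<open>dev\<close>, and the sine gives the part across the chord; the same holds at the
  exit.\<close>

lemma chord_rotation:
  assumes x: "x \<in> lines"
  shows "(q (lv x) (fst x) - q (ev x) (fst x)) * fst u =
     r (ev x) * sin (fst x - ev x) * dev x u + r (lv x) * sin (lv x - fst x) * dlv x u"
proof -
  have "sin (fst x - ev x) > 0" using ev_lines[OF x] by (intro sin_gt_zero) auto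
  then have "r (ev x) * sin (fst x - ev x) * dev x u = snd u - q (ev x) (fst x) * fst u"
    using r_pos[of "ev x"] by (simp add: dev_def)
  moreover have "r (lv x) * sin (lv x - fst x) * dlv x u = q (lv x) (fst x) * fst u - snd u"
    using sin_lv_pos[OF x] r_pos[of "lv x"] by (simp add: dlv_def)
  ultimately show ?thesis by (simp add: algebra_simps)
qed

lemma rotation_pos:
  assumes x: "x \<in> lines" and "dev x u \<ge> 0" "dlv x u > 0" shows "fst u > 0"
proof -
  have "sin (fst x - ev x) > 0" using ev_lines[OF x] by (intro sin_gt_zero) auto
  then have "r (ev x) * sin (fst x - ev x) * dev x u + r (lv x) * sin (lv x - fst x) * dlv x u > 0"
    using sin_lv_pos[OF x] r_pos[of "lv x"] r_pos[of "ev x"] assms by (intro add_nonneg_pos) auto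
  then have "0 < (q (lv x) (fst x) - q (ev x) (fst x)) * fst u" by (simp only: chord_rotation[OF x, of u])
  then show ?thesis using chord_pos[OF x] by (simp add: zero_less_mult_iff)
qed

text \<open>The tangent vector at \<open>x\<close> of the lines entering at the same point as \<open>x\<close>.\<close>

definition pencil :: "real \<times> real \<Rightarrow> real \<times> real" where
  "pencil x = (1, q (ev x) (fst x))"

text \<open>Here the quantity followed along the leaf is the entry point of the image, which tends
  to \<open>s\<close> at the tangent line. Positive \<open>dev\<close> at times \<open>n\<close> and
  \<open>n + 1\<close> means that both ends of the \<open>n\<close>-th chord move forward, and by
  \<open>chord_rotation\<close> it turns; at time 0 the entry point stays and only the exit point
  moves.\<close>

lemma pencil_positive:
  assumes down: "\<And>s d d'. enter s d \<in> low \<Longrightarrow> 0 < d' \<Longrightarrow> d' \<le> d \<Longrightarrow> d < pi \<Longrightarrow> enter s d' \<in> low"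
    and nc: "\<And>x n. x \<in> low \<Longrightarrow> n > 0 \<Longrightarrow> dev ((T ^^ n) x) (dTn n x (pencil x)) \<noteq> 0"
    and x: "x \<in> low"
  shows "fst (dTn n x (pencil x)) > 0"
proof -
  have dpos: "dev ((T ^^ n) x) (dTn n x (pencil x)) > 0" if n: "n > 0" for n
  proof -
    define s where "s = ev x"
    define b where "b = fst x - s"
    have xl: "x \<in> lines" using low_lines x by auto
    have xx: "x = enter s b" using enter_ev[OF xl] by (simp add: s_def b_def)
    have b: "0 < b" "b < pi" using ev_lines[OF xl] by (auto simp: b_def s_def)
    let ?c = "\<lambda>t. enter s t"
    have low: "?c t \<in> low" if "0 < t" "t \<le> b" for t using down[of s b t] x xx that b by auto
    have pen: "pencil (?c t) = (1, q s (s + t))" if "0 < t" "t \<le> b" for t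
      using enter_lines(2)[of t s] that b by (simp add: pencil_def) (simp add: enter_def)
    have "dev ((T ^^ n) (?c b)) (dTn n (?c b) (pencil (?c b))) > 0"
    proof (rule rolle_from_endpoint[where a = 0 and f = "\<lambda>t. ev ((T ^^ n) (?c t))" and c = s and f' = "\<lambda>t. dev ((T ^^ n) (?c t)) (dTn n (?c t) (pencil (?c t)))"])
      fix t assume t: "0 < t" "t \<le> b"
      note l = low_lines[OF low[OF t]]
      have "(?c has_derivative (\<lambda>z. z *\<^sub>R (pencil (?c t)))) (at t)"
        using enter_has_vector_derivative[of s t] by (simp add: has_vector_derivative_def pen[OF t])
      from has_derivative_compose[OF has_derivative_compose[OF this Tn_has_derivative[OF l, of n]] ev_has_derivative[OF Tn_lines[OF l]]]
      have D: "((\<lambda>t. ev ((T ^^ n) (?c t))) has_derivative (\<lambda>z. dev ((T ^^ n) (?c t)) (dTn n (?c t) (z *\<^sub>R pencil (?c t))))) (at t)"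
        unfolding dev_def .
      have "linear (dTn n (?c t))" using Tn_has_derivative[OF l, of n] by (rule has_derivative_linear)
      moreover have "linear (dev ((T ^^ n) (?c t)))"
        unfolding dev_def by (rule has_derivative_linear[OF ev_has_derivative[OF Tn_lines[OF l]]])
      ultimately show "((\<lambda>t. ev ((T ^^ n) (?c t))) has_real_derivative dev ((T ^^ n) (?c t)) (dTn n (?c t) (pencil (?c t)))) (at t)"
        using D unfolding has_real_derivative_iff_has_vector_derivative
        by (simp only: has_vector_derivative_def linear_scale[of "dTn n (?c t)"] linear_scale[of "dev ((T ^^ n) (?c t))"])
      show "dev ((T ^^ n) (?c t)) (dTn n (?c t) (pencil (?c t))) \<noteq> 0" using nc low[OF t] n by blast
      have "ev (?c t) = s" using enter_lines(2) t b by auto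
      then show "s < ev ((T ^^ n) (?c t))" using ev_Tn_gt[OF l n] by simp
    next
      have 0: "?c 0 = (s, h s)" by (simp add: enter_def)
      have "\<forall>\<^sub>F t in at_right 0. ?c t \<in> lines"
        by (rule eventually_at_rightI[of 0 b]) (use low low_lines b in auto)
      then have L: "((\<lambda>t. (T ^^ n) (?c t)) \<longlongrightarrow> (s, h s)) (at_right 0)"
        using has_vector_derivative_continuous[OF enter_has_vector_derivative] 0 by (intro Tn_limit_boundary)
      have ce: "(ev \<longlongrightarrow> ev (s, h s)) (at (s, h s) within clines)"
        using ev_cont h_pos[of s] by (simp add: continuous_on_def clines_def)
      have "filterlim (\<lambda>t. (T ^^ n) (?c t)) (at (s, h s) within clines) (at_right 0)"
        unfolding filterlim_at
      proof (intro conjI L)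
        show "\<forall>\<^sub>F t in at_right 0. (T ^^ n) (?c t) \<in> clines \<and> (T ^^ n) (?c t) \<noteq> (s, h s)"
        proof (rule eventually_at_rightI[of 0 b])
          fix t assume "t \<in> {0<..<b}"
          then have "(T ^^ n) (?c t) \<in> lines" using low low_lines Tn_lines by auto
          then show "(T ^^ n) (?c t) \<in> clines \<and> (T ^^ n) (?c t) \<noteq> (s, h s)"
            using lines_clines by (auto simp: lines_def)
        qed (use b in simp)
      qed
      from filterlim_compose[OF ce this] show "((\<lambda>t. ev ((T ^^ n) (?c t))) \<longlongrightarrow> s) (at_right 0)"
        using ev_eqI(2)[of s s "h s"] by simp
    qed (use b in simp)
    then show ?thesis using xx by simp
  qed
  have l: "(T ^^ n) x \<in> lines" for n using Tn_lines low_lines[OF x] by auto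
  have "dlv ((T ^^ n) x) (dTn n x (pencil x)) > 0"
    using dpos[of "Suc n"] dev_dT[OF l[of n], of "dTn n x (pencil x)"] by simp
  moreover have "dev ((T ^^ n) x) (dTn n x (pencil x)) \<ge> 0"
    using dpos[of n] by (cases "n = 0") (auto simp: dev_def pencil_def)
  ultimately show ?thesis by (intro rotation_pos[OF l])
qed

end

section \<open>The second variation\<close>

lemma bounded_periodic:
  fixes f :: "real \<Rightarrow> real"
  assumes "continuous_on UNIV f" and per: "\<And>t. f (t + c) = f t" and c: "c > 0"
  shows "\<exists>M>0. \<forall>t. \<bar>f t\<bar> \<le> M"
proof -
  have "bounded (f ` {0..c})"
    by (intro compact_imp_bounded compact_continuous_image continuous_on_subset[OF assms(1)]) auto
  then obtain M where M: "M > 0" "\<And>t. 0 \<le> t \<Longrightarrow> t \<le> c \<Longrightarrow> \<bar>f t\<bar> \<le> M"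
    unfolding bounded_pos by auto
  have "\<bar>f t\<bar> \<le> M" for t
  proof -
    obtain n :: int where n: "0 \<le> t + of_int n * c" "t + of_int n * c < 0 + c"
      using reduce_mod_period[OF c, of 0 t] by blast
    have "f t = f (t + of_int n * c)" using periodic_int[of f, OF per] by simp
    then show ?thesis using M(2)[OF n(1)] n(2) by simp
  qed
  then show ?thesis using M(1) by blast
qed

lemma arctan_quotient_deriv:
  fixes g g' f f' :: real
  assumes g: "g > 0" and e: "g * g' = - (f * f')"
  shows "(f' * g - f * g') / (g * g) * inverse (1 + (f / g)\<^sup>2) = f' / g"
proof -
  have p: "g\<^sup>2 + f\<^sup>2 > 0" using g by (simp add: add_pos_nonneg)
  have "1 + (f / g)\<^sup>2 = (g\<^sup>2 + f\<^sup>2) / (g * g)"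
    using g by (simp add: power_divide power2_eq_square add_divide_distrib)
  then have *: "(f' * g - f * g') / (g * g) * inverse (1 + (f / g)\<^sup>2) = (f' * g - f * g') / (g\<^sup>2 + f\<^sup>2)"
    using g by simp
  have "(f' * g - f * g') * g = f' * (g\<^sup>2 + f\<^sup>2)"
  proof -
    have "(f' * g - f * g') * g = f' * g\<^sup>2 - f * (g * g')" by (simp add: algebra_simps power2_eq_square)
    then show ?thesis unfolding e by (simp add: algebra_simps power2_eq_square)
  qed
  then show ?thesis unfolding * using g p by (simp add: frac_eq_eq)
qed

context symmetric_oval begin

text \<open>Second derivatives of the generating function \<open>2 h \<psi> sin \<delta>\<close> in the variables
  \<open>\<psi> - \<delta>\<close> and \<open>\<psi> + \<delta>\<close>.\<close>

definition S12 :: "real \<times> real \<Rightarrow> real" where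
  "S12 x = r (lv x) * sin (lv x - fst x) / 2"

definition S11 :: "real \<times> real \<Rightarrow> real" where
  "S11 x = S12 x - q (lv x) (fst x)"

definition S22 :: "real \<times> real \<Rightarrow> real" where
  "S22 x = S12 x + q (lv x) (fst (T x))"

text \<open>The quadratic form of the second variation evaluated on the momentum \<open>snd\<close>. For an ellipse
  \<open>(h \<phi>)\<^sup>2 - p\<^sup>2\<close> is a first integral, and the angular component of its Hamiltonian vector field is
  proportional to \<open>p\<close>; so for ellipses this variation loses nothing.\<close>

definition Qf :: "real \<times> real \<Rightarrow> real" where
  "Qf x = S11 x * (snd x)\<^sup>2 + 2 * S12 x * snd x * snd (T x) + S22 x * (snd (T x))\<^sup>2"

lemma S12_pos: "x \<in> lines \<Longrightarrow> S12 x > 0"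
  using sin_lv_pos r_pos by (simp add: S12_def)

text \<open>The momenta before and after a reflection are minus the first and plus the second
  partial derivative of the generating function; these are the linearised equations.\<close>

lemma dT_generating:
  assumes x: "x \<in> lines"
  shows "snd u = - S11 x * fst u - S12 x * fst (dT x u)"
    "snd (dT x u) = S12 x * fst u + S22 x * fst (dT x u)"
proof -
  have *: "2 * S12 x * dlv x u = q (lv x) (fst x) * fst u - snd u"
    using sin_lv_pos[OF x] r_pos[of "lv x"] by (simp add: dlv_def S12_def)
  have a: "fst (dT x u) = 2 * dlv x u - fst u" by (simp add: dT_alt)
  have b: "snd (dT x u) = 2 * S12 x * dlv x u + q (lv x) (fst (T x)) * fst (dT x u)"
    by (simp add: dT_alt S12_def)
  show "snd u = - S11 x * fst u - S12 x * fst (dT x u)"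
    using * unfolding a S11_def by (simp add: algebra_simps)
  show "snd (dT x u) = S12 x * fst u + S22 x * fst (dT x u)"
    unfolding b S22_def by (simp add: a algebra_simps)
qed

text \<open>The right side minus the left is \<open>S12 x / (a * b)\<close> times the square of
  \<open>a * snd (T x) - b * snd x\<close>, where \<open>a\<close> and \<open>b\<close> are
  consecutive values of the field. The bound is the increment of one quantity along the orbit, so it
  telescopes.\<close>

lemma Qf_step:
  assumes x: "x \<in> lines" and a: "fst u > 0" and a1: "fst (dT x u) > 0"
  shows "Qf x \<le> snd (dT x u) / fst (dT x u) * (snd (T x))\<^sup>2 - snd u / fst u * (snd x)\<^sup>2"
proof -
  define a b where "a = fst u" and "b = fst (dT x u)"
  note g = dT_generating[OF x, of u]
  have 1: "snd (dT x u) / b = S12 x * a / b + S22 x"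
    using a1 unfolding g(2) by (simp add: a_def b_def add_divide_distrib)
  have 2: "snd u / a = - S11 x - S12 x * b / a"
    using a by (subst g(1)) (simp add: a_def b_def diff_divide_distrib)
  have "S12 x * a / b * (snd (T x))\<^sup>2 + S12 x * b / a * (snd x)\<^sup>2 - 2 * S12 x * snd x * snd (T x)
      = S12 x / (a * b) * (a * snd (T x) - b * snd x)\<^sup>2"
    using a a1 by (simp add: a_def[symmetric] b_def[symmetric] field_simps power2_eq_square)
  also have "\<dots> \<ge> 0"
    using S12_pos[OF x] a a1 by (simp add: a_def b_def)
  finally have "Qf x \<le> (S12 x * a / b + S22 x) * (snd (T x))\<^sup>2 - (- S11 x - S12 x * b / a) * (snd x)\<^sup>2"
    unfolding Qf_def by (simp add: algebra_simps)
  then show ?thesis unfolding a_def[symmetric] b_def[symmetric] 1 2 .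
qed

text \<open>\<open>S12\<close> is bounded by \<open>M\<close> and \<open>q\<close> by
  \<open>2 * M\<close>, whence \<open>3 * M\<close>; the three terms of \<open>Qf\<close> then
  contribute 3, 2 and 3.\<close>

lemma all_bounded:
  obtains M where "M > 0" "\<And>t. \<bar>h t\<bar> \<le> M" "\<And>t. \<bar>h1 t\<bar> \<le> M" "\<And>t. r t \<le> M"
    "\<And>x. x \<in> lines \<Longrightarrow> \<bar>snd x\<bar> \<le> M" "\<And>x. x \<in> lines \<Longrightarrow> - S11 x \<le> 3 * M" "\<And>x. x \<in> lines \<Longrightarrow> - S22 x \<le> 3 * M"
    "\<And>x. x \<in> lines \<Longrightarrow> \<bar>Qf x\<bar> \<le> 8 * M * M\<^sup>2"
proof -
  obtain A where "A > 0" "\<And>t. \<bar>h t\<bar> \<le> A" using bounded_periodic[OF h_cont h_pi pi_gt_zero] by (elim exE conjE) auto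
  obtain B where "B > 0" "\<And>t. \<bar>h1 t\<bar> \<le> B" using bounded_periodic[OF h1_cont h1_pi pi_gt_zero] by (elim exE conjE) auto
  obtain C where "C > 0" "\<And>t. \<bar>r t\<bar> \<le> C" using bounded_periodic[OF r_cont r_pi pi_gt_zero] by (elim exE conjE) auto
  define M where "M = max A (max B C)"
  have M: "M > 0" "\<And>t. \<bar>h t\<bar> \<le> M" "\<And>t. \<bar>h1 t\<bar> \<le> M" "\<And>t. r t \<le> M"
    using \<open>A > 0\<close> \<open>\<And>t. \<bar>h t\<bar> \<le> A\<close> \<open>\<And>t. \<bar>h1 t\<bar> \<le> B\<close> \<open>\<And>t. \<bar>r t\<bar> \<le> C\<close>
    unfolding M_def by (auto simp: le_max_iff_disj less_max_iff_disj intro: order_trans[OF abs_ge_self])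
  have p: "\<bar>snd x\<bar> \<le> M" if "x \<in> lines" for x using that M(2)[of "fst x"] by (auto simp: lines_def)
  have qb: "\<bar>q t f\<bar> \<le> 2 * M" for t f
  proof -
    have "\<bar>h1 t * cos (f - t)\<bar> \<le> M * 1" "\<bar>h t * sin (f - t)\<bar> \<le> M * 1"
      unfolding abs_mult using M by (intro mult_mono; simp)+
    then show ?thesis unfolding q_def by linarith
  qed
  have s12: "\<bar>S12 x\<bar> \<le> M" if "x \<in> lines" for x
  proof -
    have "\<bar>r (lv x) * sin (lv x - fst x)\<bar> \<le> M * 1"
      unfolding abs_mult using M r_pos[of "lv x"] by (intro mult_mono) auto
    then show ?thesis unfolding S12_def using M(1) by (simp add: field_simps)
  qed
  have s11: "\<bar>S11 x\<bar> \<le> 3 * M" "\<bar>S22 x\<bar> \<le> 3 * M" if "x \<in> lines" for x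
    using s12[OF that] qb[of "lv x" "fst x"] qb[of "lv x" "fst (T x)"] unfolding S11_def S22_def by linarith+
  have Qb: "\<bar>Qf x\<bar> \<le> 8 * M * M\<^sup>2" if "x \<in> lines" for x
  proof -
    have sq: "\<bar>(snd z)\<^sup>2\<bar> \<le> M\<^sup>2" if "z \<in> lines" for z using power_mono[OF p[OF that], of 2] by simp
    have 1: "\<bar>S11 x * (snd x)\<^sup>2\<bar> \<le> (3 * M) * M\<^sup>2"
      unfolding abs_mult using s11[OF that] sq[OF that] M(1) by (intro mult_mono) auto
    have 2: "\<bar>S22 x * (snd (T x))\<^sup>2\<bar> \<le> (3 * M) * M\<^sup>2"
      unfolding abs_mult using s11[OF that] sq[OF T_lines[OF that]] M(1) by (intro mult_mono) auto
    have 3: "\<bar>S12 x * (snd x * snd (T x))\<bar> \<le> M * (M * M)"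
      unfolding abs_mult using s12[OF that] p[OF that] p[OF T_lines[OF that]] M(1) by (intro mult_mono) auto
    have "Qf x = S11 x * (snd x)\<^sup>2 + 2 * (S12 x * (snd x * snd (T x))) + S22 x * (snd (T x))\<^sup>2"
      unfolding Qf_def by simp
    moreover have "8 * M * M\<^sup>2 = (3 * M) * M\<^sup>2 + 2 * (M * (M * M)) + (3 * M) * M\<^sup>2"
      by (simp add: power2_eq_square)
    ultimately show ?thesis using 1 2 3 by linarith
  qed
  show ?thesis
  proof (rule that[of M, OF M p])
    show "- S11 x \<le> 3 * M" "- S22 x \<le> 3 * M" if "x \<in> lines" for x using s11[OF that] by linarith+
  qed (use Qb in auto)
qed

text \<open>After telescoping, the last slope is at most \<open>- S11\<close> because the next value
  of the field is positive, and the first is at least \<open>S22\<close> because the previous value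
  is nonnegative. The sum starts at 1 since a parallel beam has angular component 0 at time 0, where
  its slope is undefined.\<close>

lemma hopf_bound:
  "\<exists>C. \<forall>x\<in>lines. \<forall>u. fst u \<ge> 0 \<longrightarrow> (\<forall>n>0. fst (dTn n x u) > 0) \<longrightarrow>
     (\<forall>N. (\<Sum>n=1..N. Qf ((T ^^ n) x)) \<le> C)"
proof -
  obtain M where M: "M > 0" "\<And>x. x \<in> lines \<Longrightarrow> \<bar>snd x\<bar> \<le> M" "\<And>x. x \<in> lines \<Longrightarrow> - S11 x \<le> 3 * M"
    "\<And>x. x \<in> lines \<Longrightarrow> - S22 x \<le> 3 * M"
    using all_bounded by metis
  have "(\<Sum>n=1..N. Qf ((T ^^ n) x)) \<le> 6 * M * M\<^sup>2"
    if x: "x \<in> lines" and u0: "fst u \<ge> 0" and u: "\<And>n. n > 0 \<Longrightarrow> fst (dTn n x u) > 0" for x u N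
  proof -
    define w where "w n = snd (dTn n x u) / fst (dTn n x u) * (snd ((T ^^ n) x))\<^sup>2" for n
    have l: "(T ^^ n) x \<in> lines" for n using Tn_lines[OF x] .
    have sq: "(snd z)\<^sup>2 \<le> M\<^sup>2" if "z \<in> lines" for z using power_mono[OF M(2)[OF that], of 2] by simp
    have step: "Qf ((T ^^ n) x) \<le> w (Suc n) - w n" if "n > 0" for n
      using Qf_step[OF l, of "dTn n x u" n] u[OF that] u[of "Suc n"] by (simp add: w_def)
    have sum: "(\<Sum>n=1..N. Qf ((T ^^ n) x)) \<le> w (Suc N) - w 1"
    proof (induction N)
      case (Suc N) then show ?case using step[of "Suc N"] by simp
    qed simp
    have slope_upper: "snd (dTn n x u) / fst (dTn n x u) \<le> - S11 ((T ^^ n) x)" if "n > 0" for n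
    proof -
      have "snd (dTn n x u) \<le> - S11 ((T ^^ n) x) * fst (dTn n x u)"
        using dT_generating(1)[OF l, of "dTn n x u" n] u[of "Suc n"] S12_pos[OF l, of n] by simp
      then show ?thesis using u[OF that] by (simp add: pos_divide_le_eq)
    qed
    have slope_lower: "S22 x \<le> snd (dTn 1 x u) / fst (dTn 1 x u)"
    proof -
      have "S22 x * fst (dTn 1 x u) \<le> snd (dTn 1 x u)"
        using dT_generating(2)[OF x, of u] u0 S12_pos[OF x] by simp
      then show ?thesis using u[of 1] by (simp add: pos_le_divide_eq)
    qed
    have "w (Suc N) \<le> 3 * M * M\<^sup>2"
    proof -
      have "snd (dTn (Suc N) x u) / fst (dTn (Suc N) x u) \<le> 3 * M"
        using slope_upper[of "Suc N"] M(3)[OF l, of "Suc N"] by linarith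
      then have "w (Suc N) \<le> 3 * M * (snd ((T ^^ Suc N) x))\<^sup>2" unfolding w_def by (intro mult_right_mono) auto
      also have "\<dots> \<le> 3 * M * M\<^sup>2" using sq[OF l[of "Suc N"]] M(1) by (intro mult_left_mono) auto
      finally show ?thesis .
    qed
    moreover have "- w 1 \<le> 3 * M * M\<^sup>2"
    proof -
      have "- (snd (dTn 1 x u) / fst (dTn 1 x u)) \<le> 3 * M"
        using slope_lower M(4)[OF x] by linarith
      then have "- (snd (dTn 1 x u) / fst (dTn 1 x u)) * (snd ((T ^^ 1) x))\<^sup>2 \<le> 3 * M * (snd ((T ^^ 1) x))\<^sup>2"
        by (intro mult_right_mono) auto
      also have "\<dots> \<le> 3 * M * M\<^sup>2" using sq[OF l[of 1]] M(1) by (intro mult_left_mono) auto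
      finally show ?thesis by (simp add: w_def)
    qed
    ultimately show ?thesis using sum by linarith
  qed
  then show ?thesis by (intro exI[of _ "6 * M * M\<^sup>2"]) blast
qed

lemma Qf_leave:
  assumes d: "0 < d" "d < pi"
  shows "Qf (leave s d) = 2 * h s * sin d * ((h s * (r s - h s) + 2 * (h1 s)\<^sup>2) * (cos d)\<^sup>2 - (h1 s)\<^sup>2 * (sin d)\<^sup>2)"
proof -
  define S C where "S = sin d" and "C = cos d"
  have l: "lv (leave s d) = s" "T (leave s d) = enter s d" using leave_lines(2) T_leave d by auto
  have a: "s - d - s = - d" "s + d - s = d" "s - (s - d) = d" by auto
  have v: "snd (leave s d) = h s * C - h1 s * S" "snd (enter s d) = h s * C + h1 s * S"
    "q s (fst (leave s d)) = h1 s * C + h s * S" "q s (fst (enter s d)) = h1 s * C - h s * S"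
    "S12 (leave s d) = r s * S / 2"
    unfolding S12_def l(1) unfolding leave_def enter_def k_def q_def fst_conv snd_conv a S_def C_def by simp_all
  show ?thesis
    unfolding Qf_def S11_def S22_def l v unfolding S_def[symmetric] C_def[symmetric]
    by (simp add: power2_eq_square field_simps)
qed

end

text \<open>From here on the invariant curve enters only through the constant \<open>R\<close>; its
  orbits are recovered from the support function by \<open>w\<close>.\<close>

locale quarter_oval = symmetric_oval +
  fixes R :: real
  assumes R_pos: "R > 0"
    and quarter: "(h s)\<^sup>2 + (h (s + pi / 2))\<^sup>2 = R\<^sup>2"
begin

text \<open>The angle to the tangent at which the \<open>4\<close>-periodic orbit leaves the point with normal angle
  \<open>s\<close>; see \<open>enter_w\<close>.\<close>

definition w :: "real \<Rightarrow> real" where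
  "w s = arctan (h s / h (s + pi / 2))"

lemma h_half: "h (s + pi / 2 + pi / 2) = h s"
proof -
  have e: "s + pi / 2 + pi / 2 = s + pi" by simp
  show ?thesis unfolding e by (rule h_pi)
qed

lemma h_R_w: "h s = R * sin (w s)" "h (s + pi / 2) = R * cos (w s)"
proof -
  let ?g = "h (s + pi / 2)"
  have g: "?g > 0" by (rule h_pos)
  have "1 + (h s / ?g)\<^sup>2 = (R / ?g)\<^sup>2"
    using g quarter[of s] by (simp add: power_divide field_simps)
  then have "sqrt (1 + (h s / ?g)\<^sup>2) = R / ?g" using g R_pos by (simp add: real_sqrt_abs)
  then show "h s = R * sin (w s)" "?g = R * cos (w s)"
    using g R_pos unfolding w_def sin_arctan cos_arctan by auto
qed

lemma w_bounds: "0 < w s" "w s < pi / 2"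
  using h_pos[of s] h_pos[of "s + pi/2"] arctan_ubound by (auto simp: w_def)

lemma w_half: "w (s + pi / 2) = pi / 2 - w s"
proof -
  have "h (s + pi/2) / h s = inverse (h s / h (s + pi/2))" by simp
  moreover have "h s / h (s + pi/2) > 0" using h_pos by simp
  ultimately show ?thesis unfolding w_def h_half using arctan_inverse[of "h s / h (s + pi/2)"] by (simp add: divide_simps)
qed

lemma h1_half: "h s * h1 s + h (s + pi / 2) * h1 (s + pi / 2) = 0"
proof -
  have "((\<lambda>s. h (s + pi/2)) has_real_derivative h1 (s + pi/2)) (at s)"
    using h_deriv[of "s + pi/2"] by (simp add: DERIV_shift)
  then have "((\<lambda>s. (h s)\<^sup>2 + (h (s + pi / 2))\<^sup>2) has_real_derivative 2 * (h s * h1 s + h (s + pi/2) * h1 (s + pi/2))) (at s)"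
    by (auto intro!: derivative_eq_intros h_deriv[of s] simp: algebra_simps)
  moreover have "((\<lambda>s. (h s)\<^sup>2 + (h (s + pi / 2))\<^sup>2) has_real_derivative 0) (at s)"
    unfolding quarter by simp
  ultimately show ?thesis using DERIV_unique by fastforce
qed

definition w1 :: "real \<Rightarrow> real" where "w1 s = h1 s / h (s + pi / 2)"

definition w2 :: "real \<Rightarrow> real" where
  "w2 s = ((r s - h s) * h (s + pi / 2) - h1 s * h1 (s + pi / 2)) / (h (s + pi / 2))\<^sup>2"

lemma w_deriv: "(w has_real_derivative w1 s) (at s)"
proof -
  let ?g = "h (s + pi / 2)" and ?g1 = "h1 (s + pi / 2)"
  have g: "?g > 0" by (rule h_pos)
  have D: "((\<lambda>s. h (s + pi/2)) has_real_derivative ?g1) (at s)"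
    using h_deriv[of "s + pi/2"] by (simp add: DERIV_shift)
  have "(w has_real_derivative (h1 s * ?g - h s * ?g1) / (?g * ?g) * inverse (1 + (h s / ?g)\<^sup>2)) (at s)"
    unfolding w_def[abs_def]
    by (rule DERIV_chain2[OF DERIV_arctan, THEN DERIV_cong]) (rule DERIV_divide[OF h_deriv D], use g in auto)
  moreover have "?g * ?g1 = - (h s * h1 s)" using h1_half[of s] by simp
  note arctan_quotient_deriv[OF g this]
  ultimately show ?thesis unfolding w1_def by simp
qed

lemma w1_deriv: "(w1 has_real_derivative w2 s) (at s)"
proof -
  have g: "h (s + pi / 2) > 0" by (rule h_pos)
  have D: "((\<lambda>s. h (s + pi/2)) has_real_derivative h1 (s + pi/2)) (at s)"
    using h_deriv[of "s + pi/2"] by (simp add: DERIV_shift)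
  show ?thesis unfolding w1_def[abs_def] w2_def
    by (rule DERIV_cong[OF DERIV_divide[OF h1_deriv D]]) (use g in \<open>auto simp: power2_eq_square\<close>)
qed

lemma w1_half: "w1 (s + pi / 2) = - w1 s"
proof -
  have "((\<lambda>s. w (s + pi/2)) has_real_derivative w1 (s + pi/2)) (at s)"
    using w_deriv[of "s + pi/2"] by (simp add: DERIV_shift)
  moreover have "((\<lambda>s. w (s + pi/2)) has_real_derivative - w1 s) (at s)"
    unfolding w_half by (auto intro!: derivative_eq_intros w_deriv)
  ultimately show ?thesis by (rule DERIV_unique)
qed

lemma w2_half: "w2 (s + pi / 2) = - w2 s"
proof -
  have "((\<lambda>s. w1 (s + pi/2)) has_real_derivative w2 (s + pi/2)) (at s)"
    using w1_deriv[of "s + pi/2"] by (simp add: DERIV_shift)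
  moreover have "((\<lambda>s. w1 (s + pi/2)) has_real_derivative - w2 s) (at s)"
    unfolding w1_half by (auto intro!: derivative_eq_intros w1_deriv)
  ultimately show ?thesis by (rule DERIV_unique)
qed

lemma h1_w: "h1 s = R * cos (w s) * w1 s"
proof -
  have "h1 s = h (s + pi / 2) * w1 s" using h_pos[of "s + pi/2"] by (simp add: w1_def)
  then show ?thesis by (simp only: h_R_w(2))
qed

lemma r_w: "r s - h s = R * (cos (w s) * w2 s - sin (w s) * (w1 s)\<^sup>2)"
proof -
  have "((\<lambda>s. R * cos (w s) * w1 s) has_real_derivative R * (cos (w s) * w2 s - sin (w s) * (w1 s)\<^sup>2)) (at s)"
    by (auto intro!: derivative_eq_intros w_deriv w1_deriv simp: algebra_simps power2_eq_square)
  then have "(h1 has_real_derivative R * (cos (w s) * w2 s - sin (w s) * (w1 s)\<^sup>2)) (at s)"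
    by (simp add: h1_w[symmetric])
  then show ?thesis using h1_deriv DERIV_unique by blast
qed

text \<open>With \<open>h = R sin w\<close> and its quarter shift \<open>R cos w\<close>, the
  relation \<open>h1_half\<close> makes the heights of the two points along
  \<open>cis (s + w s)\<close> equal. This reverses \<open>quarter_relations\<close>.\<close>

lemma enter_w: "lv (enter s (w s)) = s + pi / 2"
proof -
  let ?g = "h (s + pi / 2)" and ?g1 = "h1 (s + pi / 2)"
  have c: "cos (w s) \<noteq> 0" "cos (w s) > 0" using w_bounds[of s] cos_gt_zero[of "w s"] by auto
  have e: "sin (w s) * h1 s + cos (w s) * ?g1 = 0"
  proof -
    have "R * (sin (w s) * h1 s + cos (w s) * ?g1) = h s * h1 s + ?g * ?g1"
      using h_R_w[of s] by (simp add: algebra_simps)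
    then show ?thesis using h1_half R_pos by simp
  qed
  have a: "s + w s - (s + pi/2) = - (pi/2 - w s)" "s + w s - s = w s" by auto
  have "k (s + pi/2) (s + w s) = ?g * sin (w s) - ?g1 * cos (w s)"
    unfolding k_def a by (simp add: cos_diff sin_diff)
  also have "\<dots> = h s * cos (w s) + h1 s * sin (w s)"
  proof -
    have "?g * sin (w s) = h s * cos (w s)" using h_R_w[of s] by simp
    moreover have "h1 s * sin (w s) = - ?g1 * cos (w s)" using e by (simp add: algebra_simps)
    ultimately show ?thesis by simp
  qed
  also have "\<dots> = k s (s + w s)" unfolding k_def a ..
  finally show ?thesis unfolding enter_def using w_bounds[of s] by (intro lv_eqI') auto
qed

text \<open>Along the pencil at one entry point \<open>lv\<close> increases with \<open>fst\<close>,
  by the twist condition, and by \<open>enter_w\<close> the chord spans exactly a quarter turn at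
  the angle \<open>w\<close>.\<close>

lemma low_iff_enter: assumes x: "x \<in> lines" shows "x \<in> low \<longleftrightarrow> fst x - ev x < w (ev x)"
proof -
  define s where "s = ev x"
  define z where "z = enter s (w s)"
  have z: "z \<in> lines" "ev z = s" "lv z = s + pi/2" "fst z = s + w s"
    using w_bounds[of s] enter_lines[of "w s" s] enter_w[of s] by (auto simp: z_def enter_def)
  have "lv x < s + pi/2 \<longleftrightarrow> fst x < s + w s"
    using lv_less[OF x z(1)] lv_less[OF z(1) x] z line_eqI[OF x z(1)] s_def
    by (metis (no_types) less_irrefl less_not_sym linorder_less_linear prod.collapse ev_props(3) lines_clines x)
  then show ?thesis using x by (auto simp: low_def s_def[symmetric] algebra_simps)
qed

text \<open>The same at the exit point: the chord that spans a quarter turn and ends at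
  \<open>t\<close> makes there the angle \<open>pi / 2 - w s = w t\<close>.\<close>

lemma low_iff_leave: assumes x: "x \<in> lines" shows "x \<in> low \<longleftrightarrow> lv x - fst x < w (lv x)"
proof -
  define t where "t = lv x"
  define s where "s = t - pi/2"
  define z where "z = enter s (w s)"
  have "w t = pi/2 - w s" using w_half[of s] by (simp add: s_def)
  then have z: "z \<in> lines" "ev z = s" "lv z = t" "fst z = t - w t"
    using w_bounds[of s] enter_lines[of "w s" s] enter_w[of s] by (auto simp: z_def enter_def s_def)
  have "s < ev x \<longleftrightarrow> t - w t < fst x"
    using ev_less[OF x z(1)] ev_less[OF z(1) x] z line_eqI[OF x z(1)] t_def
    by (metis (no_types) less_irrefl less_not_sym linorder_less_linear prod.collapse lv_props(3) lines_clines x)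
  then show ?thesis using x by (auto simp: low_def t_def[symmetric] s_def algebra_simps)
qed

text \<open>Reflection preserves the angle to the tangent, and \<open>low\<close> is described by
  the same bound \<open>w\<close> before and after it.\<close>

lemma T_low_iff: assumes x: "x \<in> lines" shows "T x \<in> low \<longleftrightarrow> x \<in> low"
proof -
  have "fst (T x) - ev (T x) = lv x - fst x" "ev (T x) = lv x"
    using T_clines(2)[OF lines_clines[OF x]] by (auto simp: T_def)
  then show ?thesis using low_iff_enter[OF T_lines[OF x]] low_iff_leave[OF x] by simp
qed

lemma Tn_low: "x \<in> low \<Longrightarrow> (T ^^ n) x \<in> low"
  by (induction n) (auto simp: T_low_iff Tn_lines low_lines)

lemma enter_low_iff: assumes "0 < d" "d < pi" shows "enter s d \<in> low \<longleftrightarrow> d < w s"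
  using low_iff_enter[OF enter_lines(1)[OF assms]] enter_lines(2)[OF assms, of s] by (simp add: enter_def)

lemma leave_low_iff: assumes "0 < d" "d < pi" shows "leave s d \<in> low \<longleftrightarrow> d < w s"
  using low_iff_leave[OF leave_lines(1)[OF assms]] leave_lines(2)[OF assms, of s] by (simp add: leave_def)

end

section \<open>Invariant area\<close>

lemma nn_integral_periodic_shift:
  fixes g :: "real \<Rightarrow> ennreal"
  assumes g[measurable]: "g \<in> borel_measurable borel" and per: "\<And>x. g (x + c) = g x" and a: "0 \<le> a" "a \<le> c"
  shows "(\<integral>\<^sup>+x. g (x + a) * indicator {0..<c} x \<partial>lborel) = (\<integral>\<^sup>+x. g x * indicator {0..<c} x \<partial>lborel)"
proof -
  have sh: "(\<integral>\<^sup>+x. u (x + t) \<partial>lborel) = (\<integral>\<^sup>+x. u x \<partial>lborel)"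
    if "u \<in> borel_measurable borel" for u :: "real \<Rightarrow> ennreal" and t
    using nn_integral_real_affine[OF that, of 1 t] by (simp add: add.commute)
  have "(\<integral>\<^sup>+x. g (x + a) * indicator {0..<c} x \<partial>lborel) = (\<integral>\<^sup>+x. g (x + a) * indicator {a..<a + c} (x + a) \<partial>lborel)"
    by (intro nn_integral_cong) (auto simp: indicator_def)
  also have "\<dots> = (\<integral>\<^sup>+x. g x * indicator {a..<a + c} x \<partial>lborel)"
    by (rule sh[where u = "\<lambda>x. g x * indicator {a..<a + c} x"]) measurable
  also have "\<dots> = (\<integral>\<^sup>+x. g x * indicator {a..<c} x + g x * indicator {c..<a + c} x \<partial>lborel)"
    using a by (intro nn_integral_cong) (auto simp: indicator_def)
  also have "\<dots> = (\<integral>\<^sup>+x. g x * indicator {a..<c} x \<partial>lborel) + (\<integral>\<^sup>+x. g x * indicator {c..<a + c} x \<partial>lborel)"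
    by (rule nn_integral_add) measurable
  also have "(\<integral>\<^sup>+x. g x * indicator {c..<a + c} x \<partial>lborel) = (\<integral>\<^sup>+x. g (x + c) * indicator {c..<a + c} (x + c) \<partial>lborel)"
    by (rule sh[where u = "\<lambda>x. g x * indicator {c..<a + c} x", symmetric]) measurable
  also have "\<dots> = (\<integral>\<^sup>+x. g x * indicator {0..<a} x \<partial>lborel)"
    by (intro nn_integral_cong) (auto simp: indicator_def per)
  also have "(\<integral>\<^sup>+x. g x * indicator {a..<c} x \<partial>lborel) + (\<integral>\<^sup>+x. g x * indicator {0..<a} x \<partial>lborel)
      = (\<integral>\<^sup>+x. g x * indicator {a..<c} x + g x * indicator {0..<a} x \<partial>lborel)"
    by (rule nn_integral_add[symmetric]) measurable
  also have "\<dots> = (\<integral>\<^sup>+x. g x * indicator {0..<c} x \<partial>lborel)"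
    using a by (intro nn_integral_cong) (auto simp: indicator_def)
  finally show ?thesis .
qed

text \<open>Exchanging the integrals leaves, for each fixed \<open>d\<close>, a translation of a
  periodic function. This replaces the direction of a line by the normal angle of one of its end
  points.\<close>

lemma nn_integral_shear:
  fixes H :: "real \<times> real \<Rightarrow> ennreal"
  assumes H[measurable]: "H \<in> borel_measurable borel" and per: "\<And>s d. H (s + c, d) = H (s, d)"
    and supp: "\<And>s d. H (s, d) \<noteq> 0 \<Longrightarrow> 0 \<le> d \<and> d \<le> c"
  shows "(\<integral>\<^sup>+s. (\<integral>\<^sup>+d. H (s + d, d) \<partial>lborel) * indicator {0..<c} s \<partial>lborel)
       = (\<integral>\<^sup>+s. (\<integral>\<^sup>+d. H (s, d) \<partial>lborel) * indicator {0..<c} s \<partial>lborel)"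
    "(\<integral>\<^sup>+s. (\<integral>\<^sup>+d. H (s - d, d) \<partial>lborel) * indicator {0..<c} s \<partial>lborel)
       = (\<integral>\<^sup>+s. (\<integral>\<^sup>+d. H (s, d) \<partial>lborel) * indicator {0..<c} s \<partial>lborel)"
proof -
  have H'[measurable]: "H \<in> borel_measurable (borel \<Otimes>\<^sub>M borel)"
    unfolding borel_prod by (rule H)
  have m: "(\<lambda>x. H (x, d)) \<in> borel_measurable borel" for d by measurable
  \<comment> \<open>The instances 1 and -1 of \<open>e\<close> are the two shears, and 0 exchanges
    the integrals back.\<close>
  have swap: "(\<integral>\<^sup>+s. (\<integral>\<^sup>+d. H (s + e * d, d) \<partial>lborel) * indicator {0..<c} s \<partial>lborel)
     = (\<integral>\<^sup>+d. (\<integral>\<^sup>+s. H (s + e * d, d) * indicator {0..<c} s \<partial>lborel) \<partial>lborel)" for e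
  proof -
    have "(\<integral>\<^sup>+s. (\<integral>\<^sup>+d. H (s + e * d, d) \<partial>lborel) * indicator {0..<c} s \<partial>lborel)
      = (\<integral>\<^sup>+s. (\<integral>\<^sup>+d. H (s + e * d, d) * indicator {0..<c} s \<partial>lborel) \<partial>lborel)"
      by (intro nn_integral_cong nn_integral_multc[symmetric]) measurable
    also have "\<dots> = (\<integral>\<^sup>+d. (\<integral>\<^sup>+s. H (s + e * d, d) * indicator {0..<c} s \<partial>lborel) \<partial>lborel)"
      by (rule lborel_pair.Fubini') measurable
    finally show ?thesis .
  qed
  have 1: "(\<integral>\<^sup>+s. H (s + d, d) * indicator {0..<c} s \<partial>lborel) = (\<integral>\<^sup>+s. H (s, d) * indicator {0..<c} s \<partial>lborel)" for d
  proof (cases "0 \<le> d \<and> d \<le> c")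
    case True
    then show ?thesis by (intro nn_integral_periodic_shift[OF m per]) auto
  next
    case False
    then have "H (s, d) = 0" for s using supp by blast
    then show ?thesis by simp
  qed
  have 2: "(\<integral>\<^sup>+s. H (s - d, d) * indicator {0..<c} s \<partial>lborel) = (\<integral>\<^sup>+s. H (s, d) * indicator {0..<c} s \<partial>lborel)" for d
  proof (cases "0 \<le> d \<and> d \<le> c")
    case True
    have "(\<integral>\<^sup>+s. H (s + d - d, d) * indicator {0..<c} s \<partial>lborel) = (\<integral>\<^sup>+s. H (s - d, d) * indicator {0..<c} s \<partial>lborel)"
    proof (rule nn_integral_periodic_shift[where g = "\<lambda>s. H (s - d, d)"])
      show "(\<lambda>s. H (s - d, d)) \<in> borel_measurable borel" by measurable
      show "H (x + c - d, d) = H (x - d, d)" for x using per[of "x - d" d] by (simp add: algebra_simps)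
    qed (use True in auto)
    then show ?thesis by simp
  next
    case False
    then have "H (s, d) = 0" for s using supp by blast
    then show ?thesis by simp
  qed
  show "(\<integral>\<^sup>+s. (\<integral>\<^sup>+d. H (s + d, d) \<partial>lborel) * indicator {0..<c} s \<partial>lborel)
       = (\<integral>\<^sup>+s. (\<integral>\<^sup>+d. H (s, d) \<partial>lborel) * indicator {0..<c} s \<partial>lborel)"
    using swap[of 1] swap[of 0] 1 by simp
  show "(\<integral>\<^sup>+s. (\<integral>\<^sup>+d. H (s - d, d) \<partial>lborel) * indicator {0..<c} s \<partial>lborel)
       = (\<integral>\<^sup>+s. (\<integral>\<^sup>+d. H (s, d) \<partial>lborel) * indicator {0..<c} s \<partial>lborel)"
    using swap[of "-1"] swap[of 0] 2 by simp
qed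

context symmetric_oval begin

text \<open>Integration over one period of the lifted cylinder. In both coordinate systems \<open>leave\<close> and
  \<open>enter\<close>, which \<open>T\<close> interchanges, the area element is \<open>r s * sin d\<close>; so \<open>T\<close> preserves area.\<close>

definition area :: "(real \<times> real \<Rightarrow> ennreal) \<Rightarrow> ennreal" where
  "area F = (\<integral>\<^sup>+f. (\<integral>\<^sup>+p. F (f, p) \<partial>lborel) * indicator {0..<2 * pi} f \<partial>lborel)"

lemma area_param:
  fixes F :: "real \<times> real \<Rightarrow> ennreal"
  assumes F[measurable]: "F \<in> borel_measurable borel" and supp: "\<And>z. F z \<noteq> 0 \<Longrightarrow> z \<in> lines"
    and e: "e = 1 \<or> e = -1"
  shows "(\<integral>\<^sup>+p. F (f, p) \<partial>lborel)
    = (\<integral>\<^sup>+d. F (f, k (f + e * d) f) * ennreal (r (f + e * d) * sin d) * indicator {0..pi} d \<partial>lborel)"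
proof -
  have F'[measurable]: "F \<in> borel_measurable (borel \<Otimes>\<^sub>M borel)"
    using F by (simp add: borel_prod)
  \<comment> \<open>\<open>k\<close> decreases as \<open>d\<close> runs from 0 to \<open>pi\<close>;
    the sign gives the increasing substitution that the rule requires.\<close>
  define g where "g d = - k (f + e * d) f" for d
  have g0: "g 0 = - h f" by (simp add: g_def)
  have gpi: "g pi = h f" using e k_pi[of f f] k_mpi[of f f] by (auto simp: g_def)
  have "(\<integral>\<^sup>+p. F (f, p) \<partial>lborel) = (\<integral>\<^sup>+p. F (f, 0 + (-1) * p) \<partial>lborel)"
    by (subst nn_integral_real_affine[of _ "-1" 0]) (auto)
  also have "\<dots> = (\<integral>\<^sup>+p. F (f, - p) * indicator {g 0..g pi} p \<partial>lborel)"
    using supp unfolding g0 gpi by (intro nn_integral_cong) (force simp: indicator_def lines_def)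
  also have "\<dots> = (\<integral>\<^sup>+d. F (f, - g d) * ennreal (r (f + e * d) * sin d) * indicator {0..pi} d \<partial>lborel)"
  proof (rule nn_integral_substitution_aux)
    show "(\<lambda>p. F (f, - p)) \<in> borel_measurable borel" by measurable
    show "(g has_real_derivative r (f + e * x) * sin x) (at x)" for x
    proof -
      have "((\<lambda>d. f + e * d) has_real_derivative e) (at x)" by (auto intro!: derivative_eq_intros)
      from DERIV_minus[OF DERIV_chain2[OF k_deriv this, of f]]
      show ?thesis unfolding g_def[abs_def] using e by auto
    qed
    show "continuous_on {0..pi} (\<lambda>x. r (f + e * x) * sin x)"
      by (intro continuous_intros)
    show "0 \<le> r (f + e * x) * sin x" if "x \<in> {0..pi}" for x
      using that r_pos[of "f + e * x"] by (auto intro!: mult_nonneg_nonneg sin_ge_zero)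
  qed auto
  finally show ?thesis by (simp add: g_def)
qed

lemma
  fixes F :: "real \<times> real \<Rightarrow> ennreal"
  assumes F[measurable]: "F \<in> borel_measurable borel" and supp: "\<And>z. F z \<noteq> 0 \<Longrightarrow> z \<in> lines"
    and per: "\<And>z. F (z + (2 * pi, 0)) = F z"
  shows area_leave: "area F = (\<integral>\<^sup>+s. (\<integral>\<^sup>+d. F (leave s d) * ennreal (r s * sin d) * indicator {0..pi} d \<partial>lborel)
        * indicator {0..<2 * pi} s \<partial>lborel)"
    and area_enter: "area F = (\<integral>\<^sup>+s. (\<integral>\<^sup>+d. F (enter s d) * ennreal (r s * sin d) * indicator {0..pi} d \<partial>lborel)
        * indicator {0..<2 * pi} s \<partial>lborel)"
proof -
  have kp: "k (s + 2 * pi) (f + 2 * pi) = k s f" for s f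
    using k_periodic[of s "f + 2 * pi"] k_pi2[of s "f + pi"] k_pi2[of s f] by (simp add: add.assoc)
  have rm: "r \<in> borel_measurable borel" using r_cont by (rule borel_measurable_continuous_onI)
  note [measurable] = rm
  have lm: "(\<lambda>z. leave (fst z) (snd z)) \<in> borel_measurable borel"
    "(\<lambda>z. enter (fst z) (snd z)) \<in> borel_measurable borel"
    by (intro borel_measurable_continuous_onI leave_cont enter_cont)+
  have rs: "(\<lambda>z::real\<times>real. ennreal (r (fst z) * sin (snd z)) * indicator {0..pi} (snd z)) \<in> borel_measurable borel"
    unfolding borel_prod[symmetric] by measurable
  let ?H = "\<lambda>z. F (leave (fst z) (snd z)) * (ennreal (r (fst z) * sin (snd z)) * indicator {0..pi} (snd z))"
  let ?G = "\<lambda>z. F (enter (fst z) (snd z)) * (ennreal (r (fst z) * sin (snd z)) * indicator {0..pi} (snd z))"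
  have Hm: "?H \<in> borel_measurable borel" "?G \<in> borel_measurable borel"
    using measurable_compose[OF lm(1) F] measurable_compose[OF lm(2) F] rs by (auto intro!: borel_measurable_times_ennreal)
  have per': "leave (s + 2 * pi) d = leave s d + (2 * pi, 0)" "enter (s + 2 * pi) d = enter s d + (2 * pi, 0)" for s d
    using kp[of s "s - d"] kp[of s "s + d"] by (auto simp: leave_def enter_def algebra_simps)
  have "area F = (\<integral>\<^sup>+f. (\<integral>\<^sup>+d. ?H (f + d, d) \<partial>lborel) * indicator {0..<2 * pi} f \<partial>lborel)"
    unfolding area_def using area_param[OF F supp, of 1] by (simp add: leave_def mult.assoc)
  also have "\<dots> = (\<integral>\<^sup>+s. (\<integral>\<^sup>+d. ?H (s, d) \<partial>lborel) * indicator {0..<2 * pi} s \<partial>lborel)"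
    by (rule nn_integral_shear(1)[OF Hm(1)]) (auto simp: per' per r_periodic indicator_def split: if_splits)
  finally show "area F = (\<integral>\<^sup>+s. (\<integral>\<^sup>+d. F (leave s d) * ennreal (r s * sin d) * indicator {0..pi} d \<partial>lborel)
        * indicator {0..<2 * pi} s \<partial>lborel)" by (simp add: mult.assoc)
  have "area F = (\<integral>\<^sup>+f. (\<integral>\<^sup>+d. ?G (f - d, d) \<partial>lborel) * indicator {0..<2 * pi} f \<partial>lborel)"
    unfolding area_def using area_param[OF F supp, of "-1"] by (simp add: enter_def mult.assoc)
  also have "\<dots> = (\<integral>\<^sup>+s. (\<integral>\<^sup>+d. ?G (s, d) \<partial>lborel) * indicator {0..<2 * pi} s \<partial>lborel)"
    by (rule nn_integral_shear(2)[OF Hm(2)]) (auto simp: per' per r_periodic indicator_def split: if_splits)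
  finally show "area F = (\<integral>\<^sup>+s. (\<integral>\<^sup>+d. F (enter s d) * ennreal (r s * sin d) * indicator {0..pi} d \<partial>lborel)
        * indicator {0..<2 * pi} s \<partial>lborel)" by (simp add: mult.assoc)
qed

lemma Qf_cont: "continuous_on lines Qf"
  unfolding Qf_def S11_def S22_def S12_def
  by (intro continuous_intros continuous_on_subset[OF lv_cont lines_subset] continuous_on_subset[OF T_cont lines_subset]) auto

lemma area_cong: "(\<And>z. F z = G z) \<Longrightarrow> area F = area G"
  by (simp add: area_def)

lemma area_mono: "(\<And>z. F z \<le> G z) \<Longrightarrow> area F \<le> area G"
  unfolding area_def by (intro nn_integral_mono mult_right_mono) auto

lemma area_add:
  assumes F: "F \<in> borel_measurable borel" and G: "G \<in> borel_measurable borel"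
  shows "area (\<lambda>z. F z + G z) = area F + area G"
proof -
  have [measurable]: "F \<in> borel_measurable (borel \<Otimes>\<^sub>M borel)" "G \<in> borel_measurable (borel \<Otimes>\<^sub>M borel)"
    unfolding borel_prod by (rule F G)+
  have "(\<integral>\<^sup>+p. F (f, p) + G (f, p) \<partial>lborel) = (\<integral>\<^sup>+p. F (f, p) \<partial>lborel) + (\<integral>\<^sup>+p. G (f, p) \<partial>lborel)" for f
    by (rule nn_integral_add) measurable
  then show ?thesis unfolding area_def distrib_right by (simp only: distrib_right) (rule nn_integral_add; measurable)
qed

end

context symmetric_oval begin

lemma lines_shift2_iff: "z + (2 * pi, 0) \<in> lines \<longleftrightarrow> z \<in> lines"
  by (cases z) (simp add: lines_def h_periodic)

lemma low_shift2_iff: "z + (2 * pi, 0) \<in> low \<longleftrightarrow> z \<in> low"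
  using lv_shift2[of z] ev_shift2[of z] by (auto simp: low_def lines_shift2_iff)

lemma Qf_shift2: assumes "z \<in> lines" shows "Qf (z + (2 * pi, 0)) = Qf z"
proof -
  have q: "q (t + 2 * pi) (f + 2 * pi) = q t f" for t f
    unfolding q_def by (simp only: h_periodic h1_periodic) simp
  have T: "T (z + (2 * pi, 0)) = T z + (2 * pi, 0)" using Tn_shift2[OF assms, of 1] by simp
  show ?thesis unfolding Qf_def S11_def S22_def S12_def T lv_shift2[OF assms]
    by (cases z) (simp add: q r_periodic)
qed

end

context quarter_oval begin

text \<open>Antiderivatives of the two trigonometric terms of \<open>Qf (leave s d) * sin d\<close>; thus \<open>W\<close> is the
  integral over \<open>0 < d < w s\<close> of \<open>Qf\<close> and \<open>V\<close> that of \<open>1\<close>, with respect to area.\<close>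

definition I1 :: "real \<Rightarrow> real" where
  "I1 d = d / 4 - sin d * cos d * (1 - 2 * (sin d)\<^sup>2) / 4"

definition I2 :: "real \<Rightarrow> real" where
  "I2 d = 3 * d / 4 - sin d * cos d + sin d * cos d * (1 - 2 * (sin d)\<^sup>2) / 4"

lemma I1_deriv: "(I1 has_real_derivative 2 * (sin d)\<^sup>2 * (cos d)\<^sup>2) (at d)"
proof -
  have c: "(cos d)\<^sup>2 = 1 - (sin d)\<^sup>2" by (simp add: cos_squared_eq)
  have "(I1 has_real_derivative 1/4 - ((cos d)\<^sup>2 - (sin d)\<^sup>2) * (1 - 2 * (sin d)\<^sup>2) / 4 + (sin d)\<^sup>2 * (cos d)\<^sup>2) (at d)"
    unfolding I1_def[abs_def] by (auto intro!: derivative_eq_intros simp: power2_eq_square field_simps)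
  then show ?thesis unfolding c by (elim DERIV_cong) (simp add: power2_eq_square field_simps)
qed

lemma I2_deriv: "(I2 has_real_derivative 2 * (sin d)\<^sup>2 * (sin d)\<^sup>2) (at d)"
proof -
  have c: "(cos d)\<^sup>2 = 1 - (sin d)\<^sup>2" by (simp add: cos_squared_eq)
  have "(I2 has_real_derivative 3/4 - ((cos d)\<^sup>2 - (sin d)\<^sup>2) + ((cos d)\<^sup>2 - (sin d)\<^sup>2) * (1 - 2 * (sin d)\<^sup>2) / 4 - (sin d)\<^sup>2 * (cos d)\<^sup>2) (at d)"
    unfolding I2_def[abs_def] by (auto intro!: derivative_eq_intros simp: power2_eq_square field_simps)
  then show ?thesis unfolding c by (elim DERIV_cong) (simp add: power2_eq_square field_simps)
qed

definition W :: "real \<Rightarrow> real" where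
  "W s = h s * r s * ((h s * (r s - h s) + 2 * (h1 s)\<^sup>2) * I1 (w s) - (h1 s)\<^sup>2 * I2 (w s))"

definition V :: "real \<Rightarrow> real" where
  "V s = r s * (1 - cos (w s))"

lemma w_cont: "continuous_on UNIV w"
  by (rule DERIV_continuous_on) (rule has_field_derivative_at_within[OF w_deriv])

lemma w_cont'[continuous_intros]: "continuous_on S a \<Longrightarrow> continuous_on S (\<lambda>x. w (a x))"
  by (rule continuous_on_compose2[OF w_cont _ subset_UNIV])

lemma W_cont: "continuous_on UNIV W"
  unfolding W_def I1_def I2_def by (intro continuous_intros) auto

lemma V_cont: "continuous_on UNIV V"
  unfolding V_def by (intro continuous_intros)

text \<open>The parameters cover the two uses: \<open>a = 1\<close> with a constant making the form
  nonnegative, and \<open>a = 0\<close> for plain area.\<close>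

lemma inner_integral:
  assumes nn: "\<And>z. z \<in> lines \<Longrightarrow> 0 \<le> a * Qf z + b"
  shows "(\<integral>\<^sup>+d. ennreal (indicator low (leave s d) *\<^sub>R (a * Qf (leave s d) + b)) * ennreal (r s * sin d) * indicator {0..pi} d \<partial>lborel)
    = ennreal (a * W s + b * V s)" (is "?L = _") and "0 \<le> a * W s + b * V s"
proof -
  define G where "G d = (a * (2 * h s * sin d * ((h s * (r s - h s) + 2 * (h1 s)\<^sup>2) * (cos d)\<^sup>2 - (h1 s)\<^sup>2 * (sin d)\<^sup>2)) + b) * (r s * sin d)" for d
  define P where "P d = a * (h s * r s * ((h s * (r s - h s) + 2 * (h1 s)\<^sup>2) * I1 d - (h1 s)\<^sup>2 * I2 d)) + b * (r s * (1 - cos d))" for d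
  have w: "0 < w s" "w s < pi" using w_bounds[of s] by auto
  have Geq: "G d = (a * Qf (leave s d) + b) * (r s * sin d)" if "0 < d" "d < pi" for d
    using Qf_leave[OF that] by (simp add: G_def)
  have Gnn: "0 \<le> G d" if "0 \<le> d" "d \<le> w s" for d
  proof (cases "d = 0")
    case False
    then have d: "0 < d" "d < pi" using that w by auto
    have "0 \<le> a * Qf (leave s d) + b" using nn leave_lines(1)[OF d] by blast
    moreover have "0 \<le> r s * sin d" using r_pos[of s] sin_gt_zero[OF d] by simp
    ultimately show ?thesis unfolding Geq[OF d] by (rule mult_nonneg_nonneg)
  qed (simp add: G_def)
  have Pd: "(P has_real_derivative G d) (at d)" for d
    unfolding P_def[abs_def] G_def
    by (auto intro!: derivative_eq_intros I1_deriv I2_deriv simp: power2_eq_square algebra_simps)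
  have P0: "P 0 = 0" by (simp add: P_def I1_def I2_def)
  have Pw: "P (w s) = a * W s + b * V s" by (simp add: P_def W_def V_def)
  have "?L = (\<integral>\<^sup>+d. ennreal (G d) * indicator {0..w s} d \<partial>lborel)"
  proof (rule nn_integral_cong_AE)
    have "AE d in lborel. d \<noteq> w s \<and> d \<noteq> 0 \<and> d \<noteq> pi"
      using AE_lborel_singleton[of "w s"] AE_lborel_singleton[of "0::real"] AE_lborel_singleton[of pi] by eventually_elim auto
    then show "AE d in lborel. ennreal (indicator low (leave s d) *\<^sub>R (a * Qf (leave s d) + b)) * ennreal (r s * sin d) * indicator {0..pi} d
        = ennreal (G d) * indicator {0..w s} d"
    proof eventually_elim
      case (elim d)
      consider "d < 0 \<or> d > pi" | "0 < d" "d < pi" using elim by linarith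
      then show ?case
      proof cases
        case 1 then show ?thesis using w by (auto simp: indicator_def)
      next
        case 2
        have "0 \<le> r s * sin d" using r_pos[of s] sin_gt_zero[OF 2] by simp
        then show ?thesis using leave_low_iff[OF 2, of s] Geq[OF 2] 2 elim w
          by (auto simp: indicator_def ennreal_mult'')
      qed
    qed
  qed
  also have "\<dots> = ennreal (P (w s) - P 0)"
  proof (rule nn_integral_FTC_Icc)
    show "G \<in> borel_measurable borel"
      unfolding G_def by (intro borel_measurable_continuous_onI continuous_intros)
    show "(P has_real_derivative G x) (at x)" for x by (rule Pd)
  qed (use Gnn w in auto)
  finally show "?L = ennreal (a * W s + b * V s)" by (simp add: P0 Pw)
  have "P 0 \<le> P (w s)"
    by (rule DERIV_nonneg_imp_nondecreasing) (use w Pd Gnn in auto)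
  then show "0 \<le> a * W s + b * V s" by (simp add: P0 Pw)
qed

lemma area_low:
  assumes nn: "\<And>z. z \<in> lines \<Longrightarrow> 0 \<le> a * Qf z + b"
    and W': "\<And>s. (W' has_real_derivative W s) (at s)" and V': "\<And>s. (V' has_real_derivative V s) (at s)"
  shows "area (\<lambda>z. ennreal (indicator low z *\<^sub>R (a * Qf z + b))) = ennreal (a * (W' (2 * pi) - W' 0) + b * (V' (2 * pi) - V' 0))"
proof -
  define F where "F z = ennreal (indicator low z *\<^sub>R (a * Qf z + b))" for z
  define D where "D s = a * W' s + b * V' s" for s
  have Fm: "F \<in> borel_measurable borel"
  proof -
    have "continuous_on low (\<lambda>z. a * Qf z + b)"
      by (intro continuous_intros continuous_on_subset[OF Qf_cont]) (auto simp: low_def)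
    then have "(\<lambda>z. indicator low z *\<^sub>R (a * Qf z + b)) \<in> borel_measurable borel"
      by (intro borel_measurable_continuous_on_indicator) (auto simp: low_open borel_open)
    then show ?thesis unfolding F_def[abs_def] by measurable
  qed
  have per: "F (z + (2 * pi, 0)) = F z" for z
    using Qf_shift2[of z] low_lines[of z] by (auto simp: F_def indicator_def low_shift2_iff)
  have supp: "z \<in> lines" if "F z \<noteq> 0" for z
    using that by (cases "z \<in> low") (auto simp: F_def low_lines)
  have nnJ: "0 \<le> a * W s + b * V s" for s by (rule inner_integral(2)[OF nn])
  have "area F = (\<integral>\<^sup>+s. (\<integral>\<^sup>+d. F (leave s d) * ennreal (r s * sin d) * indicator {0..pi} d \<partial>lborel)
        * indicator {0..<2 * pi} s \<partial>lborel)"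
    by (rule area_leave[OF Fm supp per])
  also have "\<dots> = (\<integral>\<^sup>+s. ennreal (a * W s + b * V s) * indicator {0..<2 * pi} s \<partial>lborel)"
    unfolding F_def by (simp only: inner_integral(1)[OF nn])
  also have "\<dots> = (\<integral>\<^sup>+s. ennreal (a * W s + b * V s) * indicator {0..2 * pi} s \<partial>lborel)"
  proof (rule nn_integral_cong_AE)
    show "AE s in lborel. ennreal (a * W s + b * V s) * indicator {0..<2 * pi} s = ennreal (a * W s + b * V s) * indicator {0..2 * pi} s"
      using AE_lborel_singleton[of "2 * pi"] by eventually_elim (auto simp: indicator_def)
  qed
  also have "\<dots> = ennreal (D (2 * pi) - D 0)"
  proof (rule nn_integral_FTC_Icc)
    show "(\<lambda>s. a * W s + b * V s) \<in> borel_measurable borel"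
      by (intro borel_measurable_continuous_onI continuous_intros W_cont V_cont)
    show "(D has_real_derivative a * W s + b * V s) (at s)" for s
      unfolding D_def[abs_def] by (auto intro!: derivative_eq_intros W' V')
  qed (use nnJ in auto)
  also have "D (2 * pi) - D 0 = a * (W' (2 * pi) - W' 0) + b * (V' (2 * pi) - V' 0)"
    by (simp add: D_def algebra_simps)
  finally show ?thesis unfolding F_def[abs_def] .
qed

lemma area_step:
  assumes g: "continuous_on low g" and per: "\<And>z. z \<in> low \<Longrightarrow> g (z + (2 * pi, 0)) = g z"
  shows "area (\<lambda>z. ennreal (indicator low z *\<^sub>R g (T z))) = area (\<lambda>z. ennreal (indicator low z *\<^sub>R g z))"
proof -
  define F where "F z = ennreal (indicator low z *\<^sub>R g z)" for z
  define G where "G z = ennreal (indicator low z *\<^sub>R g (T z))" for z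
  have m: "(\<lambda>z. ennreal (indicator low z *\<^sub>R u z)) \<in> borel_measurable borel" if "continuous_on low u" for u
  proof -
    have "(\<lambda>z. indicator low z *\<^sub>R u z) \<in> borel_measurable borel"
      using that by (intro borel_measurable_continuous_on_indicator) (auto simp: low_open borel_open)
    then show ?thesis by measurable
  qed
  have Fm: "F \<in> borel_measurable borel" unfolding F_def[abs_def] by (rule m[OF g])
  have "continuous_on low (\<lambda>z. g (T z))"
    by (rule continuous_on_compose2[OF g continuous_on_subset[OF T_cont]])
      (use T_low_iff low_lines lines_clines in auto)
  then have Gm: "G \<in> borel_measurable borel" unfolding G_def[abs_def] by (rule m)
  have T: "T (z + (2 * pi, 0)) = T z + (2 * pi, 0)" if "z \<in> lines" for z using Tn_shift2[OF that, of 1] by simp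
  have perF: "F (z + (2 * pi, 0)) = F z" for z
    using per[of z] by (auto simp: F_def indicator_def low_shift2_iff)
  have perG: "G (z + (2 * pi, 0)) = G z" for z
    using per[of "T z"] T[of z] low_lines[of z] T_low_iff[of z] by (auto simp: G_def indicator_def low_shift2_iff)
  have suppF: "z \<in> lines" if "F z \<noteq> 0" for z
    using that by (cases "z \<in> low") (auto simp: F_def low_lines)
  have suppG: "z \<in> lines" if "G z \<noteq> 0" for z
    using that by (cases "z \<in> low") (auto simp: G_def low_lines)
  have eq: "G (leave s d) * ennreal (r s * sin d) * indicator {0..pi} d
      = F (enter s d) * ennreal (r s * sin d) * indicator {0..pi} d" for s d
  proof (cases "0 < d \<and> d < pi")
    case True
    then show ?thesis using leave_low_iff[of d s] enter_low_iff[of d s] T_leave[of d s] by (simp add: F_def G_def indicator_def)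
  next
    case False
    then have "d = 0 \<or> d = pi \<or> d \<notin> {0..pi}" by auto
    then show ?thesis by (auto simp: indicator_def)
  qed
  have "area G = (\<integral>\<^sup>+s. (\<integral>\<^sup>+d. G (leave s d) * ennreal (r s * sin d) * indicator {0..pi} d \<partial>lborel)
        * indicator {0..<2 * pi} s \<partial>lborel)"
    by (rule area_leave[OF Gm suppG perG])
  also have "\<dots> = (\<integral>\<^sup>+s. (\<integral>\<^sup>+d. F (enter s d) * ennreal (r s * sin d) * indicator {0..pi} d \<partial>lborel)
        * indicator {0..<2 * pi} s \<partial>lborel)"
    by (simp only: eq)
  also have "\<dots> = area F" by (rule area_enter[OF Fm suppF perF, symmetric])
  finally show ?thesis unfolding F_def[abs_def] G_def[abs_def] .
qed

lemma area_iterate: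
  assumes g: "continuous_on low g" and per: "\<And>z. z \<in> low \<Longrightarrow> g (z + (2 * pi, 0)) = g z"
  shows "area (\<lambda>z. ennreal (indicator low z *\<^sub>R g ((T ^^ n) z))) = area (\<lambda>z. ennreal (indicator low z *\<^sub>R g z))"
proof (induction n)
  case (Suc n)
  have c: "continuous_on low (\<lambda>z. g ((T ^^ n) z))"
    by (rule continuous_on_compose2[OF g continuous_on_subset[OF Tn_cont]])
      (use Tn_low low_lines lines_clines in auto)
  have p: "g ((T ^^ n) (z + (2 * pi, 0))) = g ((T ^^ n) z)" if "z \<in> low" for z
    using per[OF Tn_low[OF that]] Tn_shift2[OF low_lines[OF that]] by simp
  from area_step[OF c p] Suc show ?case by (simp only: funpow_Suc_right o_apply)
qed simp

text \<open>Integrate the bounded Birkhoff sums over the invariant domain, divide by \<open>N\<close> and let \<open>N\<close> tend to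
  infinity. The constant \<open>K\<close> only makes the integrands nonnegative.\<close>

lemma integral_nonpos:
  assumes bound: "\<And>z N. z \<in> low \<Longrightarrow> (\<Sum>n=1..N. Qf ((T ^^ n) z)) \<le> C"
    and W': "\<And>s. (W' has_real_derivative W s) (at s)"
  shows "W' (2 * pi) - W' 0 \<le> 0"
proof -
  obtain M where M: "M > 0" "\<And>x. x \<in> lines \<Longrightarrow> \<bar>Qf x\<bar> \<le> 8 * M * M\<^sup>2" using all_bounded by metis
  define K where "K = 8 * M * M\<^sup>2"
  have K: "0 \<le> 1 * Qf z + K" if "z \<in> lines" for z using M(2)[OF that] by (simp add: K_def)
  have K0: "K > 0" using M by (simp add: K_def)
  \<comment> \<open>The case \<open>N = 0\<close> of the bound, whose sum is empty.\<close>
  have cap: "0 \<le> C" if "low \<noteq> {}" using bound[of _ 0] that by auto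
  obtain V' where V': "\<And>s. (V' has_real_derivative V s) (at s)"
    using continuous_antiderivative[OF V_cont] by blast
  define IW IV where "IW = W' (2 * pi) - W' 0" and "IV = V' (2 * pi) - V' 0"
  define g where "g z = 1 * Qf z + K" for z
  have gc: "continuous_on low g" unfolding g_def
    by (intro continuous_intros continuous_on_subset[OF Qf_cont]) (auto simp: low_def)
  have gp: "g (z + (2 * pi, 0)) = g z" if "z \<in> low" for z using Qf_shift2[OF low_lines[OF that]] by (simp add: g_def)
  have gnn: "0 \<le> g ((T ^^ n) z)" if "z \<in> low" for z n
    using K[OF low_lines[OF Tn_low[OF that]]] by (simp add: g_def)
  have a0: "area (\<lambda>z. ennreal (indicator low z *\<^sub>R g z)) = ennreal (IW + K * IV)"
    using area_low[OF K W' V'] by (simp add: g_def IW_def IV_def)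
  have a1: "area (\<lambda>z. ennreal (indicator low z *\<^sub>R c)) = ennreal (c * IV)" if "c \<ge> 0" for c
    using area_low[of 0 c, OF _ W' V'] that by (simp add: IV_def)
  have low: "leave 0 (w 0 / 2) \<in> low"
    using leave_low_iff[of "w 0 / 2" 0] w_bounds[of 0] by auto
  then have C0: "0 \<le> C" using cap by blast
  have mS: "(\<lambda>z. ennreal (indicator low z *\<^sub>R u z)) \<in> borel_measurable borel" if "continuous_on low u" for u
  proof -
    have "(\<lambda>z. indicator low z *\<^sub>R u z) \<in> borel_measurable borel"
      using that by (intro borel_measurable_continuous_on_indicator) (auto simp: low_open borel_open)
    then show ?thesis by measurable
  qed
  have cn: "continuous_on low (\<lambda>z. g ((T ^^ n) z))" for n
    by (rule continuous_on_compose2[OF gc continuous_on_subset[OF Tn_cont]])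
      (use Tn_low low_lines lines_clines in auto)
  have IVn: "0 \<le> IV"
  proof -
    have "V' 0 \<le> V' (2 * pi)"
    proof (rule DERIV_nonneg_imp_nondecreasing[of 0 "2 * pi" V'])
      have "0 \<le> V s" for s using r_pos[of s] by (simp add: V_def)
      then show "\<exists>y. (V' has_real_derivative y) (at s) \<and> 0 \<le> y" for s using V'[of s] by blast
    qed simp
    then show ?thesis by (simp add: IV_def)
  qed
  have IWn: "0 \<le> IW + K * IV"
  proof -
    have "W' 0 + K * V' 0 \<le> W' (2 * pi) + K * V' (2 * pi)"
    proof (rule DERIV_nonneg_imp_nondecreasing[of 0 "2 * pi" "\<lambda>s. W' s + K * V' s"])
      fix s
      have "((\<lambda>s. W' s + K * V' s) has_real_derivative W s + K * V s) (at s)"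
        by (auto intro!: derivative_eq_intros W' V')
      then show "\<exists>y. ((\<lambda>s. W' s + K * V' s) has_real_derivative y) (at s) \<and> 0 \<le> y"
        using inner_integral(2)[OF K, of s] by auto
    qed simp
    then show ?thesis by (simp add: IW_def IV_def algebra_simps)
  qed
  have sum: "area (\<lambda>z. ennreal (indicator low z *\<^sub>R (\<Sum>n=1..N. g ((T ^^ n) z)))) = ennreal (real N * (IW + K * IV))" for N
  proof (induction N)
    case 0 then show ?case by (simp add: area_def)
  next
    case (Suc N)
    have "area (\<lambda>z. ennreal (indicator low z *\<^sub>R (\<Sum>n=1..Suc N. g ((T ^^ n) z))))
      = area (\<lambda>z. ennreal (indicator low z *\<^sub>R (\<Sum>n=1..N. g ((T ^^ n) z))) + ennreal (indicator low z *\<^sub>R g ((T ^^ Suc N) z)))"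
      by (rule area_cong) (auto simp: indicator_def sum_nonneg gnn ennreal_plus[symmetric] gnn[where n = "Suc _", simplified] simp del: ennreal_plus)
    also have "\<dots> = area (\<lambda>z. ennreal (indicator low z *\<^sub>R (\<Sum>n=1..N. g ((T ^^ n) z)))) + area (\<lambda>z. ennreal (indicator low z *\<^sub>R g ((T ^^ Suc N) z)))"
      by (intro area_add mS continuous_on_sum cn)
    also have "\<dots> = ennreal (real N * (IW + K * IV)) + ennreal (IW + K * IV)"
      by (rule arg_cong2[where f = "(+)", OF Suc trans[OF area_iterate[OF gc gp] a0]])
    also have "\<dots> = ennreal (real N * (IW + K * IV) + (IW + K * IV))"
      using IWn by (subst ennreal_plus) auto
    finally show ?case by (simp add: algebra_simps)
  qed
  have key: "real N * IW \<le> C * IV" for N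
  proof -
    have "area (\<lambda>z. ennreal (indicator low z *\<^sub>R (\<Sum>n=1..N. g ((T ^^ n) z)))) \<le> area (\<lambda>z. ennreal (indicator low z *\<^sub>R (C + real N * K)))"
    proof (rule area_mono)
      fix z
      have "(\<Sum>n=1..N. g ((T ^^ n) z)) \<le> C + real N * K" if "z \<in> low"
        using bound[OF that, of N] by (simp add: g_def sum.distrib)
      then show "ennreal (indicator low z *\<^sub>R (\<Sum>n=1..N. g ((T ^^ n) z))) \<le> ennreal (indicator low z *\<^sub>R (C + real N * K))"
        by (auto simp: indicator_def ennreal_leI)
    qed
    then have "ennreal (real N * (IW + K * IV)) \<le> ennreal ((C + real N * K) * IV)"
      unfolding sum using C0 K0 by (subst (asm) a1) auto
    then have "real N * (IW + K * IV) \<le> (C + real N * K) * IV"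
      using C0 K0 IVn by (subst (asm) ennreal_le_iff) auto
    then show ?thesis by (simp add: algebra_simps)
  qed
  show ?thesis
  proof (rule ccontr)
    assume "\<not> ?thesis"
    then have "IW > 0" by (simp add: IW_def)
    then obtain N :: nat where "C * IV < real N * IW" using reals_Archimedean3 by blast
    then show False using key[of N] by simp
  qed
qed

end

section \<open>Rigidity\<close>

text \<open>The simple pole of the cotangent is compensated by the double zero of the square; this
  disposes of the boundary terms in \<open>wirtinger_rigidity\<close>.\<close>

lemma cot_square_limit:
  fixes g :: "real \<Rightarrow> real"
  assumes "(g has_real_derivative g') (at 0)" "g 0 = 0"
  shows "((\<lambda>s. 2 * cot (2 * s) * (g s)\<^sup>2) \<longlongrightarrow> 0) (at_right 0)"
proof -
  have 1: "((\<lambda>s. g s / s) \<longlongrightarrow> g') (at_right 0)"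
    using assms by (auto simp: has_field_derivative_iff intro: filterlim_mono[OF _ order_refl at_le])
  have "((\<lambda>s. sin (2 * s)) has_real_derivative 2) (at (0::real))"
    by (auto intro!: derivative_eq_intros)
  then have 2: "((\<lambda>s::real. sin (2 * s) / s) \<longlongrightarrow> 2) (at_right 0)"
    by (auto simp: has_field_derivative_iff intro: filterlim_mono[OF _ order_refl at_le])
  have 3: "(g \<longlongrightarrow> 0) (at_right 0)"
    using DERIV_isCont[OF assms(1)] assms(2) by (auto simp: isCont_def intro: filterlim_mono[OF _ order_refl at_le])
  have 4: "((\<lambda>s::real. cos (2 * s)) \<longlongrightarrow> cos (2 * 0)) (at_right 0)" by (intro tendsto_intros)
  have "((\<lambda>s. 2 * (cos (2 * s) * g s * ((g s / s) / (sin (2 * s) / s)))) \<longlongrightarrow> 2 * (cos (2 * 0) * 0 * (g' / 2))) (at_right 0)"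
    by (intro tendsto_intros 1 2 3 4) simp
  moreover have "\<forall>\<^sub>F s in at_right 0. 2 * (cos (2 * s) * g s * ((g s / s) / (sin (2 * s) / s))) = 2 * cot (2 * s) * (g s)\<^sup>2"
    by (rule eventually_mono[OF eventually_at_right_less[of 0]]) (simp add: cot_def power2_eq_square)
  ultimately show ?thesis using Lim_transform_eventually by force
qed

text \<open>Stated with absolute values so that it also applies to functions changing sign under the
  shift by \<open>c\<close>.\<close>

lemma periodic_zero:
  fixes f :: "real \<Rightarrow> real"
  assumes per: "\<And>t. \<bar>f (t + c)\<bar> = \<bar>f t\<bar>" and c: "c > 0" and z: "\<And>t. 0 \<le> t \<Longrightarrow> t < c \<Longrightarrow> f t = 0"
  shows "f t = 0"
proof -
  obtain n :: int where n: "0 \<le> t + of_int n * c" "t + of_int n * c < 0 + c"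
    using reduce_mod_period[OF c, of 0 t] by blast
  have "\<bar>f (t + of_int n * c)\<bar> = \<bar>f t\<bar>" by (rule periodic_int) (rule per)
  then show ?thesis using z[OF n(1)] n(2) by simp
qed

text \<open>The equality case of Wirtinger's inequality. The proof completes the square
  \<open>(f' - 2 cot (2s) f)\<^sup>2\<close> on an interval of length \<open>\<pi>/2\<close> between two zeros of \<open>f\<close>.\<close>

lemma wirtinger_rigidity:
  fixes f f' :: "real \<Rightarrow> real"
  assumes f: "\<And>s. (f has_real_derivative f' s) (at s)"
    and anti: "\<And>s. f (s + pi / 2) = - f s" and anti': "\<And>s. f' (s + pi / 2) = - f' s"
    and D: "\<And>s. (D has_real_derivative (f' s)\<^sup>2 - 4 * (f s)\<^sup>2) (at s)"
    and D_le: "D (2 * pi) - D 0 \<le> 0"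
  shows "\<exists>c s0. \<forall>s. f s = c * sin (2 * (s - s0))"
proof -
  have "\<exists>s0. f s0 = 0"
  proof (cases "f 0 \<le> 0")
    case True
    then have "\<exists>x\<ge>0. x \<le> pi/2 \<and> f x = 0"
      using anti[of 0] f by (intro IVT) (auto intro: DERIV_isCont)
    then show ?thesis by blast
  next
    case False
    then have "\<exists>x\<ge>0. x \<le> pi/2 \<and> f x = 0"
      using anti[of 0] f by (intro IVT2) (auto intro: DERIV_isCont)
    then show ?thesis by blast
  qed
  then obtain s0 where s0: "f s0 = 0" by blast
  \<comment> \<open>The integrand is invariant under the quarter shift, because \<open>f\<close> and
    \<open>f'\<close> only change sign. So \<open>D\<close> gains the same \<open>\<kappa>\<close>
    over every quarter turn.\<close>
  define \<kappa> where "\<kappa> = D (s0 + pi / 2) - D s0"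
  have kap: "D (s + pi / 2) - D s = \<kappa>" for s
  proof -
    have "((\<lambda>s. D (s + pi/2) - D s) has_real_derivative 0) (at s)" for s
    proof -
      have "((\<lambda>s. D (s + pi/2)) has_real_derivative (f' (s + pi/2))\<^sup>2 - 4 * (f (s + pi/2))\<^sup>2) (at s)"
        using D[of "s + pi/2"] by (simp add: DERIV_shift)
      from DERIV_diff[OF this D[of s]] show ?thesis by (simp add: anti anti')
    qed
    then have "(\<lambda>s. D (s + pi/2) - D s) s = (\<lambda>s. D (s + pi/2) - D s) s0" by (rule DERIV_isconst_all[rule_format])
    then show ?thesis by (simp add: \<kappa>_def)
  qed
  have "D (2 * pi) - D 0 = 4 * \<kappa>"
  proof -
    have "0 + pi/2 + pi/2 + pi/2 + pi/2 = 2 * pi" by simp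
    then show ?thesis using kap[of 0] kap[of "0 + pi/2"] kap[of "0 + pi/2 + pi/2"] kap[of "0 + pi/2 + pi/2 + pi/2"] by simp
  qed
  then have kle: "\<kappa> \<le> 0" using D_le by simp
  define g where "g s = f (s0 + s)" for s
  define g' where "g' s = f' (s0 + s)" for s
  have g: "(g has_real_derivative g' s) (at s)" for s
    using f[of "s0 + s"] unfolding g_def[abs_def] g'_def by (simp add: DERIV_shift add.commute[of s0])
  have g0: "g 0 = 0" "g (pi/2) = 0" using s0 anti[of s0] by (auto simp: g_def)
  \<comment> \<open>\<open>D\<close> minus the boundary term of the completed square; its derivative
    is the square itself.\<close>
  define M where "M s = D (s0 + s) - D s0 - 2 * cot (2 * s) * (g s)\<^sup>2" for s
  have sp: "sin (2 * s) > 0" if "0 < s" "s < pi/2" for s using that by (intro sin_gt_zero) auto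
  have M': "(M has_real_derivative (g' s - 2 * cot (2 * s) * g s)\<^sup>2) (at s)" if s: "0 < s" "s < pi/2" for s
  proof -
    have n: "sin (2 * s) \<noteq> 0" using sp[OF s] by simp
    have "((\<lambda>s. D (s0 + s)) has_real_derivative (g' s)\<^sup>2 - 4 * (g s)\<^sup>2) (at s)"
      using D[of "s0 + s"] unfolding g_def g'_def by (simp add: DERIV_shift add.commute[of s0])
    moreover have "((\<lambda>s. cot (2 * s)) has_real_derivative - (2 * inverse ((sin (2 * s))\<^sup>2))) (at s)"
    proof -
      have "((\<lambda>s. 2 * s) has_real_derivative 2) (at s)" by (auto intro!: derivative_eq_intros)
      from DERIV_chain2[where f = cot and g = "\<lambda>s. 2 * s", OF DERIV_cot[OF n] this] show ?thesis
        by (simp add: mult.commute)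
    qed
    ultimately have "(M has_real_derivative (g' s)\<^sup>2 - 4 * (g s)\<^sup>2
        - (2 * (- (2 * inverse ((sin (2 * s))\<^sup>2))) * (g s)\<^sup>2 + 2 * cot (2 * s) * (2 * g s * g' s))) (at s)"
      unfolding M_def[abs_def] by (auto intro!: derivative_eq_intros g simp: algebra_simps)
    moreover have "inverse ((sin (2 * s))\<^sup>2) = 1 + (cot (2 * s))\<^sup>2"
    proof -
      have "1 + (cot (2 * s))\<^sup>2 = ((sin (2 * s))\<^sup>2 + (cos (2 * s))\<^sup>2) / (sin (2 * s))\<^sup>2"
        unfolding add_divide_distrib using n by (simp add: cot_def power_divide)
      then show ?thesis by (simp only: sin_cos_squared_add inverse_eq_divide)
    qed
    ultimately show ?thesis by (simp only:) (elim DERIV_cong, simp add: power2_eq_square algebra_simps)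
  qed
  have mono: "M s \<le> M t" if "0 < s" "s \<le> t" "t < pi/2" for s t
  proof (rule DERIV_nonneg_imp_nondecreasing[OF that(2)])
    fix x assume x: "s \<le> x" "x \<le> t"
    show "\<exists>y. (M has_real_derivative y) (at x) \<and> 0 \<le> y"
      by (rule exI[of _ "(g' x - 2 * cot (2 * x) * g x)\<^sup>2"]) (use M'[of x] x that in auto)
  qed
  have contD: "isCont D s" for s using D DERIV_isCont by blast
  have lim0: "(M \<longlongrightarrow> 0) (at_right 0)"
  proof -
    have "isCont (\<lambda>s. D (s0 + s)) 0" by (intro isCont_o2[OF _ contD] continuous_intros)
    then have "((\<lambda>s. D (s0 + s)) \<longlongrightarrow> D (s0 + 0)) (at_right 0)"
      by (auto simp: isCont_def intro: filterlim_mono[OF _ order_refl at_le])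
    from tendsto_diff[OF tendsto_diff[OF this tendsto_const[of "D s0"]] cot_square_limit[OF g[of 0] g0(1)]]
    show ?thesis unfolding M_def by simp
  qed
  have lim1: "((\<lambda>u. M (pi/2 - u)) \<longlongrightarrow> \<kappa>) (at_right 0)"
  proof -
    have "isCont (\<lambda>u. D (s0 + (pi/2 - u))) 0" by (intro isCont_o2[OF _ contD] continuous_intros)
    then have "((\<lambda>u. D (s0 + (pi/2 - u))) \<longlongrightarrow> D (s0 + (pi/2 - 0))) (at_right 0)"
      by (auto simp: isCont_def intro: filterlim_mono[OF _ order_refl at_le])
    moreover have "((\<lambda>u. g (pi/2 - u)) has_real_derivative - g' (pi/2)) (at 0)"
      by (rule DERIV_chain2[of g "g' (pi/2)", THEN DERIV_cong]) (use g[of "pi/2"] in \<open>auto intro!: derivative_eq_intros\<close>)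
    note cot_square_limit[OF this]
    ultimately have "((\<lambda>u. D (s0 + (pi/2 - u)) - D s0 + 2 * cot (2 * u) * (g (pi/2 - u))\<^sup>2) \<longlongrightarrow> D (s0 + (pi/2 - 0)) - D s0 + 0) (at_right 0)"
      using g0 by (intro tendsto_intros) auto
    moreover have "cot (2 * (pi/2 - u)) = - cot (2 * u)" for u :: real
    proof -
      have "2 * (pi/2 - u) = pi - 2 * u" by simp
      then show ?thesis by (simp add: cot_def)
    qed
    ultimately show ?thesis unfolding M_def by (simp add: \<kappa>_def)
  qed
  \<comment> \<open>\<open>M\<close> is monotone between the limits 0 and
    \<open>\<kappa> \<le> 0\<close>, so it is constantly 0 and the square vanishes.\<close>
  have M0: "M s = 0" if s: "0 < s" "s < pi/2" for s
  proof -
    have "0 \<le> M s"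
    proof (rule tendsto_upperbound[OF lim0])
      show "\<forall>\<^sub>F u in at_right 0. M u \<le> M s"
        by (rule eventually_at_rightI[of 0 s]) (use mono s in auto)
    qed simp
    moreover have "M s \<le> \<kappa>"
    proof (rule tendsto_lowerbound[OF lim1])
      show "\<forall>\<^sub>F u in at_right 0. M s \<le> M (pi/2 - u)"
        by (rule eventually_at_rightI[of 0 "pi/2 - s"]) (use mono s in auto)
    qed simp
    ultimately show ?thesis using kle by simp
  qed
  have ode: "g' s = 2 * cot (2 * s) * g s" if s: "0 < s" "s < pi/2" for s
  proof -
    have "(M has_real_derivative 0) (at s)"
    proof (rule has_field_derivative_transform_within_open[where S = "{0<..<pi/2}"])
      show "((\<lambda>_. 0) has_real_derivative 0) (at s)" by simp
    qed (use M0 s in auto)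
    from DERIV_unique[OF this M'[OF s]] show ?thesis by simp
  qed
  have quot: "((\<lambda>s. g s / sin (2 * s)) has_real_derivative 0) (at s)" if s: "0 < s" "s < pi/2" for s
  proof -
    have n: "sin (2 * s) \<noteq> 0" using sp[OF s] by simp
    have "((\<lambda>s. sin (2 * s)) has_real_derivative 2 * cos (2 * s)) (at s)" by (auto intro!: derivative_eq_intros)
    from DERIV_divide[OF g[of s] this n] show ?thesis
      by (elim DERIV_cong) (use n in \<open>simp add: ode[OF s] cot_def\<close>)
  qed
  have "\<exists>c. \<forall>s\<in>{0<..<pi/2}. g s / sin (2 * s) = c"
  proof (rule has_field_derivative_zero_constant)
    show "((\<lambda>s. g s / sin (2 * s)) has_real_derivative 0) (at s within {0<..<pi/2})" if "s \<in> {0<..<pi/2}" for s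
      by (rule has_field_derivative_at_within[OF quot]) (use that in auto)
  qed simp
  then obtain c where c: "\<And>s. 0 < s \<Longrightarrow> s < pi/2 \<Longrightarrow> g s / sin (2 * s) = c" by auto
  have gc: "g s = c * sin (2 * s)" if s: "0 < s" "s < pi/2" for s
  proof -
    have "g s / sin (2 * s) = c" by (rule c[OF s])
    then show ?thesis using sp[OF s] by (simp add: field_simps)
  qed
  have "g s - c * sin (2 * s) = 0" for s
  proof (rule periodic_zero[of "\<lambda>s. g s - c * sin (2 * s)" "pi/2"])
    fix t
    have "2 * (t + pi/2) = 2 * t + pi" by simp
    then have "g (t + pi/2) - c * sin (2 * (t + pi/2)) = - (g t - c * sin (2 * t))"
      using anti[of "s0 + t"] by (simp only: g_def sin_periodic_pi) (simp add: add.assoc)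
    then show "\<bar>g (t + pi/2) - c * sin (2 * (t + pi/2))\<bar> = \<bar>g t - c * sin (2 * t)\<bar>" by simp
    show "g t - c * sin (2 * t) = 0" if "0 \<le> t" "t < pi/2"
      using that gc[of t] g0 by (cases "t = 0") auto
  qed simp
  then have "f s = c * sin (2 * (s - s0))" for s
    using spec[of "\<lambda>s. g s - c * sin (2 * s) = 0" "s - s0"] by (simp add: g_def)
  then show ?thesis by blast
qed

text \<open>The core computation, for \<open>S = sin w\<close>, \<open>C = cos w\<close>, \<open>a = w'\<close>, \<open>b = w''\<close> and \<open>H = \<pi>/2\<close>: adding
  the values of \<open>W\<close> at \<open>s\<close> and \<open>s + \<pi>/2\<close> leaves Wirtinger's integrand for \<open>cos (2 w)\<close> up to the
  total derivative \<open>U1\<close> of a periodic function \<open>U\<close>.\<close>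

lemma weight_identity:
  fixes S C w a b H :: real
  assumes SC: "S * S + C * C = 1"
  shows "4 * S * (S + (C * b - S * a\<^sup>2)) * ((S * (C * b - S * a\<^sup>2) + 2 * (C * a)\<^sup>2) * (w - S * C * (1 - 2 * S\<^sup>2)) - (C * a)\<^sup>2 * (3 * w - 4 * S * C + S * C * (1 - 2 * S\<^sup>2)))
    + 4 * C * (C + (- S * b - C * a\<^sup>2)) * ((C * (- S * b - C * a\<^sup>2) + 2 * (S * a)\<^sup>2) * ((H - w) - S * C * (1 - 2 * C\<^sup>2)) - (S * a)\<^sup>2 * (3 * (H - w) - 4 * S * C + S * C * (1 - 2 * C\<^sup>2)))
   = 4 * H * ((S * C * b + (C\<^sup>2 - S\<^sup>2) * a\<^sup>2)\<^sup>2 - 4 * S\<^sup>2 * C\<^sup>2 * a\<^sup>2)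
    + (4 * (((C\<^sup>2 - S\<^sup>2) * a * (a - a ^ 3) + S * C * (b - 3 * a\<^sup>2 * b)) * w + S * C * (a - a ^ 3) * a)
       - 2 * H * ((C\<^sup>2 - S\<^sup>2) * a * (a - a ^ 3) + S * C * (b - 3 * a\<^sup>2 * b))
       - 2 * H * ((- 4 * S * C * a) * (S * C) * (a + a ^ 3) + (C\<^sup>2 - S\<^sup>2) * ((C\<^sup>2 - S\<^sup>2) * a * (a + a ^ 3) + S * C * (b + 3 * a\<^sup>2 * b)))
       - 4 * ((2 * S * C\<^sup>2 * (C * a) - 2 * C * S\<^sup>2 * (S * a)) * (C\<^sup>2 - S\<^sup>2) * (a - a ^ 3)
          + S\<^sup>2 * C\<^sup>2 * ((- 4 * S * C * a) * (a - a ^ 3) + (C\<^sup>2 - S\<^sup>2) * (b - 3 * a\<^sup>2 * b))))"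
  using SC by algebra

context quarter_oval begin

text \<open>\<open>yc = cos (2 w)\<close> and its first two derivatives. As \<open>2 h\<^sup>2 = R\<^sup>2 (1 - yc)\<close>, the oval is an ellipse
  if \<open>yc\<close> is a harmonic of frequency \<open>2\<close>.\<close>

definition yc :: "real \<Rightarrow> real" where "yc s = (cos (w s))\<^sup>2 - (sin (w s))\<^sup>2"
definition yc1 :: "real \<Rightarrow> real" where "yc1 s = - 4 * (sin (w s) * cos (w s) * w1 s)"
definition yc2 :: "real \<Rightarrow> real" where
  "yc2 s = - 4 * (sin (w s) * cos (w s) * w2 s + yc s * (w1 s)\<^sup>2)"

lemma yc_deriv: "(yc has_real_derivative yc1 s) (at s)"
  unfolding yc_def[abs_def] yc1_def by (auto intro!: derivative_eq_intros w_deriv simp: algebra_simps)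

lemma yc1_deriv: "(yc1 has_real_derivative yc2 s) (at s)"
  unfolding yc1_def[abs_def] yc2_def yc_def
  by (auto intro!: derivative_eq_intros w_deriv w1_deriv simp: algebra_simps power2_eq_square)

lemma sin_cos_w_half: "sin (w (s + pi / 2)) = cos (w s)" "cos (w (s + pi / 2)) = sin (w s)"
  by (simp_all add: w_half sin_diff cos_diff)

lemma yc_half: "yc (s + pi / 2) = - yc s" "yc1 (s + pi / 2) = - yc1 s" "yc2 (s + pi / 2) = - yc2 s"
  unfolding yc1_def yc2_def yc_def sin_cos_w_half w1_half w2_half by (simp_all add: algebra_simps)

text \<open>Only \<open>w\<close> and its first derivative occur, so \<open>U\<close> is
  differentiable for a \<open>C\<^sup>2\<close> table. Its values at 0 and \<open>2 * pi\<close>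
  agree, and it drops out of the integral.\<close>

definition U :: "real \<Rightarrow> real" where
  "U s = 4 * ((sin (w s) * cos (w s)) * (w1 s - w1 s ^ 3) * w s)
     - pi * ((sin (w s) * cos (w s)) * (w1 s - w1 s ^ 3))
     - pi * (yc s * ((sin (w s) * cos (w s)) * (w1 s + w1 s ^ 3)))
     - 4 * ((sin (w s))\<^sup>2 * (cos (w s))\<^sup>2 * (yc s * (w1 s - w1 s ^ 3)))"

definition U1 :: "real \<Rightarrow> real" where
  "U1 s = (let S = sin (w s); C = cos (w s); a = w1 s; b = w2 s; H = pi / 2 in
    4 * (((C\<^sup>2 - S\<^sup>2) * a * (a - a ^ 3) + S * C * (b - 3 * a\<^sup>2 * b)) * w s + S * C * (a - a ^ 3) * a)
       - 2 * H * ((C\<^sup>2 - S\<^sup>2) * a * (a - a ^ 3) + S * C * (b - 3 * a\<^sup>2 * b))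
       - 2 * H * ((- 4 * S * C * a) * (S * C) * (a + a ^ 3) + (C\<^sup>2 - S\<^sup>2) * ((C\<^sup>2 - S\<^sup>2) * a * (a + a ^ 3) + S * C * (b + 3 * a\<^sup>2 * b)))
       - 4 * ((2 * S * C\<^sup>2 * (C * a) - 2 * C * S\<^sup>2 * (S * a)) * (C\<^sup>2 - S\<^sup>2) * (a - a ^ 3)
          + S\<^sup>2 * C\<^sup>2 * ((- 4 * S * C * a) * (a - a ^ 3) + (C\<^sup>2 - S\<^sup>2) * (b - 3 * a\<^sup>2 * b))))"

lemma U_deriv: "(U has_real_derivative U1 s) (at s)"
proof -
  have sc: "((\<lambda>s. sin (w s) * cos (w s)) has_real_derivative yc s * w1 s) (at s)"
    unfolding yc_def by (auto intro!: derivative_eq_intros w_deriv simp: algebra_simps power2_eq_square)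
  have m: "((\<lambda>s. w1 s - w1 s ^ 3) has_real_derivative w2 s - 3 * (w1 s)\<^sup>2 * w2 s) (at s)"
    by (auto intro!: derivative_eq_intros w1_deriv)
  have p: "((\<lambda>s. w1 s + w1 s ^ 3) has_real_derivative w2 s + 3 * (w1 s)\<^sup>2 * w2 s) (at s)"
    by (auto intro!: derivative_eq_intros w1_deriv)
  have s2: "((\<lambda>s. (sin (w s))\<^sup>2 * (cos (w s))\<^sup>2) has_real_derivative
     2 * sin (w s) * (cos (w s))\<^sup>2 * (cos (w s) * w1 s) - 2 * cos (w s) * (sin (w s))\<^sup>2 * (sin (w s) * w1 s)) (at s)"
    by (auto intro!: derivative_eq_intros w_deriv simp: algebra_simps)
  show ?thesis
    unfolding U_def[abs_def]
    by (rule DERIV_cong[OF DERIV_diff[OF DERIV_diff[OF DERIV_diff[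
      OF DERIV_cmult[OF DERIV_mult[OF DERIV_mult[OF sc m] w_deriv]]
      DERIV_cmult[OF DERIV_mult[OF sc m]]]
      DERIV_cmult[OF DERIV_mult[OF yc_deriv DERIV_mult[OF sc p]]]]
      DERIV_cmult[OF DERIV_mult[OF s2 DERIV_mult[OF yc_deriv m]]]]])
      (simp add: U1_def Let_def yc_def yc1_def algebra_simps)
qed

text \<open>\<open>I1\<close> and \<open>I2\<close> carry a quarter and
  \<open>weight_identity\<close> another factor 4, which makes the 16. Its coefficient
  \<open>4 * H\<close> is \<open>2 * pi\<close>, and the form in \<open>yc1\<close> and
  \<open>yc2\<close> is 16 times the bracket there; \<open>2 * pi / 256\<close> is
  \<open>pi / 128\<close>.\<close>

lemma W_sum: "W s + W (s + pi / 2) = R ^ 4 * (pi / 128 * ((yc2 s)\<^sup>2 - 4 * (yc1 s)\<^sup>2) + U1 s / 16)"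
proof -
  define S C a b where "S = sin (w s)" and "C = cos (w s)" and "a = w1 s" and "b = w2 s"
  have hs: "h s = R * S" "h1 s = R * (C * a)" "r s = R * (S + (C * b - S * a\<^sup>2))"
    using h_R_w(1)[of s] h1_w[of s] r_w[of s] by (simp_all add: S_def C_def a_def b_def algebra_simps)
  have "h (s + pi/2) = R * C" using h_R_w(2)[of s] by (simp add: C_def)
  moreover have "h1 (s + pi/2) = - R * (S * a)"
    using h1_w[of "s + pi/2"] by (simp add: sin_cos_w_half w1_half S_def a_def)
  moreover have "r (s + pi/2) - h (s + pi/2) = R * (- S * b - C * a\<^sup>2)"
    using r_w[of "s + pi/2"] by (simp add: sin_cos_w_half w1_half w2_half S_def C_def a_def b_def)
  ultimately have hs': "h (s + pi/2) = R * C" "h1 (s + pi/2) = - R * (S * a)"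
    "r (s + pi/2) = R * (C + (- S * b - C * a\<^sup>2))"
    by (simp_all add: algebra_simps)
  have i: "I1 (w s) = (w s - S * C * (1 - 2 * S\<^sup>2)) / 4" "I2 (w s) = (3 * w s - 4 * S * C + S * C * (1 - 2 * S\<^sup>2)) / 4"
    by (simp_all add: I1_def I2_def S_def C_def field_simps)
  have i': "I1 (w (s + pi/2)) = ((pi/2 - w s) - S * C * (1 - 2 * C\<^sup>2)) / 4"
    "I2 (w (s + pi/2)) = (3 * (pi/2 - w s) - 4 * S * C + S * C * (1 - 2 * C\<^sup>2)) / 4"
    unfolding I1_def I2_def sin_cos_w_half unfolding w_half by (simp_all add: S_def C_def field_simps)
  have f1: "R ^ 4 = R * R * R * R" by (simp add: eval_nat_numeral)
  have 1: "16 * W s = R ^ 4 * (4 * S * (S + (C * b - S * a\<^sup>2)) * ((S * (C * b - S * a\<^sup>2) + 2 * (C * a)\<^sup>2) * (w s - S * C * (1 - 2 * S\<^sup>2)) - (C * a)\<^sup>2 * (3 * w s - 4 * S * C + S * C * (1 - 2 * S\<^sup>2))))"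
    unfolding W_def hs i f1 power2_eq_square by (simp add: field_simps)
  have 2: "16 * W (s + pi/2) = R ^ 4 * (4 * C * (C + (- S * b - C * a\<^sup>2)) * ((C * (- S * b - C * a\<^sup>2) + 2 * (S * a)\<^sup>2) * ((pi/2 - w s) - S * C * (1 - 2 * C\<^sup>2)) - (S * a)\<^sup>2 * (3 * (pi/2 - w s) - 4 * S * C + S * C * (1 - 2 * C\<^sup>2))))"
    unfolding W_def hs' i' f1 power2_eq_square by (simp add: field_simps)
  have SC: "S * S + C * C = 1" using sin_cos_squared_add[of "w s"] by (simp only: power2_eq_square S_def C_def)
  have y: "(yc2 s)\<^sup>2 - 4 * (yc1 s)\<^sup>2 = 16 * ((S * C * b + (C\<^sup>2 - S\<^sup>2) * a\<^sup>2)\<^sup>2 - 4 * S\<^sup>2 * C\<^sup>2 * a\<^sup>2)"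
    unfolding yc2_def yc1_def yc_def S_def C_def a_def b_def
    by (simp only: power_mult_distrib) (simp add: algebra_simps)
  have "16 * W s + 16 * W (s + pi/2) = R ^ 4 * (4 * (pi/2) * ((S * C * b + (C\<^sup>2 - S\<^sup>2) * a\<^sup>2)\<^sup>2 - 4 * S\<^sup>2 * C\<^sup>2 * a\<^sup>2) + U1 s)"
    unfolding 1 2 distrib_left[symmetric] weight_identity[OF SC, of b a "w s" "pi/2"]
    by (simp only: U1_def Let_def S_def C_def a_def b_def)
  then show ?thesis unfolding y by (simp add: algebra_simps)
qed

lemma ellipse_support:
  assumes W': "\<And>s. (W' has_real_derivative W s) (at s)" and le: "W' (2 * pi) - W' 0 \<le> 0"
  shows "\<exists>a>0. \<exists>b>0. \<exists>s0. \<forall>s. (h s)\<^sup>2 = a\<^sup>2 * (cos (s - s0))\<^sup>2 + b\<^sup>2 * (sin (s - s0))\<^sup>2"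
proof -
  have "continuous_on UNIV w1" "continuous_on UNIV yc1"
    by (rule DERIV_continuous_on, rule has_field_derivative_at_within, rule w1_deriv yc1_deriv)+
  note [continuous_intros] = continuous_on_compose2[OF this(1) _ subset_UNIV] this(2)
  have "continuous_on UNIV yc2"
    unfolding yc2_def yc_def w2_def
    by (intro continuous_intros \<open>continuous_on UNIV w1\<close> r_cont) (use h_pos in \<open>auto simp: less_imp_neq[symmetric]\<close>)
  then have yc2c: "continuous_on UNIV yc2" .
  have "continuous_on UNIV (\<lambda>s. (yc2 s)\<^sup>2 - 4 * (yc1 s)\<^sup>2)"
    by (intro continuous_intros yc2c \<open>continuous_on UNIV yc1\<close>)
  from continuous_antiderivative[OF this]
  obtain D where D: "\<And>s. (D has_real_derivative (yc2 s)\<^sup>2 - 4 * (yc1 s)\<^sup>2) (at s)" by blast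
  define E where "E s = W' s + W' (s + pi/2) - R ^ 4 * (pi / 128 * D s + U s / 16)" for s
  have "(E has_real_derivative 0) (at s)" for s
  proof -
    have "((\<lambda>s. W' (s + pi/2)) has_real_derivative W (s + pi/2)) (at s)"
      using W'[of "s + pi/2"] by (simp add: DERIV_shift)
    then have "(E has_real_derivative W s + W (s + pi/2) - R ^ 4 * (pi / 128 * ((yc2 s)\<^sup>2 - 4 * (yc1 s)\<^sup>2) + U1 s / 16)) (at s)"
      unfolding E_def[abs_def] by (auto intro!: derivative_eq_intros W' D U_deriv)
    then show ?thesis by (simp add: W_sum)
  qed
  then have E: "E (2 * pi) = E 0" by (rule DERIV_isconst_all[rule_format])
  have per: "w (s + 2 * pi) = w s" "w1 (s + 2 * pi) = w1 s" for s
  proof -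
    have e: "s + pi/2 + pi/2 + pi/2 + pi/2 = s + 2 * pi" by simp
    show "w (s + 2 * pi) = w s" "w1 (s + 2 * pi) = w1 s"
      using w_half[of s] w_half[of "s + pi/2"] w_half[of "s + pi/2 + pi/2"] w_half[of "s + pi/2 + pi/2 + pi/2"]
       w1_half[of s] w1_half[of "s + pi/2"] w1_half[of "s + pi/2 + pi/2"] w1_half[of "s + pi/2 + pi/2 + pi/2"]
      unfolding e by simp_all
  qed
  have U: "U (2 * pi) = U 0" using per[of 0] by (simp add: U_def yc_def)
  have Wper: "W' (s + 2 * pi) - W' s = W' (2 * pi) - W' 0" for s
  proof -
    have "((\<lambda>s. W' (s + 2 * pi) - W' s) has_real_derivative 0) (at s)" for s
    proof -
      have "W (s + 2 * pi) = W s" by (simp add: W_def per h_periodic h1_periodic r_periodic)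
      moreover have "((\<lambda>s. W' (s + 2 * pi)) has_real_derivative W (s + 2 * pi)) (at s)"
        using W'[of "s + 2 * pi"] by (simp add: DERIV_shift)
      ultimately show ?thesis using DERIV_diff[OF _ W'[of s]] by fastforce
    qed
    then have "(\<lambda>s. W' (s + 2 * pi) - W' s) s = (\<lambda>s. W' (s + 2 * pi) - W' s) 0" by (rule DERIV_isconst_all[rule_format])
    then show ?thesis by simp
  qed
  \<comment> \<open>The quarter shift does not change an integral over a full period, so the
    integral of \<open>W\<close> is counted twice.\<close>
  have "R ^ 4 * (pi / 128 * (D (2 * pi) - D 0)) = 2 * (W' (2 * pi) - W' 0)"
    using E Wper[of "pi/2"] unfolding E_def U by (simp add: algebra_simps diff_divide_distrib)
  then have "R ^ 4 * (pi / 128 * (D (2 * pi) - D 0)) \<le> 0" using le by simp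
  moreover have "R ^ 4 * (pi / 128) > 0" using R_pos by simp
  ultimately have "D (2 * pi) - D 0 \<le> 0" by (metis mult.assoc mult_pos_pos not_less)
  \<comment> \<open>Applied to the derivative of \<open>yc\<close>; the additive constant left open
    by this vanishes because \<open>yc\<close> changes sign under the quarter shift.\<close>
  from wirtinger_rigidity[OF yc1_deriv yc_half(2,3) D this]
  obtain c s0 where c: "\<And>s. yc1 s = c * sin (2 * (s - s0))" by blast
  define e where "e = c / 2"
  have "((\<lambda>s. yc s + e * cos (2 * (s - s0))) has_real_derivative 0) (at s)" for s
    by (auto intro!: derivative_eq_intros yc_deriv simp: c e_def)
  then have k: "yc s + e * cos (2 * (s - s0)) = yc t + e * cos (2 * (t - s0))" for s t
    by (rule DERIV_isconst_all[rule_format, where f = "\<lambda>s. yc s + e * cos (2 * (s - s0))"])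
  have "yc s + e * cos (2 * (s - s0)) = 0" for s
  proof -
    have "2 * (s + pi/2 - s0) = 2 * (s - s0) + pi" by simp
    then have "cos (2 * (s + pi/2 - s0)) = - cos (2 * (s - s0))" by (simp only: cos_periodic_pi)
    then show ?thesis using k[of s "s + pi/2"] yc_half(1)[of s] by simp
  qed
  then have y: "yc s = - e * cos (2 * (s - s0))" for s by (simp add: eq_neg_iff_add_eq_0)
  have hh: "(h s)\<^sup>2 = R\<^sup>2 * (1 + e) / 2 * (cos (s - s0))\<^sup>2 + R\<^sup>2 * (1 - e) / 2 * (sin (s - s0))\<^sup>2" for s
  proof -
    have "(h s)\<^sup>2 = R\<^sup>2 * (1 - yc s) / 2"
      unfolding h_R_w(1)[of s] yc_def by (simp add: power_mult_distrib cos_squared_eq)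
    also have "1 - yc s = 1 + e * ((cos (s - s0))\<^sup>2 - (sin (s - s0))\<^sup>2)"
      unfolding y cos_double by simp
    also have "\<dots> = (1 + e) * (cos (s - s0))\<^sup>2 + (1 - e) * (sin (s - s0))\<^sup>2"
      using sin_cos_squared_add[of "s - s0"] by (simp add: algebra_simps)
    finally show ?thesis by (simp add: field_simps)
  qed
  \<comment> \<open>The coefficients are the values of \<open>h\<^sup>2\<close> in the directions of
    the two axes.\<close>
  have "0 < R\<^sup>2 * (1 + e) / 2"
  proof -
    have "(h s0)\<^sup>2 = R\<^sup>2 * (1 + e) / 2" using hh[of s0] by simp
    then show ?thesis using zero_less_power[OF h_pos[of s0], of 2] by (simp only:)
  qed
  moreover have "0 < R\<^sup>2 * (1 - e) / 2"
  proof -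
    have "(h (s0 + pi/2))\<^sup>2 = R\<^sup>2 * (1 - e) / 2" using hh[of "s0 + pi/2"] by simp
    then show ?thesis using zero_less_power[OF h_pos[of "s0 + pi/2"], of 2] by (simp only:)
  qed
  ultimately show ?thesis using hh
    by (intro exI[of _ "sqrt (R\<^sup>2 * (1 + e) / 2)"] conjI exI[of _ "sqrt (R\<^sup>2 * (1 - e) / 2)"] exI[of _ s0]) auto
qed

text \<open>The common end of both cases. The vector \<open>u x\<close> is arbitrary at each
  \<open>x\<close>, as only the uniform bound of \<open>hopf_bound\<close> is passed on.\<close>

lemma ellipse_of_jacobi_field:
  assumes "\<And>x. x \<in> low \<Longrightarrow> 0 \<le> fst (u x)" "\<And>x n. x \<in> low \<Longrightarrow> n > 0 \<Longrightarrow> fst (dTn n x (u x)) > 0"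
  shows "\<exists>a>0. \<exists>b>0. \<exists>s0. \<forall>s. (h s)\<^sup>2 = a\<^sup>2 * (cos (s - s0))\<^sup>2 + b\<^sup>2 * (sin (s - s0))\<^sup>2"
proof -
  obtain C where C: "\<And>x u N. x \<in> lines \<Longrightarrow> fst u \<ge> 0 \<Longrightarrow> (\<forall>n>0. fst (dTn n x u) > 0) \<Longrightarrow> (\<Sum>n=1..N. Qf ((T ^^ n) x)) \<le> C"
    using hopf_bound by blast
  have "(\<Sum>n=1..N. Qf ((T ^^ n) x)) \<le> C" if "x \<in> low" for x N
    using C[OF low_lines[OF that], of "u x"] assms that by blast
  moreover obtain W' where W': "\<And>s. (W' has_real_derivative W s) (at s)" using continuous_antiderivative[OF W_cont] by blast
  ultimately have "W' (2 * pi) - W' 0 \<le> 0" by (rule integral_nonpos)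
  from ellipse_support[OF W' this] show ?thesis .
qed

theorem conjugate_points:
  assumes "\<not> (\<exists>a>0. \<exists>b>0. \<exists>s0. \<forall>s. (h s)\<^sup>2 = a\<^sup>2 * (cos (s - s0))\<^sup>2 + b\<^sup>2 * (sin (s - s0))\<^sup>2)"
  shows "\<exists>x\<in>low. \<exists>n>0. fst (dTn n x (0, - 1)) = 0"
    and "\<exists>x\<in>low. \<exists>n>0. dev ((T ^^ n) x) (dTn n x (pencil x)) = 0"
proof -
  show "\<exists>x\<in>low. \<exists>n>0. fst (dTn n x (0, - 1)) = 0"
  proof (rule ccontr)
    assume "\<not> ?thesis"
    then have nc: "\<And>x n. x \<in> low \<Longrightarrow> n > 0 \<Longrightarrow> fst (dTn n x (0, - 1)) \<noteq> 0" by blast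
    show False
      using ellipse_of_jacobi_field[of "\<lambda>x. (0, - 1)"] parallel_beam_positive[OF nc] assms by simp
  qed
  show "\<exists>x\<in>low. \<exists>n>0. dev ((T ^^ n) x) (dTn n x (pencil x)) = 0"
  proof (rule ccontr)
    assume "\<not> ?thesis"
    then have nc: "\<And>x n. x \<in> low \<Longrightarrow> n > 0 \<Longrightarrow> dev ((T ^^ n) x) (dTn n x (pencil x)) \<noteq> 0" by blast
    have down: "enter s d' \<in> low" if "enter s d \<in> low" "0 < d'" "d' \<le> d" "d < pi" for s d d'
      using that enter_low_iff[of d s] enter_low_iff[of d' s] by auto
    show False
      using ellipse_of_jacobi_field[of pencil] pencil_positive[OF down nc] assms by (simp add: pencil_def)
  qed
qed

end

section \<open>The support function of a convex table\<close>

lemma cis_eq_1_imp: "cis x = 1 \<Longrightarrow> \<exists>n::int. x = 2 * pi * of_int n"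
proof -
  assume "cis x = 1"
  then have "cos x = 1" by (metis cis.simps(1) one_complex.simps(1))
  then obtain n :: int where "x = of_int n * 2 * pi" using cos_one_2pi_int by blast
  then show ?thesis by (intro exI[of _ n]) simp
qed

lemma cis_eq_imp: "cis x = cis y \<Longrightarrow> \<exists>n::int. x = y + 2 * pi * of_int n"
proof -
  assume "cis x = cis y"
  then have "cis (x - y) = 1" by (simp add: cis_divide[symmetric])
  from cis_eq_1_imp[OF this] show ?thesis by (auto simp: algebra_simps)
qed

lemma cis_2pi_int [simp]: "cis (x + 2 * pi * of_int n) = cis x"
  by (simp add: cis_mult[symmetric] cis_multiple_2pi Ints_of_int)

lemma cis_has_vector_derivative:
  assumes "(f has_real_derivative f') (at s)"
  shows "((\<lambda>s. cis (f s)) has_vector_derivative f' *\<^sub>R (\<i> * cis (f s))) (at s)"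
  using has_derivative_cis[of f "(*) f'" s UNIV] assms
  unfolding has_vector_derivative_def has_field_derivative_def by (simp add: mult.commute)

section \<open>The tangent angle of the curve\<close>

locale convex_table =
  fixes \<gamma> :: "real \<Rightarrow> complex" and L :: real
  assumes curve: "simple_closed_C2_curve \<gamma> L"
    and conv: "convex (table \<gamma>)"
    and curv: "\<And>s. curvature \<gamma> s > 0"
begin

lemma L_pos: "L > 0" and \<gamma>_periodic: "\<gamma> (s + L) = \<gamma> s" and \<gamma>_inj: "inj_on \<gamma> {0..<L}"
  using curve by (auto simp: simple_closed_C2_curve_def)

lemma \<gamma>_deriv: "(\<gamma> has_vector_derivative velocity \<gamma> s) (at s)"
  using curve by (simp add: simple_closed_C2_curve_def vector_derivative_works)

lemma vel_deriv: "(velocity \<gamma> has_vector_derivative acceleration \<gamma> s) (at s)"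
  using curve by (simp add: simple_closed_C2_curve_def vector_derivative_works)

lemma norm_vel: "norm (velocity \<gamma> s) = 1"
  using curve by (simp add: simple_closed_C2_curve_def)

lemma acc_cont: "continuous_on UNIV (acceleration \<gamma>)"
  using curve by (simp add: simple_closed_C2_curve_def)

lemma \<gamma>_cont: "continuous_on S \<gamma>"
  using \<gamma>_deriv by (meson continuous_at_imp_continuous_on has_vector_derivative_continuous)

lemma vel_cont: "continuous_on S (velocity \<gamma>)"
  using vel_deriv by (meson continuous_at_imp_continuous_on has_vector_derivative_continuous)

lemma curvature_cont: "continuous_on S (curvature \<gamma>)"
  unfolding curvature_def by (intro continuous_intros vel_cont continuous_on_subset[OF acc_cont]) auto

lemma acceleration_eq: "acceleration \<gamma> s = of_real (curvature \<gamma> s) * \<i> * velocity \<gamma> s"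
proof -
  let ?v = "velocity \<gamma> s" and ?a = "acceleration \<gamma> s"
  have "((\<lambda>s. velocity \<gamma> s \<bullet> velocity \<gamma> s) has_vector_derivative (?v \<bullet> ?a + ?a \<bullet> ?v)) (at s)"
    by (rule bounded_bilinear.has_vector_derivative[OF bounded_bilinear_inner vel_deriv vel_deriv])
  moreover have "velocity \<gamma> s \<bullet> velocity \<gamma> s = 1" for s
    using norm_vel[of s] by (simp add: dot_square_norm)
  ultimately have "((\<lambda>s. 1) has_vector_derivative (?v \<bullet> ?a + ?a \<bullet> ?v)) (at s)" by simp
  from vector_derivative_unique_at[OF this has_vector_derivative_const]
  have "?v \<bullet> ?a + ?a \<bullet> ?v = 0" .
  then have "Re (cnj ?v * ?a) = 0" by (simp add: inner_complex_def algebra_simps)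
  then have "cnj ?v * ?a = of_real (curvature \<gamma> s) * \<i>"
    by (simp add: complex_eq_iff curvature_def)
  then have "?v * cnj ?v * ?a = of_real (curvature \<gamma> s) * \<i> * ?v" by (simp add: mult_ac)
  moreover have "?v * cnj ?v = 1" using norm_vel[of s] by (simp add: complex_norm_square[symmetric])
  ultimately show ?thesis by simp
qed

text \<open>For \<open>\<Psi>\<close> an antiderivative of the curvature, the velocity turned back
  by \<open>\<Psi>\<close> has derivative 0. The \<open>pi / 2\<close> makes \<open>\<Psi>\<close>
  the angle of the normal instead of the tangent.\<close>

lemma tangent_angle_exists:
  "\<exists>\<Psi>. (\<forall>s. (\<Psi> has_real_derivative curvature \<gamma> s) (at s)) \<and> (\<forall>s. velocity \<gamma> s = \<i> * cis (\<Psi> s))"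
proof -
  obtain F where F: "\<And>x. (F has_real_derivative curvature \<gamma> x) (at x)"
    using continuous_antiderivative[OF curvature_cont] by blast
  define \<Psi> where "\<Psi> s = F s - F 0 + Arg (velocity \<gamma> 0) - pi / 2" for s
  have P: "(\<Psi> has_real_derivative curvature \<gamma> s) (at s)" for s
    unfolding \<Psi>_def[abs_def] by (auto intro!: derivative_eq_intros F)
  have D: "((\<lambda>s. velocity \<gamma> s * cis (- \<Psi> s)) has_vector_derivative 0) (at s)" for s
  proof -
    have c: "((\<lambda>s. cis (- \<Psi> s)) has_vector_derivative (- curvature \<gamma> s) *\<^sub>R (\<i> * cis (- \<Psi> s))) (at s)"
      by (rule cis_has_vector_derivative) (rule DERIV_minus[OF P])
    have "((\<lambda>s. velocity \<gamma> s * cis (- \<Psi> s)) has_vector_derivative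
       velocity \<gamma> s * ((- curvature \<gamma> s) *\<^sub>R (\<i> * cis (- \<Psi> s))) + acceleration \<gamma> s * cis (- \<Psi> s)) (at s)"
      by (rule has_vector_derivative_mult[OF vel_deriv c])
    then show ?thesis by (simp add: acceleration_eq scaleR_conv_of_real)
  qed
  have const: "velocity \<gamma> s * cis (- \<Psi> s) = \<i>" for s
  proof -
    have "velocity \<gamma> s * cis (- \<Psi> s) = velocity \<gamma> 0 * cis (- \<Psi> 0)"
      using has_vector_derivative_zero_constant[of UNIV "\<lambda>s. velocity \<gamma> s * cis (- \<Psi> s)"] D
      by (metis UNIV_I convex_UNIV)
    also have "velocity \<gamma> 0 = cis (Arg (velocity \<gamma> 0))"
      using norm_vel[of 0] rcis_cmod_Arg[of "velocity \<gamma> 0"] by (simp add: rcis_def)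
    also have "\<dots> * cis (- \<Psi> 0) = \<i>" by (simp add: cis_mult \<Psi>_def)
    finally show ?thesis .
  qed
  have "velocity \<gamma> s = \<i> * cis (\<Psi> s)" for s
  proof -
    have "velocity \<gamma> s = velocity \<gamma> s * (cis (- \<Psi> s) * cis (\<Psi> s))" by (simp add: cis_mult)
    also have "\<dots> = \<i> * cis (\<Psi> s)" by (simp only: mult.assoc[symmetric] const)
    finally show ?thesis .
  qed
  then show ?thesis using P by blast
qed

definition \<Psi> :: "real \<Rightarrow> real" where
  "\<Psi> = (SOME \<Psi>. (\<forall>s. (\<Psi> has_real_derivative curvature \<gamma> s) (at s)) \<and> (\<forall>s. velocity \<gamma> s = \<i> * cis (\<Psi> s)))"

lemma \<Psi>_deriv: "(\<Psi> has_real_derivative curvature \<gamma> s) (at s)" and vel_\<Psi>: "velocity \<gamma> s = \<i> * cis (\<Psi> s)"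
  using someI_ex[OF tangent_angle_exists] unfolding \<Psi>_def by blast+

lemma \<Psi>_less: "s < t \<Longrightarrow> \<Psi> s < \<Psi> t"
  by (rule DERIV_pos_imp_increasing) (use \<Psi>_deriv curv in blast)+

lemma \<Psi>_less_iff: "\<Psi> s < \<Psi> t \<longleftrightarrow> s < t"
  using \<Psi>_less by (metis less_asym linorder_neqE)

lemma \<Psi>_inj: "\<Psi> s = \<Psi> t \<Longrightarrow> s = t"
  using \<Psi>_less by (metis less_irrefl linorder_neqE)

lemma shift_deriv: "((\<lambda>s. s + L) has_vector_derivative 1) (at s)"
  unfolding has_real_derivative_iff_has_vector_derivative[symmetric] by (auto intro!: derivative_eq_intros)

lemma vel_periodic: "velocity \<gamma> (s + L) = velocity \<gamma> s"
proof -
  have "((\<lambda>s. \<gamma> (s + L)) has_vector_derivative velocity \<gamma> (s + L)) (at s)"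
    using vector_diff_chain_at[OF shift_deriv \<gamma>_deriv[of "s + L"]] by (simp add: o_def)
  then show ?thesis using \<gamma>_deriv[of s] by (simp add: \<gamma>_periodic vector_derivative_unique_at)
qed

lemma acc_periodic: "acceleration \<gamma> (s + L) = acceleration \<gamma> s"
proof -
  have "((\<lambda>s. velocity \<gamma> (s + L)) has_vector_derivative acceleration \<gamma> (s + L)) (at s)"
    using vector_diff_chain_at[OF shift_deriv vel_deriv[of "s + L"]] by (simp add: o_def)
  then show ?thesis using vel_deriv[of s] by (simp add: vel_periodic vector_derivative_unique_at)
qed

lemma curvature_periodic: "curvature \<gamma> (s + L) = curvature \<gamma> s"
  by (simp add: curvature_def vel_periodic acc_periodic)

text \<open>So far only some positive number of turns; that it is one is shown in
  \<open>\<Psi>_turn\<close> with the help of supporting lines.\<close>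

lemma turning_exists: "\<exists>m::nat. m > 0 \<and> (\<forall>s. \<Psi> (s + L) = \<Psi> s + 2 * pi * real m)"
proof -
  have "((\<lambda>s. \<Psi> (s + L) - \<Psi> s) has_real_derivative 0) (at s)" for s
  proof -
    have "((\<lambda>s. \<Psi> (s + L)) has_real_derivative curvature \<gamma> (s + L)) (at s)"
      using \<Psi>_deriv[of "s + L"] by (simp add: DERIV_shift)
    from DERIV_diff[OF this \<Psi>_deriv[of s]] show ?thesis by (simp add: curvature_periodic)
  qed
  then have c: "\<Psi> (s + L) - \<Psi> s = \<Psi> (0 + L) - \<Psi> 0" for s
    by (rule DERIV_isconst_all[rule_format, where f = "\<lambda>s. \<Psi> (s + L) - \<Psi> s"])
  have "cis (\<Psi> (0 + L)) = cis (\<Psi> 0)" using vel_periodic[of 0] by (simp add: vel_\<Psi>)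
  then obtain n :: int where n: "\<Psi> (0 + L) = \<Psi> 0 + 2 * pi * of_int n" using cis_eq_imp by blast
  have "\<Psi> 0 < \<Psi> (0 + L)" using \<Psi>_less L_pos by simp
  then have "n > 0" using n by (simp add: zero_less_mult_iff)
  then show ?thesis using c n by (intro exI[of _ "nat n"]) (auto simp: algebra_simps)
qed

lemma \<gamma>_int: "\<gamma> (s + of_int n * L) = \<gamma> s"
  by (rule periodic_int) (rule \<gamma>_periodic)

lemmas reduce_parameter = reduce_mod_period[OF L_pos]

lemma \<gamma>_eq_imp: assumes "\<gamma> s = \<gamma> t" shows "\<exists>n::int. s = t + of_int n * L"
proof -
  obtain m n :: int where m: "0 \<le> s + of_int m * L" "s + of_int m * L < 0 + L"
    and n: "0 \<le> t + of_int n * L" "t + of_int n * L < 0 + L"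
    using reduce_parameter[of 0 s] reduce_parameter[of 0 t] by (elim exE conjE)
  have "\<gamma> (s + of_int m * L) = \<gamma> (t + of_int n * L)" using assms by (simp add: \<gamma>_int)
  then have "s + of_int m * L = t + of_int n * L" using m n \<gamma>_inj by (auto dest: inj_onD)
  then show ?thesis by (intro exI[of _ "n - m"]) (simp add: algebra_simps)
qed

section \<open>The table as a Jordan domain and its supporting lines\<close>

definition loop :: "real \<Rightarrow> complex" where "loop t = \<gamma> (L * t)"

lemma loop_simple: "simple_path loop" "pathfinish loop = pathstart loop" "path_image loop = range \<gamma>"
proof -
  show "pathfinish loop = pathstart loop"
    using \<gamma>_periodic[of 0] by (simp add: loop_def pathfinish_def pathstart_def)
  have "path loop" unfolding path_def loop_def[abs_def]
    by (intro continuous_on_compose2[OF \<gamma>_cont[of UNIV]] continuous_intros) auto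
  moreover have "x = y \<or> x = 0 \<and> y = 1 \<or> x = 1 \<and> y = 0"
    if "x \<in> {0..1}" "y \<in> {0..1}" "loop x = loop y" for x y
  proof -
    obtain n :: int where n: "L * x = L * y + of_int n * L" using \<gamma>_eq_imp[of "L * x" "L * y"] \<open>loop x = loop y\<close> unfolding loop_def by auto
    then have "L * x = L * (y + of_int n)" by (simp add: algebra_simps)
    then have "x = y + of_int n" using L_pos by simp
    moreover have "n = 0 \<or> n = 1 \<or> n = -1"
    proof -
      have "of_int n \<le> (1::real)" "- 1 \<le> (of_int n::real)" using that \<open>x = y + of_int n\<close> by auto
      then have "n \<le> 1" "-1 \<le> n" by linarith+
      then show ?thesis by linarith
    qed
    ultimately show ?thesis using that by auto
  qed
  ultimately show "simple_path loop" unfolding simple_path_def loop_free_def by blast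
  show "path_image loop = range \<gamma>"
  proof
    show "range \<gamma> \<subseteq> path_image loop"
    proof
      fix z assume "z \<in> range \<gamma>"
      then obtain s where s: "z = \<gamma> s" by blast
      obtain n :: int where n: "0 \<le> s + of_int n * L" "s + of_int n * L < 0 + L" using reduce_parameter[of 0 s] by blast
      have "z = loop ((s + of_int n * L) / L)" using L_pos by (simp add: loop_def s \<gamma>_int)
      moreover have "(s + of_int n * L) / L \<in> {0..1}" using n L_pos by (simp add: divide_simps)
      ultimately show "z \<in> path_image loop" unfolding path_image_def by blast
    qed
  qed (auto simp: path_image_def loop_def)
qed

lemma table_nonempty: "table \<gamma> \<noteq> {}" and table_open: "open (table \<gamma>)" and frontier_table: "frontier (table \<gamma>) = range \<gamma>"
  using Jordan_inside_outside[OF loop_simple(1,2)] unfolding loop_simple(3) by auto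

lemma range_closure: "\<gamma> s \<in> closure (table \<gamma>)" and range_not_table: "\<gamma> s \<notin> table \<gamma>"
proof -
  have "\<gamma> s \<in> frontier (table \<gamma>)" by (simp add: frontier_table)
  then show "\<gamma> s \<in> closure (table \<gamma>)" "\<gamma> s \<notin> table \<gamma>"
    using interior_open[OF table_open] by (auto simp: frontier_def)
qed

lemma closure_table: "closure (table \<gamma>) = table \<gamma> \<union> range \<gamma>"
  using closure_Un_frontier[of "table \<gamma>"] frontier_table by auto

definition \<sigma> :: "real \<Rightarrow> real" where "\<sigma> = inv \<Psi>"

lemma \<Psi>_cont: "continuous_on S \<Psi>"
  by (rule DERIV_continuous_on) (rule has_field_derivative_at_within[OF \<Psi>_deriv])

lemma \<Psi>_surj: "\<exists>s. \<Psi> s = x"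
proof -
  obtain m :: nat where m: "m > 0" "\<And>s. \<Psi> (s + L) = \<Psi> s + 2 * pi * real m" using turning_exists by blast
  have up: "\<Psi> (s + real n * L) = \<Psi> s + 2 * pi * real m * real n" for s n
  proof (induction n)
    case (Suc n)
    have "s + real (Suc n) * L = (s + real n * L) + L" by (simp add: algebra_simps)
    then show ?case using Suc m(2)[of "s + real n * L"] by (simp add: algebra_simps)
  qed simp
  obtain n :: nat where n: "\<bar>x - \<Psi> 0\<bar> \<le> real n" using real_arch_simple[of "\<bar>x - \<Psi> 0\<bar>"] by blast
  have "1 \<le> 2 * pi * real m"
  proof -
    have "1 * 1 \<le> (2 * pi) * real m" using pi_gt3 m by (intro mult_mono) auto
    then show ?thesis by simp
  qed
  then have big: "real n \<le> 2 * pi * real m * real n" using mult_right_mono[of 1 "2 * pi * real m" "real n"] by simp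
  have "\<Psi> (0 - real n * L) = \<Psi> 0 - 2 * pi * real m * real n" using up[of "0 - real n * L" n] by simp
  then have lo: "\<Psi> (0 - real n * L) \<le> x" using n big by linarith
  have hi: "x \<le> \<Psi> (0 + real n * L)" unfolding up using n big by linarith
  have "\<exists>t\<ge>0 - real n * L. t \<le> 0 + real n * L \<and> \<Psi> t = x"
    by (rule IVT'[of \<Psi>, OF lo hi]) (use L_pos \<Psi>_cont in auto)
  then show ?thesis by blast
qed

lemma \<Psi>_\<sigma> [simp]: "\<Psi> (\<sigma> x) = x" unfolding \<sigma>_def by (rule surj_f_inv_f) (unfold surj_def, metis \<Psi>_surj)

lemma \<sigma>_\<Psi> [simp]: "\<sigma> (\<Psi> s) = s" by (rule \<Psi>_inj) simp

lemma \<sigma>_less: "x < y \<Longrightarrow> \<sigma> x < \<sigma> y" using \<Psi>_less_iff[of "\<sigma> x" "\<sigma> y"] by simp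

text \<open>The outer normal at \<open>\<gamma> s\<close> is \<open>cis (\<Psi> s)\<close>: positivity of the curvature excludes the inner one.\<close>

lemma support:
  shows "z \<in> closure (table \<gamma>) \<Longrightarrow> (z - \<gamma> s) \<bullet> cis (\<Psi> s) \<le> 0"
    and "z \<in> table \<gamma> \<Longrightarrow> (z - \<gamma> s) \<bullet> cis (\<Psi> s) < 0"
proof -
  have ri: "rel_interior (table \<gamma>) = table \<gamma>" using table_open by (rule rel_interior_open)
  obtain a where a: "a \<noteq> 0" "\<And>y. y \<in> closure (table \<gamma>) \<Longrightarrow> a \<bullet> \<gamma> s \<le> a \<bullet> y"
    "\<And>y. y \<in> table \<gamma> \<Longrightarrow> a \<bullet> \<gamma> s < a \<bullet> y"
    using supporting_hyperplane_relative_frontier[OF conv range_closure, of s] range_not_table[of s] unfolding ri by blast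
  have D: "((\<lambda>t. a \<bullet> \<gamma> t) has_real_derivative a \<bullet> velocity \<gamma> t) (at t)" for t
    using bounded_linear.has_vector_derivative[OF bounded_linear_inner_right \<gamma>_deriv]
    by (simp add: has_real_derivative_iff_has_vector_derivative)
  \<comment> \<open>The supporting functional has a minimum along the curve at \<open>s\<close>, so
    \<open>a\<close> is a multiple of the normal there; its sign remains to be found.\<close>
  have "a \<bullet> velocity \<gamma> s = 0"
  proof (rule DERIV_local_min[OF D])
    show "\<forall>y. \<bar>s - y\<bar> < 1 \<longrightarrow> a \<bullet> \<gamma> s \<le> a \<bullet> \<gamma> y" using a(2) range_closure by blast
  qed simp
  then have z: "- Re a * sin (\<Psi> s) + Im a * cos (\<Psi> s) = 0" by (simp add: vel_\<Psi> inner_complex_def)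
  define l where "l = a \<bullet> cis (\<Psi> s)"
  have al: "a = l *\<^sub>R cis (\<Psi> s)"
  proof -
    have 1: "Im a * cos (\<Psi> s) = Re a * sin (\<Psi> s)" using z by simp
    have l: "l = Re a * cos (\<Psi> s) + Im a * sin (\<Psi> s)" by (simp add: l_def inner_complex_def)
    have "l * cos (\<Psi> s) = Re a * (cos (\<Psi> s) * cos (\<Psi> s)) + sin (\<Psi> s) * (Im a * cos (\<Psi> s))" by (simp only: l algebra_simps)
    also have "\<dots> = Re a * (cos (\<Psi> s) * cos (\<Psi> s) + sin (\<Psi> s) * sin (\<Psi> s))" unfolding 1 by (simp only: algebra_simps)
    finally have 2: "l * cos (\<Psi> s) = Re a" unfolding sin_cos_squared_add3 by simp
    have "l * sin (\<Psi> s) = cos (\<Psi> s) * (Re a * sin (\<Psi> s)) + Im a * (sin (\<Psi> s) * sin (\<Psi> s))" by (simp add: l algebra_simps)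
    also have "\<dots> = Im a * (cos (\<Psi> s) * cos (\<Psi> s) + sin (\<Psi> s) * sin (\<Psi> s))" unfolding 1[symmetric] by (simp only: algebra_simps)
    finally have 3: "l * sin (\<Psi> s) = Im a" unfolding sin_cos_squared_add3 by simp
    show ?thesis using 2 3 by (simp add: complex_eq_iff)
  qed
  have lneg: "l < 0"
  proof (rule ccontr)
    assume "\<not> l < 0"
    moreover have "l \<noteq> 0" using a(1) al by auto
    ultimately have l: "l > 0" by simp
    \<comment> \<open>Any turn by less than \<open>pi\<close> would do: up to there the curve turns
      left, so \<open>a \<bullet> \<gamma>\<close> would fall below its minimum.\<close>
    define t where "t = \<sigma> (\<Psi> s + 1)"
    have st: "s < t" using \<sigma>_less[of "\<Psi> s" "\<Psi> s + 1"] by (simp add: t_def)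
    have "a \<bullet> \<gamma> t < a \<bullet> \<gamma> s"
    proof (rule DERIV_neg_imp_decreasing_open[OF st])
      fix u assume u: "s < u" "u < t"
      have "\<Psi> s < \<Psi> u" "\<Psi> u < \<Psi> s + 1" using \<Psi>_less[OF u(1)] \<Psi>_less[OF u(2)] by (auto simp: t_def)
      then have "sin (\<Psi> u - \<Psi> s) > 0" using pi_gt3 by (intro sin_gt_zero) auto
      moreover have "a \<bullet> velocity \<gamma> u = - (l * sin (\<Psi> u - \<Psi> s))"
        by (simp add: al vel_\<Psi> inner_complex_def sin_diff algebra_simps)
      ultimately show "\<exists>y. ((\<lambda>t. a \<bullet> \<gamma> t) has_real_derivative y) (at u) \<and> y < 0"
        using D[of u] l by (intro exI[of _ "a \<bullet> velocity \<gamma> u"]) simp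
    qed (intro continuous_intros \<gamma>_cont)
    then show False using a(2)[OF range_closure[of t]] by simp
  qed
  have eq: "a \<bullet> y - a \<bullet> \<gamma> s = l * ((y - \<gamma> s) \<bullet> cis (\<Psi> s))" for y
    unfolding al by (simp add: inner_diff_left inner_commute algebra_simps)
  show "(z - \<gamma> s) \<bullet> cis (\<Psi> s) \<le> 0" if "z \<in> closure (table \<gamma>)"
    using a(2)[OF that] eq[of z] lneg by (smt (verit) mult_neg_pos)
  show "(z - \<gamma> s) \<bullet> cis (\<Psi> s) < 0" if "z \<in> table \<gamma>"
    using a(3)[OF that] eq[of z] lneg by (smt (verit) mult_nonpos_nonneg)
qed

lemma unit_orthogonal:
  assumes "z \<noteq> 0" "z \<bullet> cis a = 0" "z \<bullet> cis b = 0" shows "cis b = cis a \<or> cis b = - cis a"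
proof -
  have 1: "Re z * cos a = - (Im z * sin a)" "Re z * cos b = - (Im z * sin b)"
    using assms by (auto simp: inner_complex_def)
  have "Re z * sin (a - b) = 0"
  proof -
    have "Re z * sin (a - b) = sin a * (Re z * cos b) - sin b * (Re z * cos a)" by (simp add: sin_diff algebra_simps)
    then show ?thesis unfolding 1 by (simp add: algebra_simps)
  qed
  moreover have "Im z * sin (a - b) = 0"
  proof -
    have "Im z * sin (a - b) = (Im z * sin a) * cos b - cos a * (Im z * sin b)" by (simp add: sin_diff algebra_simps)
    also have "\<dots> = - (Re z * cos a) * cos b + cos a * (Re z * cos b)" unfolding 1 by simp
    finally show ?thesis by simp
  qed
  ultimately have s: "sin (a - b) = 0" using assms(1) by (auto simp: complex_eq_iff)
  then have "cos (a - b) = 1 \<or> cos (a - b) = - 1" using sin_zero_abs_cos_one[of "a - b"] by linarith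
  then have "cis (a - b) = 1 \<or> cis (a - b) = - 1" using s by (auto simp: complex_eq_iff)
  then show ?thesis
  proof
    assume "cis (a - b) = 1"
    then have "cis a = cis b" by (simp add: cis_divide[symmetric])
    then show ?thesis by simp
  next
    assume "cis (a - b) = - 1"
    then have "cis a = - cis b" by (simp add: cis_divide[symmetric] divide_eq_minus_1_iff)
    then show ?thesis by simp
  qed
qed

text \<open>If the tangent turned more than once, two different points would share an outer normal, and the
  segment between them would lie on the curve, with the same normal at each of its points.\<close>

lemma \<Psi>_turn: "\<Psi> (s + L) = \<Psi> s + 2 * pi"
proof -
  obtain m :: nat where m: "m > 0" "\<And>s. \<Psi> (s + L) = \<Psi> s + 2 * pi * real m" using turning_exists by blast
  have "m = 1"
  proof (rule ccontr)
    assume "m \<noteq> 1"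
    then have m2: "real m \<ge> 2" using m(1) by linarith
    define s' where "s' = \<sigma> (\<Psi> s + 2 * pi)"
    define n where "n = cis (\<Psi> s)"
    have ss: "s < s'" using \<sigma>_less[of "\<Psi> s" "\<Psi> s + 2 * pi"] by (simp add: s'_def)
    have "\<Psi> s + 2 * pi < \<Psi> s + 2 * pi * real m" using m2 pi_gt3 by simp
    then have ss': "s' < s + L" using \<Psi>_less_iff[of s' "s + L"] m(2) by (simp add: s'_def)
    have ne: "\<gamma> s \<noteq> \<gamma> s'"
    proof
      assume "\<gamma> s = \<gamma> s'"
      then obtain j :: int where j: "s' = s + of_int j * L" using \<gamma>_eq_imp[of s' s] by auto
      then have "0 < of_int j * L" "of_int j * L < 1 * L" using ss ss' by auto
      then have "0 < (of_int j::real)" "(of_int j::real) < 1" using L_pos by (auto simp: zero_less_mult_iff)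
      then show False by simp
    qed
    have n': "cis (\<Psi> s') = n" using cis_2pi_int[of "\<Psi> s" 1] by (simp add: s'_def n_def)
    have "(\<gamma> s' - \<gamma> s) \<bullet> n \<le> 0" "(\<gamma> s - \<gamma> s') \<bullet> n \<le> 0"
      using support(1)[OF range_closure[of s'], of s] support(1)[OF range_closure[of s], of s'] by (auto simp: n' n_def)
    then have z: "(\<gamma> s' - \<gamma> s) \<bullet> n = 0" by (simp add: inner_diff_left)
    define Q where "Q u = (1 - u) *\<^sub>R \<gamma> s + u *\<^sub>R \<gamma> s'" for u :: real
    have Qe: "Q u - \<gamma> s = u *\<^sub>R (\<gamma> s' - \<gamma> s)" "Q u - \<gamma> s' = (u - 1) *\<^sub>R (\<gamma> s' - \<gamma> s)" for u
      by (simp_all add: Q_def algebra_simps)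
    have Qt: "\<exists>j<m. Q u = \<gamma> (\<sigma> (\<Psi> s + 2 * pi * real j))" if u: "0 < u" "u < 1" for u
    proof -
      have cl: "Q u \<in> closure (table \<gamma>)" unfolding Q_def
        by (rule convexD[OF convex_closure[OF conv] range_closure range_closure]) (use u in auto)
      have "(Q u - \<gamma> s) \<bullet> n = 0" by (simp add: Qe z)
      then have "Q u \<notin> table \<gamma>" using support(2)[of "Q u" s] by (auto simp: n_def)
      then obtain t0 where "Q u = \<gamma> t0" using cl closure_table by auto
      then obtain t where t: "Q u = \<gamma> t" "s \<le> t" "t < s + L" using reduce_parameter[of s t0] \<gamma>_int by metis
      have "(\<gamma> s - \<gamma> t) \<bullet> cis (\<Psi> t) \<le> 0" "(\<gamma> s' - \<gamma> t) \<bullet> cis (\<Psi> t) \<le> 0"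
        by (rule support(1)[OF range_closure])+
      moreover have "\<gamma> s - \<gamma> t = (- u) *\<^sub>R (\<gamma> s' - \<gamma> s)" "\<gamma> s' - \<gamma> t = (1 - u) *\<^sub>R (\<gamma> s' - \<gamma> s)"
        using Qe[of u] t(1) by (simp_all add: algebra_simps)
      ultimately have "- u * ((\<gamma> s' - \<gamma> s) \<bullet> cis (\<Psi> t)) \<le> 0" "(1 - u) * ((\<gamma> s' - \<gamma> s) \<bullet> cis (\<Psi> t)) \<le> 0"
        by simp_all
      then have "(\<gamma> s' - \<gamma> s) \<bullet> cis (\<Psi> t) = 0"
        using u by (auto simp: mult_le_0_iff zero_le_mult_iff)
      then have "cis (\<Psi> t) = n \<or> cis (\<Psi> t) = - n"
        using unit_orthogonal[of "\<gamma> s' - \<gamma> s" "\<Psi> s" "\<Psi> t"] ne z by (auto simp: n_def)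
      moreover have "cis (\<Psi> t) \<noteq> - n"
      proof
        assume a: "cis (\<Psi> t) = - n"
        obtain y where y: "y \<in> table \<gamma>" using table_nonempty by blast
        have "(y - \<gamma> s) \<bullet> n < 0" using support(2)[OF y, of s] by (simp add: n_def)
        moreover have "(y - \<gamma> t) \<bullet> (- n) < 0" using support(2)[OF y, of t] a by simp
        moreover have "(\<gamma> t - \<gamma> s) \<bullet> n = 0" using \<open>(Q u - \<gamma> s) \<bullet> n = 0\<close> t(1) by simp
        ultimately show False by (simp add: inner_diff_left)
      qed
      ultimately have "cis (\<Psi> t) = cis (\<Psi> s)" by (simp add: n_def)
      then obtain j :: int where j: "\<Psi> t = \<Psi> s + 2 * pi * of_int j" using cis_eq_imp by blast
      have "\<Psi> s \<le> \<Psi> t" using t(2) \<Psi>_less_iff[of t s] by linarith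
      then have j0: "0 \<le> j" using j pi_gt_zero by (simp add: zero_le_mult_iff)
      have "\<Psi> t < \<Psi> s + 2 * pi * real m" using \<Psi>_less[OF t(3)] m(2) by simp
      then have jm: "of_int j < real m" using j pi_gt_zero by simp
      have "\<gamma> t = \<gamma> (\<sigma> (\<Psi> s + 2 * pi * real (nat j)))" using j j0 \<sigma>_\<Psi>[of t] by simp
      then show ?thesis using jm j0 t(1) by (intro exI[of _ "nat j"]) auto
    qed
    \<comment> \<open>Only \<open>m\<close> parameters in a period have this normal, whereas the
      segment is infinite.\<close>
    have "Q ` {0<..<1} \<subseteq> (\<lambda>j. \<gamma> (\<sigma> (\<Psi> s + 2 * pi * real j))) ` {..<m}"
    proof
      fix z assume "z \<in> Q ` {0<..<1}"
      then obtain u where u: "0 < u" "u < 1" "z = Q u" by auto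
      from Qt[OF u(1,2)] obtain j where "j < m" "Q u = \<gamma> (\<sigma> (\<Psi> s + 2 * pi * real j))" by blast
      then show "z \<in> (\<lambda>j. \<gamma> (\<sigma> (\<Psi> s + 2 * pi * real j))) ` {..<m}" using u(3) by blast
    qed
    then have "finite (Q ` {0<..<1})" by (rule finite_subset) simp
    moreover have "inj_on Q {0<..<1}"
    proof (rule inj_onI)
      fix u v assume "Q u = Q v"
      then have "u *\<^sub>R (\<gamma> s' - \<gamma> s) = v *\<^sub>R (\<gamma> s' - \<gamma> s)" by (simp only: Qe(1)[symmetric])
      then have "(u - v) *\<^sub>R (\<gamma> s' - \<gamma> s) = 0" by (simp only: scaleR_left_diff_distrib right_minus_eq)
      then show "u = v" using not_sym[OF ne] by simp
    qed
    ultimately have "finite {0<..<1::real}" by (rule finite_imageD)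
    then show False using infinite_Ioo[of 0 "1::real"] by simp
  qed
  then show ?thesis using m(2)[of s] by simp
qed

lemma \<sigma>_turn: "\<sigma> (x + 2 * pi) = \<sigma> x + L"
  by (rule \<Psi>_inj) (simp add: \<Psi>_turn)

lemma \<sigma>_isCont: "isCont \<sigma> x"
proof (rule isCont_inverse_function2[of "\<sigma> x - 1" "\<sigma> x" "\<sigma> x + 1" \<sigma> \<Psi>, simplified])
  show "isCont \<Psi> z" for z using \<Psi>_deriv DERIV_isCont by blast
qed

lemma \<sigma>_deriv: "(\<sigma> has_real_derivative 1 / curvature \<gamma> (\<sigma> x)) (at x)"
proof -
  have "(\<sigma> has_real_derivative inverse (curvature \<gamma> (\<sigma> x))) (at x)"
    by (rule DERIV_inverse_function[where f = \<Psi> and a = "x - 1" and b = "x + 1"])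
      (use \<Psi>_deriv curv[of "\<sigma> x"] \<sigma>_isCont in auto)
  then show ?thesis by (simp add: inverse_eq_divide)
qed

end

locale symmetric_table = convex_table +
  fixes c :: complex
  assumes symm: "(\<lambda>z. 2 * c - z) ` range \<gamma> = range \<gamma>"
begin

definition G :: "real \<Rightarrow> complex" where "G t = \<gamma> (\<sigma> t) - c"
definition sh :: "real \<Rightarrow> real" where "sh t = G t \<bullet> cis t"
definition sh1 :: "real \<Rightarrow> real" where "sh1 t = G t \<bullet> (\<i> * cis t)"
definition sr :: "real \<Rightarrow> real" where "sr t = 1 / curvature \<gamma> (\<sigma> t)"

lemma G_deriv: "(G has_vector_derivative sr t *\<^sub>R (\<i> * cis t)) (at t)"
proof -
  have "(\<sigma> has_vector_derivative sr t) (at t)"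
    using \<sigma>_deriv by (simp add: sr_def has_real_derivative_iff_has_vector_derivative)
  from vector_diff_chain_at[OF this \<gamma>_deriv]
  have "((\<lambda>t. \<gamma> (\<sigma> t)) has_vector_derivative sr t *\<^sub>R (\<i> * cis t)) (at t)"
    by (simp add: o_def vel_\<Psi>)
  from has_vector_derivative_diff[OF this has_vector_derivative_const[of c]]
  show ?thesis by (simp add: G_def[abs_def])
qed

lemma G_2pi: "G (t + 2 * pi) = G t"
  by (simp add: G_def \<sigma>_turn \<gamma>_periodic)

lemma G_h: "G t = (Complex (sh t) (sh1 t)) * cis t"
proof -
  have "Complex (sh t) (sh1 t) = G t * cis (- t)"
    by (simp add: complex_eq_iff sh_def sh1_def inner_complex_def)
  then show ?thesis by (simp add: mult.assoc cis_mult)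
qed

lemma oval_table: "oval sh sh1 sr"
proof
  fix t
  have c1: "((\<lambda>t. cis t) has_vector_derivative \<i> * cis t) (at t)"
    using cis_has_vector_derivative[of "\<lambda>t. t" 1 t] by simp
  have c2: "((\<lambda>t. \<i> * cis t) has_vector_derivative - cis t) (at t)"
    using has_vector_derivative_mult_right[OF c1, of \<i>] by (simp add: mult.assoc[symmetric])
  show "(sh has_real_derivative sh1 t) (at t)"
    using bounded_bilinear.has_vector_derivative[OF bounded_bilinear_inner G_deriv c1]
    by (simp add: sh_def[abs_def] sh1_def has_real_derivative_iff_has_vector_derivative inner_complex_def)
  have "(\<i> * cis t) \<bullet> (\<i> * cis t) = 1"
    using sin_cos_squared_add3[of t] by (simp add: inner_complex_def add.commute)
  then show "(sh1 has_real_derivative sr t - sh t) (at t)"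
    using bounded_bilinear.has_vector_derivative[OF bounded_bilinear_inner G_deriv c2]
    by (simp add: sh_def sh1_def[abs_def] has_real_derivative_iff_has_vector_derivative)
  show "continuous_on UNIV sr"
    unfolding sr_def[abs_def] using curv
    by (intro continuous_intros continuous_on_compose2[OF curvature_cont[of UNIV]])
      (auto intro!: continuous_at_imp_continuous_on \<sigma>_isCont simp: less_imp_neq[symmetric])
  show "0 < sr t" using curv by (simp add: sr_def)
  show "sh (t + 2 * pi) = sh t" using cis_2pi_int[of t 1] by (simp add: sh_def G_2pi)
qed

lemma support_G: "(\<gamma> s - c) \<bullet> cis t \<le> sh t"
  using support(1)[OF range_closure[of s], of "\<sigma> t"] by (simp add: sh_def G_def inner_diff_left)

text \<open>The reflection in \<open>c\<close> maps the point with normal angle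
  \<open>t + pi\<close> to a point of the curve whose height along \<open>cis t\<close> is
  \<open>sh (t + pi)\<close>. Applied again at \<open>t + pi\<close> it gives equality.\<close>

lemma sh_le: "sh (t + pi) \<le> sh t"
proof -
  have "2 * c - \<gamma> (\<sigma> (t + pi)) \<in> range \<gamma>" using symm by blast
  then obtain s where s: "2 * c - \<gamma> (\<sigma> (t + pi)) = \<gamma> s" by auto
  have "\<gamma> s - c = - G (t + pi)" unfolding s[symmetric] by (simp add: G_def algebra_simps)
  then have "(\<gamma> s - c) \<bullet> cis t = G (t + pi) \<bullet> cis (t + pi)" by (simp add: inner_complex_def)
  then show ?thesis using support_G[of s t] by (simp add: sh_def)
qed

end

sublocale symmetric_table \<subseteq> symmetric_oval sh sh1 sr
proof -
  interpret oval sh sh1 sr by (rule oval_table)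
  show "symmetric_oval sh sh1 sr"
  proof
    fix t
    have e: "t + pi + pi = t + 2 * pi" by simp
    have "sh t \<le> sh (t + pi)" using sh_le[of "t + pi"] unfolding e h_periodic .
    then show "sh (t + pi) = sh t" using sh_le[of t] by simp
  qed
qed

section \<open>The phase cylinder\<close>

context symmetric_table begin

text \<open>The lifted coordinates measure \<open>p\<close> from the centre \<open>c\<close>, those of the cylinder from the origin.\<close>

definition proj :: "real \<times> real \<Rightarrow> oriented_line" where
  "proj x = (cis (fst x), snd x + c \<bullet> cis (fst x))"

section \<open>Lines, their end points and reflections in the plane\<close>

lemma k_inner: "k t f = G t \<bullet> cis f"
  by (subst G_h) (simp add: k_def inner_complex_def cos_diff sin_diff algebra_simps)

lemma q_inner: "q t f = G t \<bullet> (\<i> * cis f)"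
  by (subst G_h) (simp add: q_def inner_complex_def cos_diff sin_diff algebra_simps)

lemma \<gamma>_\<sigma>: "\<gamma> (\<sigma> t) = c + G t" by (simp add: G_def)
lemma \<gamma>_G: "\<gamma> s = c + G (\<Psi> s)" by (simp add: G_def)

lemma G_int: "G (t + 2 * pi * of_int n) = G t"
  using periodic_int[of G "2 * pi", OF G_2pi] by (simp add: mult.commute)

lemma lv_less_ev: assumes "x \<in> lines" shows "lv x < ev x + 2 * pi" "ev x < lv x"
  using lv_lines[OF assms] ev_lines[OF assms] by auto

lemma reduce_angle: "\<exists>n::int. a \<le> t + 2 * pi * of_int n \<and> t + 2 * pi * of_int n < a + 2 * pi"
  using reduce_mod_period[of "2 * pi" a t] by (simp add: mult.commute)

lemma k_le_h: "k t f \<le> sh f" and k_eq_h_imp: "k t f = sh f \<Longrightarrow> \<exists>n::int. t = f + 2 * pi * of_int n"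
proof -
  obtain n :: int where n: "f - pi \<le> t + 2 * pi * of_int n" "t + 2 * pi * of_int n < f - pi + 2 * pi"
    using reduce_angle by blast
  define u where "u = t + 2 * pi * of_int n"
  have e: "k t f = k u f" by (simp add: k_inner u_def G_int)
  have l: "k u f < sh f" if "u \<noteq> f" using k_less_h[of f u] n that by (simp add: u_def)
  then show "k t f \<le> sh f" using e by (cases "u = f") auto
  show "\<exists>n::int. t = f + 2 * pi * of_int n" if "k t f = sh f"
  proof -
    have "u = f" using l e that by fastforce
    then show ?thesis by (intro exI[of _ "- n"]) (simp add: u_def)
  qed
qed

text \<open>For a point outside, a separating functional \<open>a\<close> is bounded below on the
  table; the boundary point whose outer normal is the direction of \<open>- a\<close> then
  contradicts the strict inequality for that normal.\<close>

lemma table_eq: "table \<gamma> = {z. \<forall>t. (z - c) \<bullet> cis t < sh t}"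
proof (intro set_eqI iffI CollectI allI)
  fix z t assume "z \<in> table \<gamma>"
  then show "(z - c) \<bullet> cis t < sh t"
    using support(2)[of z "\<sigma> t"] by (simp add: sh_def G_def inner_diff_left)
next
  fix z assume z: "z \<in> {z. \<forall>t. (z - c) \<bullet> cis t < sh t}"
  show "z \<in> table \<gamma>"
  proof (rule ccontr)
    assume "z \<notin> table \<gamma>"
    then obtain a b where a: "a \<noteq> 0" "a \<bullet> z \<le> b" "\<And>x. x \<in> table \<gamma> \<Longrightarrow> b \<le> a \<bullet> x"
      using separating_hyperplane_sets[of "{z}" "table \<gamma>"] conv table_nonempty by auto
    have cl: "closure (table \<gamma>) \<subseteq> {x. b \<le> a \<bullet> x}"
      by (rule closure_minimal) (use a closed_halfspace_ge[of b a] in \<open>auto simp: inner_commute\<close>)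
    define t where "t = Arg (- a)"
    have at: "- a = norm a *\<^sub>R cis t"
      using rcis_cmod_Arg[of "- a"] by (simp add: t_def rcis_def scaleR_conv_of_real)
    have "b \<le> a \<bullet> \<gamma> (\<sigma> t)" using cl range_closure by blast
    then have "(- a) \<bullet> (c + G t) \<le> (- a) \<bullet> z" using a(2) by (simp add: \<gamma>_\<sigma>)
    then have "norm a * (cis t \<bullet> (c + G t)) \<le> norm a * (cis t \<bullet> z)" unfolding at by simp
    then have "cis t \<bullet> (c + G t) \<le> cis t \<bullet> z" using a(1) by simp
    then have "sh t \<le> (z - c) \<bullet> cis t"
      by (simp add: sh_def inner_commute[of _ "cis t"] inner_add_right inner_diff_right)
    then show False using z by (auto simp: not_less[symmetric])
  qed
qed

lemma points_proj: "z \<in> points (proj x) \<longleftrightarrow> (z - c) \<bullet> cis (fst x) = snd x"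
  by (auto simp: points_def proj_def inner_diff_left)

lemma direction_proj: "direction (proj x) = \<i> * cis (fst x)"
  by (simp add: direction_def proj_def)

lemma frame: "z = (z \<bullet> cis f) *\<^sub>R cis f + (z \<bullet> (\<i> * cis f)) *\<^sub>R (\<i> * cis f)"
proof -
  have "Complex (z \<bullet> cis f) (z \<bullet> (\<i> * cis f)) = z * cis (- f)"
    by (simp add: complex_eq_iff inner_complex_def algebra_simps)
  then have "Complex (z \<bullet> cis f) (z \<bullet> (\<i> * cis f)) * cis f = z" by (simp add: mult.assoc cis_mult)
  then show ?thesis by (simp add: complex_eq_iff)
qed

lemma chord_vector:
  assumes x: "x \<in> lines"
  shows "G (lv x) - G (ev x) = (q (lv x) (fst x) - q (ev x) (fst x)) *\<^sub>R (\<i> * cis (fst x))"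
proof -
  have "(G (lv x) - G (ev x)) \<bullet> cis (fst x) = 0"
    using ev_props(3)[OF lines_clines[OF x]] lv_props(3)[OF lines_clines[OF x]]
    by (simp add: inner_diff_left k_inner[symmetric])
  moreover have "(G (lv x) - G (ev x)) \<bullet> (\<i> * cis (fst x)) = q (lv x) (fst x) - q (ev x) (fst x)"
    by (simp add: inner_diff_left q_inner[symmetric])
  ultimately show ?thesis using frame[of "G (lv x) - G (ev x)" "fst x"] by simp
qed

text \<open>A supporting line touches only at the point with its normal angle modulo
  \<open>2 * pi\<close>, and the two ends are less than a turn apart; so no supporting line contains
  both.\<close>

lemma chord_in_table:
  assumes x: "x \<in> lines" and u: "0 < u" "u < 1"
  shows "c + G (ev x) + u *\<^sub>R (G (lv x) - G (ev x)) \<in> table \<gamma>"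
  unfolding table_eq
proof (intro CollectI allI)
  fix t
  have e: "(c + G (ev x) + u *\<^sub>R (G (lv x) - G (ev x)) - c) \<bullet> cis t = (1 - u) * k (ev x) t + u * k (lv x) t"
    by (simp add: k_inner inner_add_left inner_diff_left algebra_simps)
  have "k (ev x) t < sh t \<or> k (lv x) t < sh t"
  proof (rule ccontr)
    assume "\<not> ?thesis"
    then have "k (ev x) t = sh t" "k (lv x) t = sh t" using k_le_h[of "ev x" t] k_le_h[of "lv x" t] by auto
    then obtain m n :: int where mn: "ev x = t + 2 * pi * of_int m" "lv x = t + 2 * pi * of_int n"
      using k_eq_h_imp by meson
    then have "2 * pi * of_int m < 2 * pi * (of_int n :: real)" "2 * pi * (of_int n :: real) < 2 * pi * (of_int m + 1)"
      using lv_less_ev[OF x] by (auto simp: algebra_simps)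
    then have "(of_int m :: real) < of_int n" "(of_int n :: real) < of_int (m + 1)" by simp_all
    then have "m < n" "n < m + 1" unfolding of_int_less_iff by blast+
    then show False by simp
  qed
  then have "(1 - u) * k (ev x) t + u * k (lv x) t < (1 - u) * sh t + u * sh t"
  proof
    assume "k (ev x) t < sh t"
    then show ?thesis using u k_le_h[of "lv x" t] by (intro add_less_le_mono mult_strict_left_mono mult_left_mono) auto
  next
    assume "k (lv x) t < sh t"
    then show ?thesis using u k_le_h[of "ev x" t] by (intro add_le_less_mono mult_strict_left_mono mult_left_mono) auto
  qed
  then show "(c + G (ev x) + u *\<^sub>R (G (lv x) - G (ev x)) - c) \<bullet> cis t < sh t" unfolding e by (simp add: algebra_simps)
qed

lemma on_line_cases:
  assumes x: "x \<in> lines" and k: "k t (fst x) = snd x"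
  shows "G t = G (ev x) \<or> G t = G (lv x)"
proof -
  obtain n :: int where n: "fst x - pi \<le> t + 2 * pi * of_int n" "t + 2 * pi * of_int n < fst x - pi + 2 * pi"
    using reduce_angle by blast
  define u where "u = t + 2 * pi * of_int n"
  have ku: "k u (fst x) = snd x" and Gu: "G t = G u" using k by (simp_all add: k_inner u_def G_int)
  have "u = ev x \<or> u = lv x"
  proof (cases "u \<le> fst x")
    case True
    then have "ev (fst x, snd x) = u" using n ku by (intro ev_eqI) (auto simp: u_def)
    then show ?thesis by simp
  next
    case False
    then have "lv (fst x, snd x) = u" using n ku by (intro lv_eqI) (auto simp: u_def)
    then show ?thesis by simp
  qed
  then show ?thesis using Gu by auto
qed

lemma beyond_exit: assumes x: "x \<in> lines" and t: "t > 0"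
  shows "c + G (lv x) + of_real t * (\<i> * cis (fst x)) \<notin> table \<gamma>"
    "c + G (ev x) - of_real t * (\<i> * cis (fst x)) \<notin> table \<gamma>"
proof -
  have "(c + G (lv x) + of_real t * (\<i> * cis (fst x)) - c) \<bullet> cis (lv x) = sh (lv x) + t * sin (lv x - fst x)"
    by (simp add: sh_def inner_complex_def sin_diff algebra_simps)
  moreover have "t * sin (lv x - fst x) > 0" using t sin_lv_pos[OF x] by simp
  ultimately show "c + G (lv x) + of_real t * (\<i> * cis (fst x)) \<notin> table \<gamma>"
    unfolding table_eq by (auto intro!: exI[of _ "lv x"])
  have "(c + G (ev x) - of_real t * (\<i> * cis (fst x)) - c) \<bullet> cis (ev x) = sh (ev x) + t * sin (fst x - ev x)"
    by (simp add: sh_def inner_complex_def sin_diff algebra_simps)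
  moreover have "sin (fst x - ev x) > 0" using ev_lines[OF x] by (intro sin_gt_zero) auto
  then have "t * sin (fst x - ev x) > 0" using t by simp
  ultimately show "c + G (ev x) - of_real t * (\<i> * cis (fst x)) \<notin> table \<gamma>"
    unfolding table_eq by (auto intro!: exI[of _ "ev x"])
qed

lemma chord_param:
  assumes x: "x \<in> lines" and t: "0 < t" "t < q (lv x) (fst x) - q (ev x) (fst x)"
  shows "c + G (ev x) + of_real t * (\<i> * cis (fst x)) \<in> table \<gamma>"
    "c + G (lv x) - of_real t * (\<i> * cis (fst x)) \<in> table \<gamma>"
proof -
  define l where "l = q (lv x) (fst x) - q (ev x) (fst x)"
  have l: "l > 0" "t < l" using chord_pos[OF x] t by (simp_all add: l_def)
  have v: "G (lv x) - G (ev x) = l *\<^sub>R (\<i> * cis (fst x))" using chord_vector[OF x] by (simp add: l_def)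
  have "c + G (ev x) + (t / l) *\<^sub>R (G (lv x) - G (ev x)) \<in> table \<gamma>"
    by (rule chord_in_table[OF x]) (use l t in auto)
  then show "c + G (ev x) + of_real t * (\<i> * cis (fst x)) \<in> table \<gamma>"
    unfolding v using l by (simp add: scaleR_conv_of_real)
  have "c + G (ev x) + (1 - t / l) *\<^sub>R (G (lv x) - G (ev x)) \<in> table \<gamma>"
    by (rule chord_in_table[OF x]) (use l t in auto)
  moreover have "c + G (ev x) + (1 - t / l) *\<^sub>R (G (lv x) - G (ev x)) = c + G (lv x) - (t / l) *\<^sub>R (G (lv x) - G (ev x))"
    by (simp add: algebra_simps)
  ultimately have "c + G (lv x) - (t / l) *\<^sub>R (G (lv x) - G (ev x)) \<in> table \<gamma>" by simp
  then show "c + G (lv x) - of_real t * (\<i> * cis (fst x)) \<in> table \<gamma>"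
    unfolding v using l by (simp add: scaleR_conv_of_real)
qed

lemma point_of_ends: assumes x: "x \<in> lines"
  shows "c + G (ev x) \<in> points (proj x) \<inter> range \<gamma>" "c + G (lv x) \<in> points (proj x) \<inter> range \<gamma>"
proof -
  have "c + G (ev x) \<in> range \<gamma>" "c + G (lv x) \<in> range \<gamma>"
    using \<gamma>_\<sigma> rangeI[of \<gamma>] by metis+
  then show "c + G (ev x) \<in> points (proj x) \<inter> range \<gamma>" "c + G (lv x) \<in> points (proj x) \<inter> range \<gamma>"
    using ev_props(3)[OF lines_clines[OF x]] lv_props(3)[OF lines_clines[OF x]]
    by (simp_all add: points_proj k_inner[symmetric])
qed

lemma point_cases:
  assumes x: "x \<in> lines" and z: "z \<in> points (proj x) \<inter> range \<gamma>"
  shows "z = c + G (ev x) \<or> z = c + G (lv x)"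
proof -
  from z obtain s where s: "z = c + G (\<Psi> s)" using \<gamma>_G by auto
  then have "k (\<Psi> s) (fst x) = snd x" using z by (simp add: points_proj k_inner)
  from on_line_cases[OF x this] show ?thesis using s by auto
qed

lemma enters_iff: assumes x: "x \<in> lines" shows "enters_at \<gamma> (proj x) z \<longleftrightarrow> z = c + G (ev x)"
proof
  assume e: "enters_at \<gamma> (proj x) z"
  then have "\<forall>\<^sub>F t in at_right 0. z + of_real t * (\<i> * cis (fst x)) \<in> table \<gamma>"
    by (simp add: enters_at_def direction_proj)
  then have "\<forall>\<^sub>F t in at_right 0. t > 0 \<and> z + of_real t * (\<i> * cis (fst x)) \<in> table \<gamma>"
    using eventually_at_right_less[of "0::real"] by eventually_elim auto
  then obtain t where "t > 0" "z + of_real t * (\<i> * cis (fst x)) \<in> table \<gamma>"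
    using eventually_happens'[OF trivial_limit_at_right_real] by blast
  then have "z \<noteq> c + G (lv x)" using beyond_exit(1)[OF x] by blast
  then show "z = c + G (ev x)" using point_cases[OF x] e by (auto simp: enters_at_def)
next
  assume z: "z = c + G (ev x)"
  have "\<forall>\<^sub>F t in at_right 0. z + of_real t * direction (proj x) \<in> table \<gamma>"
    unfolding direction_proj z
    by (rule eventually_at_rightI[of 0 "q (lv x) (fst x) - q (ev x) (fst x)"]) (use chord_param(1)[OF x] chord_pos[OF x] in auto)
  then show "enters_at \<gamma> (proj x) z" using point_of_ends(1)[OF x] z by (simp add: enters_at_def)
qed

lemma leaves_iff: assumes x: "x \<in> lines" shows "leaves_at \<gamma> (proj x) z \<longleftrightarrow> z = c + G (lv x)"
proof
  assume e: "leaves_at \<gamma> (proj x) z"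
  then have "\<forall>\<^sub>F t in at_right 0. z - of_real t * (\<i> * cis (fst x)) \<in> table \<gamma>"
    by (simp add: leaves_at_def direction_proj)
  then have "\<forall>\<^sub>F t in at_right 0. t > 0 \<and> z - of_real t * (\<i> * cis (fst x)) \<in> table \<gamma>"
    using eventually_at_right_less[of "0::real"] by eventually_elim auto
  then obtain t where "t > 0" "z - of_real t * (\<i> * cis (fst x)) \<in> table \<gamma>"
    using eventually_happens'[OF trivial_limit_at_right_real] by blast
  then have "z \<noteq> c + G (ev x)" using beyond_exit(2)[OF x] by blast
  then show "z = c + G (lv x)" using point_cases[OF x] e by (auto simp: leaves_at_def)
next
  assume z: "z = c + G (lv x)"
  have "\<forall>\<^sub>F t in at_right 0. z - of_real t * direction (proj x) \<in> table \<gamma>"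
    unfolding direction_proj z
    by (rule eventually_at_rightI[of 0 "q (lv x) (fst x) - q (ev x) (fst x)"]) (use chord_param(2)[OF x] chord_pos[OF x] in auto)
  then show "leaves_at \<gamma> (proj x) z" using point_of_ends(2)[OF x] z by (simp add: leaves_at_def)
qed

lemma proj_lines: "x \<in> lines \<Longrightarrow> proj x \<in> phase_cylinder \<gamma>"
proof -
  assume x: "x \<in> lines"
  let ?z = "c + G (ev x) + (1/2) *\<^sub>R (G (lv x) - G (ev x))"
  have "?z \<in> table \<gamma>" by (rule chord_in_table[OF x]) auto
  moreover have "?z \<in> points (proj x)"
    using ev_props(3)[OF lines_clines[OF x]] lv_props(3)[OF lines_clines[OF x]]
    by (simp add: points_proj k_inner inner_add_left inner_diff_left)
  ultimately show "proj x \<in> phase_cylinder \<gamma>" by (auto simp: phase_cylinder_def proj_def)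
qed

lemma proj_cylinder_iff: "proj x \<in> phase_cylinder \<gamma> \<longleftrightarrow> x \<in> lines"
proof
  assume "proj x \<in> phase_cylinder \<gamma>"
  then obtain z where z: "z \<in> points (proj x)" "z \<in> table \<gamma>" by (auto simp: phase_cylinder_def)
  then have "(z - c) \<bullet> cis (fst x) < sh (fst x)" "(z - c) \<bullet> cis (fst x + pi) < sh (fst x + pi)"
    unfolding table_eq by blast+
  moreover have "(z - c) \<bullet> cis (fst x) = snd x" using z(1) by (simp add: points_proj)
  moreover have "(z - c) \<bullet> cis (fst x + pi) = - snd x" using z(1) by (simp add: points_proj inner_complex_def)
  ultimately show "x \<in> lines" by (simp add: lines_def h_pi abs_less_iff)
qed (rule proj_lines)

lemma proj_eq_imp:
  assumes "proj x = proj y" shows "\<exists>n::int. x = y + (2 * pi * of_int n, 0)"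
proof -
  have "cis (fst x) = cis (fst y)" "snd x = snd y" using assms by (auto simp: proj_def)
  then show ?thesis using cis_eq_imp[of "fst x" "fst y"] by (auto simp: prod_eq_iff)
qed

lemma proj_shift: "proj (x + (2 * pi * of_int n, 0)) = proj x"
  by (simp add: proj_def)

lemma \<gamma>_eq_G_vel: assumes "\<gamma> s = c + G t" shows "velocity \<gamma> s = \<i> * cis t"
proof -
  obtain n :: int where n: "s = \<sigma> t + of_int n * L" using \<gamma>_eq_imp[of s "\<sigma> t"] assms \<gamma>_\<sigma> by auto
  have "velocity \<gamma> (\<sigma> t + of_int n * L) = velocity \<gamma> (\<sigma> t)"
    by (rule periodic_int) (rule vel_periodic)
  then show ?thesis by (simp add: n vel_\<Psi>)
qed

lemma billiard_proj: assumes x: "x \<in> lines" shows "billiard_map \<gamma> (proj x) = proj (T x)"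
proof -
  define t where "t = lv x"
  \<comment> \<open>The exit point has many parameters \<open>s\<close>, differing by periods; that
    all give the same line makes the definite description meaningful.\<close>
  have refl: "line_through (\<gamma> s) ((velocity \<gamma> s)\<^sup>2 * cnj (direction (proj x))) = proj (T x)"
    if s: "\<gamma> s = c + G t" for s
  proof -
    have "(velocity \<gamma> s)\<^sup>2 * cnj (direction (proj x)) = \<i> * cis (2 * t - fst x)"
    proof -
      have "(\<i> * cis t)\<^sup>2 = - cis (2 * t)" by (simp add: power_mult_distrib Complex.DeMoivre)
      moreover have "cnj (\<i> * cis (fst x)) = - \<i> * cis (- fst x)" by (simp add: cis_cnj)
      ultimately have "(\<i> * cis t)\<^sup>2 * cnj (\<i> * cis (fst x)) = \<i> * (cis (2 * t) * cis (- fst x))" by simp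
      then show ?thesis unfolding \<gamma>_eq_G_vel[OF s] direction_proj by (simp add: cis_mult)
    qed
    then show ?thesis unfolding line_through_def s
      by (simp add: proj_def T_def t_def[symmetric] k_inner inner_add_left mult.assoc[symmetric])
  qed
  show ?thesis unfolding billiard_map_def
  proof (rule the_equality)
    show "\<exists>s. leaves_at \<gamma> (proj x) (\<gamma> s) \<and> proj (T x) = line_through (\<gamma> s) ((velocity \<gamma> s)\<^sup>2 * cnj (direction (proj x)))"
      using refl[of "\<sigma> t"] by (intro exI[of _ "\<sigma> t"]) (simp add: leaves_iff[OF x] \<gamma>_\<sigma> t_def)
    show "l' = proj (T x)"
      if "\<exists>s. leaves_at \<gamma> (proj x) (\<gamma> s) \<and> l' = line_through (\<gamma> s) ((velocity \<gamma> s)\<^sup>2 * cnj (direction (proj x)))" for l'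
      using that refl by (auto simp: leaves_iff[OF x] t_def)
  qed
qed

lemma billiard_proj_n: "x \<in> lines \<Longrightarrow> (billiard_map \<gamma> ^^ n) (proj x) = proj ((T ^^ n) x)"
  by (induction n) (auto simp: billiard_proj Tn_lines)

lemma arc_step_proj: assumes x: "x \<in> lines" shows "arc_step \<gamma> L (proj x) = \<sigma> (lv x) - \<sigma> (ev x)"
proof -
  have 0: "0 < \<sigma> (lv x) - \<sigma> (ev x)" using \<sigma>_less[OF lv_less_ev(2)[OF x]] by simp
  have 1: "\<sigma> (lv x) - \<sigma> (ev x) < L" using \<sigma>_less[OF lv_less_ev(1)[OF x]] \<sigma>_turn[of "ev x"] by simp
  show ?thesis unfolding arc_step_def
  proof (rule the_equality)
    show "0 < \<sigma> (lv x) - \<sigma> (ev x) \<and> \<sigma> (lv x) - \<sigma> (ev x) < L \<and>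
       (\<exists>s. enters_at \<gamma> (proj x) (\<gamma> s) \<and> leaves_at \<gamma> (proj x) (\<gamma> (s + (\<sigma> (lv x) - \<sigma> (ev x)))))"
      using 0 1 by (auto intro!: exI[of _ "\<sigma> (ev x)"] simp: enters_iff[OF x] leaves_iff[OF x] \<gamma>_\<sigma>)
    fix d assume d: "0 < d \<and> d < L \<and> (\<exists>s. enters_at \<gamma> (proj x) (\<gamma> s) \<and> leaves_at \<gamma> (proj x) (\<gamma> (s + d)))"
    then obtain s where s: "\<gamma> s = \<gamma> (\<sigma> (ev x))" "\<gamma> (s + d) = \<gamma> (\<sigma> (lv x))"
      by (auto simp: enters_iff[OF x] leaves_iff[OF x] \<gamma>_\<sigma>)
    obtain m :: int where m: "s = \<sigma> (ev x) + of_int m * L" using \<gamma>_eq_imp[OF s(1)] by blast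
    obtain n :: int where n: "s + d = \<sigma> (lv x) + of_int n * L" using \<gamma>_eq_imp[OF s(2)] by blast
    have e: "d - (\<sigma> (lv x) - \<sigma> (ev x)) = of_int (n - m) * L" using m n by (simp add: algebra_simps)
    have "of_int (n - m) * L < 1 * L" "(-1) * L < of_int (n - m) * L"
      using d 0 1 unfolding e[symmetric] by auto
    then have "real_of_int (n - m) < 1" "- 1 < real_of_int (n - m)" using L_pos mult_less_cancel_right_pos by blast+
    then have "n - m = 0" by linarith
    then show "d = \<sigma> (lv x) - \<sigma> (ev x)" using e by simp
  qed
qed

lemma entry_parameter_cong:
  assumes "x \<in> lines" "y \<in> lines" "ev x = ev y"
  shows "entry_parameter \<gamma> L (proj x) = entry_parameter \<gamma> L (proj y)"
  using assms by (simp add: entry_parameter_def enters_iff)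

end

lemma continuous_periodic_extension:
  fixes f :: "real \<Rightarrow> 'a::real_normed_vector"
  assumes f: "continuous_on {0..1} f" and v: "f 1 = f 0 + v"
  shows "continuous_on UNIV (\<lambda>t. f (frac t) + of_int \<lfloor>t\<rfloor> *\<^sub>R v)"
proof -
  let ?F = "\<lambda>t. f (frac t) + of_int \<lfloor>t\<rfloor> *\<^sub>R v"
  have piece: "continuous_on {of_int n..of_int n + 1} ?F" for n :: int
  proof -
    have "continuous_on {of_int n..of_int n + 1} (\<lambda>t. f (t - of_int n) + of_int n *\<^sub>R v)"
      by (intro continuous_intros continuous_on_compose2[OF f]) auto
    moreover have "?F t = f (t - of_int n) + of_int n *\<^sub>R v" if "t \<in> {of_int n..of_int n + 1}" for t
    proof (cases "t = of_int n + 1")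
      case True
      then have t: "t = of_int (n + 1)" by simp
      then have fl: "\<lfloor>t\<rfloor> = n + 1" by (simp only: floor_of_int)
      then have "frac t = 0" unfolding frac_def using t by (simp only: diff_self)
      moreover have "t - of_int n = 1" using True by simp
      ultimately show ?thesis using v unfolding fl by (simp add: algebra_simps)
    next
      case False
      then have fl: "\<lfloor>t\<rfloor> = n" using that by (intro floor_unique) auto
      then have "frac t = t - of_int n" unfolding frac_def by (simp only:)
      then show ?thesis unfolding fl by (simp only:)
    qed
    ultimately show ?thesis by (subst continuous_on_cong[OF refl])
  qed
  have "isCont ?F t" for t
  proof -
    define n where "n = \<lfloor>t\<rfloor>"
    have t: "of_int (n - 1) < t" "t < of_int n + 1" unfolding n_def by linarith+
    have e: "{of_int (n - 1)..of_int (n - 1) + 1} = {of_int (n - 1)..of_int n :: real}" by simp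
    have "continuous_on ({of_int (n - 1)..of_int n} \<union> {of_int n..of_int n + 1}) ?F"
      using piece[of "n - 1"] piece[of n] unfolding e by (intro continuous_on_closed_Un) auto
    moreover have "{of_int (n - 1)..of_int n} \<union> {of_int n..of_int n + 1} = {of_int (n - 1)..of_int n + 1 :: real}" by auto
    ultimately have "continuous_on {of_int (n - 1)..of_int n + 1} ?F" by simp
    then show ?thesis by (rule continuous_on_interior) (use t in auto)
  qed
  then show ?thesis by (simp add: continuous_on_eq_continuous_at)
qed

lemma has_vector_derivative_transform_eventually_nhds:
  assumes "\<forall>\<^sub>F t in nhds a. f t = g t" "(f has_vector_derivative D) (at a)"
  shows "(g has_vector_derivative D) (at a)"
proof -
  obtain S where "open S" "a \<in> S" "\<And>t. t \<in> S \<Longrightarrow> f t = g t"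
    using assms(1) unfolding eventually_nhds by blast
  then show ?thesis using has_vector_derivative_transform_within_open[OF assms(2)] by blast
qed

section \<open>The lifted invariant curve and its rotation number\<close>

context symmetric_table begin

text \<open>The continuous logarithm of the normal along the curve is imaginary and gives the angle.
  Winding number 1, arranged by reversing the curve if necessary, makes the lift advance by
  \<open>2 * pi\<close>, and it is continued to the whole line by translation.\<close>

lemma lift_curve:
  assumes "rotational_curve \<gamma> \<alpha>"
  obtains g :: "real \<Rightarrow> real \<times> real" where "continuous_on UNIV g" "\<And>t. g t \<in> lines" "\<And>t. g (t + 1) = g t + (2 * pi, 0)"
    "inj g" "\<And>t. proj (g t) \<in> \<alpha>" "\<And>l. l \<in> \<alpha> \<Longrightarrow> \<exists>t. proj (g t) = l"
proof -
  have cyl: "\<alpha> \<subseteq> phase_cylinder \<gamma>" using assms by (simp add: rotational_curve_def)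
  obtain g0 where g0: "simple_path g0" "pathfinish g0 = pathstart g0" "path_image g0 = \<alpha>"
    "winding_number (normal \<circ> g0) 0 \<in> {1, -1}"
    using assms by (auto simp: rotational_curve_def)
  have props: "path (normal \<circ> g0) \<and> 0 \<notin> path_image (normal \<circ> g0)" if "simple_path g0" "path_image g0 = \<alpha>" for g0
  proof
    show "path (normal \<circ> g0)" using simple_path_imp_path[OF that(1)]
      unfolding path_def o_def by (intro continuous_intros)
    show "0 \<notin> path_image (normal \<circ> g0)"
      using cyl unfolding that(2)[symmetric] by (force simp: path_image_def phase_cylinder_def)
  qed
  obtain g1 where g1: "simple_path g1" "pathfinish g1 = pathstart g1" "path_image g1 = \<alpha>"
    "winding_number (normal \<circ> g1) 0 = 1"
  proof (cases "winding_number (normal \<circ> g0) 0 = 1")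
    case True then show ?thesis using that[of g0] g0 by blast
  next
    case False
    have "normal \<circ> reversepath g0 = reversepath (normal \<circ> g0)" by (simp add: reversepath_def o_def)
    then have "winding_number (normal \<circ> reversepath g0) 0 = 1"
      using winding_number_reversepath[of "normal \<circ> g0" 0] props[OF g0(1,3)] g0(4) False by simp
    then show ?thesis using that[of "reversepath g0"] g0 by (simp add: simple_path_reversepath)
  qed
  obtain \<theta>c where q: "path \<theta>c" "pathfinish \<theta>c - pathstart \<theta>c = 2 * of_real pi * \<i> * winding_number (normal \<circ> g1) 0"
    "\<And>t. t \<in> {0..1} \<Longrightarrow> (normal \<circ> g1) t = 0 + exp (\<theta>c t)"
    using winding_number_as_continuous_log[of "normal \<circ> g1" 0] props[OF g1(1,3)] by blast
  define f where "f t = (Im (\<theta>c t), snd (g1 t) - c \<bullet> normal (g1 t))" for t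
  have pf: "proj (f t) = g1 t" if "t \<in> {0..1}" for t
  proof -
    have "g1 t \<in> phase_cylinder \<gamma>" using that g1(3) cyl by (auto simp: path_image_def)
    then have "norm (exp (\<theta>c t)) = 1" using q(3)[OF that] by (simp add: phase_cylinder_def)
    then have "Re (\<theta>c t) = 0" by (simp add: norm_exp_eq_Re)
    then have "exp (\<theta>c t) = cis (Im (\<theta>c t))" by (simp add: exp_eq_polar)
    then show ?thesis using q(3)[OF that] by (simp add: proj_def f_def prod_eq_iff)
  qed
  have fl: "f t \<in> lines" if "t \<in> {0..1}" for t
  proof -
    have "g1 t \<in> phase_cylinder \<gamma>" using that g1(3) cyl by (auto simp: path_image_def)
    then show ?thesis using proj_cylinder_iff[of "f t"] pf[OF that] by simp
  qed
  have fc: "continuous_on {0..1} f" unfolding f_def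
    using q(1) simple_path_imp_path[OF g1(1)] by (intro continuous_intros) (auto simp: path_def)
  have f1: "f 1 = f 0 + (2 * pi, 0)"
  proof -
    have "\<theta>c 1 = \<theta>c 0 + 2 * of_real pi * \<i>" using q(2) g1(4) by (simp add: pathfinish_def pathstart_def algebra_simps)
    then show ?thesis using g1(2) by (simp add: f_def pathfinish_def pathstart_def)
  qed
  define g where "g t = f (frac t) + of_int \<lfloor>t\<rfloor> *\<^sub>R (2 * pi, 0)" for t
  have fr: "frac t \<in> {0..1}" "frac t < 1" for t :: real using frac_ge_0[of t] frac_lt_1[of t] by auto
  have gs: "g t = f (frac t) + (2 * pi * of_int \<lfloor>t\<rfloor>, 0)" for t by (simp add: g_def mult.commute)
  have pg: "proj (g t) = g1 (frac t)" for t unfolding gs proj_shift by (rule pf[OF fr(1)])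
  show ?thesis
  proof (rule that[of g])
    show "continuous_on UNIV g" unfolding g_def by (rule continuous_periodic_extension[OF fc f1])
    show "g t \<in> lines" for t
    proof -
      have "g1 (frac t) \<in> phase_cylinder \<gamma>" using fr[of t] g1(3) cyl by (auto simp: path_image_def)
      then show ?thesis using proj_cylinder_iff[of "g t"] pg by simp
    qed
    show "g (t + 1) = g t + (2 * pi, 0)" for t
      unfolding gs frac_1_eq by (simp add: prod_eq_iff distrib_left)
    show "inj g"
    proof (rule injI)
      fix s t assume st: "g s = g t"
      then have "g1 (frac s) = g1 (frac t)" using pg by metis
      then have "frac s = frac t \<or> frac s = 0 \<and> frac t = 1 \<or> frac s = 1 \<and> frac t = 0"
        using g1(1) fr(1)[of s] fr(1)[of t] unfolding simple_path_def loop_free_def by blast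
      then have e: "frac s = frac t" using fr(2)[of s] fr(2)[of t] by auto
      then have "\<lfloor>s\<rfloor> = \<lfloor>t\<rfloor>" using st unfolding gs by simp
      then show "s = t" using e by (simp add: frac_def)
    qed
    show "proj (g t) \<in> \<alpha>" for t unfolding pg using fr(1)[of t] g1(3) by (auto simp: path_image_def)
    show "\<exists>t. proj (g t) = l" if l: "l \<in> \<alpha>" for l
    proof -
      obtain t where t: "t \<in> {0..1}" "l = g1 t" using l g1(3) unfolding path_image_def by blast
      show ?thesis
      proof (cases "t = 1")
        case True
        then have "l = g1 0" using t g1(2) by (simp add: pathfinish_def pathstart_def)
        then show ?thesis using pg[of 0] by (intro exI[of _ 0]) simp
      next
        case False
        then have "frac t = t" using t by (simp add: frac_eq)
        then show ?thesis using pg[of t] t by metis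
      qed
    qed
  qed
qed

lemma lines_shift_nat: "x \<in> lines \<Longrightarrow> x + (2 * pi * real n, 0) \<in> lines"
proof (induction n)
  case (Suc n)
  have "x + (2 * pi * real (Suc n), 0) = (x + (2 * pi * real n, 0)) + (2 * pi, 0)" by (simp add: prod_eq_iff algebra_simps)
  then show ?case using Suc lines_shift2 by metis
qed (simp add: zero_prod_def[symmetric])

lemma Tn_shift_nat: "x \<in> lines \<Longrightarrow> (T ^^ m) (x + (2 * pi * real n, 0)) = (T ^^ m) x + (2 * pi * real n, 0)"
proof (induction n)
  case (Suc n)
  have e: "z + (2 * pi * real (Suc n), 0) = (z + (2 * pi * real n, 0)) + (2 * pi, 0)" for z :: "real \<times> real"
    by (simp add: prod_eq_iff algebra_simps)
  show ?case unfolding e using Suc Tn_shift2[OF lines_shift_nat] by simp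
qed (simp add: zero_prod_def[symmetric])

lemma ev_shift_nat: "x \<in> lines \<Longrightarrow> ev (x + (2 * pi * real n, 0)) = ev x + 2 * pi * real n"
proof (induction n)
  case (Suc n)
  have e: "x + (2 * pi * real (Suc n), 0) = (x + (2 * pi * real n, 0)) + (2 * pi, 0)" by (simp add: prod_eq_iff algebra_simps)
  show ?case unfolding e using Suc ev_shift2[OF lines_shift_nat] by (simp add: algebra_simps)
qed (simp add: zero_prod_def[symmetric])

lemma \<sigma>_shift_nat: "\<sigma> (t + 2 * pi * real n) = \<sigma> t + real n * L"
proof (induction n)
  case (Suc n)
  have "t + 2 * pi * real (Suc n) = (t + 2 * pi * real n) + 2 * pi" by (simp add: algebra_simps)
  then show ?case using Suc \<sigma>_turn[of "t + 2 * pi * real n"] by (simp add: algebra_simps)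
qed simp

text \<open>Four steps lift to a translation by \<open>N\<close> turns. The arcs add up to
  differences of entry parameters, so along multiples of 4 their mean is \<open>N / 4\<close> of the
  length, and the rotation number forces \<open>N = 1\<close>.\<close>

lemma period_one:
  assumes x: "x \<in> lines" and per: "(billiard_map \<gamma> ^^ 4) (proj x) = proj x"
    and rot: "(\<lambda>k. (\<Sum>i<k. arc_step \<gamma> L ((billiard_map \<gamma> ^^ i) (proj x))) / (real k * L)) \<longlonglongrightarrow> 1 / 4"
  shows "(T ^^ 4) x = x + (2 * pi, 0)"
proof -
  have "proj ((T ^^ 4) x) = proj x" using per billiard_proj_n[OF x, of 4] by simp
  then obtain n :: int where n: "(T ^^ 4) x = x + (2 * pi * of_int n, 0)" using proj_eq_imp by blast
  have "fst x < fst ((T ^^ 4) x)" using fst_Tn_gt[OF x, of 4] by simp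
  then have n0: "n > 0" by (simp add: n zero_less_mult_iff)
  define N where "N = nat n"
  have N: "(T ^^ 4) x = x + (2 * pi * real N, 0)" using n n0 by (simp add: N_def)
  have sum: "(\<Sum>i<k. arc_step \<gamma> L ((billiard_map \<gamma> ^^ i) (proj x))) = \<sigma> (ev ((T ^^ k) x)) - \<sigma> (ev x)" for k
  proof (induction k)
    case (Suc k)
    have "arc_step \<gamma> L ((billiard_map \<gamma> ^^ k) (proj x)) = \<sigma> (lv ((T ^^ k) x)) - \<sigma> (ev ((T ^^ k) x))"
      unfolding billiard_proj_n[OF x] by (rule arc_step_proj[OF Tn_lines[OF x]])
    moreover have "lv ((T ^^ k) x) = ev ((T ^^ Suc k) x)"
      using T_clines(2)[OF lines_clines[OF Tn_lines[OF x]], of k] by simp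
    ultimately show ?case using Suc by simp
  qed simp
  have Tj: "(T ^^ (4 * j)) x = x + (2 * pi * real (N * j), 0)" for j
  proof (induction j)
    case (Suc j)
    have "(T ^^ (4 * Suc j)) x = (T ^^ (4 * j)) ((T ^^ 4) x)"
      using fun_cong[OF funpow_add[of "4 * j" 4 T], of x] by (simp add: add.commute)
    also have "\<dots> = x + (2 * pi * real (N * j), 0) + (2 * pi * real N, 0)"
      unfolding N Tn_shift_nat[OF x] Suc ..
    finally show ?case by (simp add: prod_eq_iff algebra_simps)
  qed (simp add: zero_prod_def[symmetric])
  let ?a = "\<lambda>k. (\<Sum>i<k. arc_step \<gamma> L ((billiard_map \<gamma> ^^ i) (proj x))) / (real k * L)"
  \<comment> \<open>\<open>Suc\<close> keeps away from the division by zero at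
    \<open>k = 0\<close>.\<close>
  have "?a (4 * Suc j) = real N / 4" for j
  proof -
    have "(\<Sum>i<4 * Suc j. arc_step \<gamma> L ((billiard_map \<gamma> ^^ i) (proj x))) = real (N * Suc j) * L"
      unfolding sum Tj ev_shift_nat[OF x] \<sigma>_shift_nat by simp
    moreover have "real (N * Suc j) * L / (real (4 * Suc j) * L) = real N / 4"
    proof -
      have "real (N * Suc j) * L / (real (4 * Suc j) * L) = (real N * (real (Suc j) * L)) / (4 * (real (Suc j) * L))"
        by (simp only: of_nat_mult of_nat_numeral mult.assoc)
      also have "\<dots> = real N / 4" using L_pos by (intro mult_divide_mult_cancel_right) auto
      finally show ?thesis .
    qed
    ultimately show ?thesis by (simp only:)
  qed
  moreover have "(?a \<circ> (\<lambda>j. 4 * Suc j)) \<longlonglongrightarrow> 1 / 4"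
    by (rule LIMSEQ_subseq_LIMSEQ[OF rot]) (simp add: strict_mono_def)
  ultimately have "(\<lambda>j::nat. real N / 4) \<longlonglongrightarrow> 1 / 4" by (simp only: o_def)
  then have "real N / 4 = 1 / 4" by (simp add: LIMSEQ_const_iff)
  then show ?thesis using N by simp
qed

lemma low_shift_int: "z + (2 * pi * of_int n, 0) \<in> low \<longleftrightarrow> z \<in> low"
proof -
  have "(fst z + (t + 2 * pi), snd z) \<in> low \<longleftrightarrow> (fst z + t, snd z) \<in> low" for t
    using low_shift2_iff[of "(fst z + t, snd z)"] by (simp add: add.assoc)
  from periodic_int[of "\<lambda>t. (fst z + t, snd z) \<in> low", OF this, of 0 n]
  show ?thesis by (cases z) (simp add: mult.commute)
qed

text \<open>The pencil at the entry point, run from the tangent line to \<open>x\<close>, stays in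
  \<open>low\<close> and so avoids \<open>\<alpha>\<close>; its first line is not in the open
  cylinder, hence not on \<open>\<alpha>\<close> either.\<close>

lemma lower_domain_proj:
  assumes x: "x \<in> low" and cyl: "\<alpha> \<subseteq> phase_cylinder \<gamma>"
    and down: "\<And>s d d'. enter s d \<in> low \<Longrightarrow> 0 < d' \<Longrightarrow> d' \<le> d \<Longrightarrow> d < pi \<Longrightarrow> enter s d' \<in> low"
    and \<alpha>: "\<And>z. z \<in> low \<Longrightarrow> proj z \<notin> \<alpha>"
  shows "proj x \<in> lower_domain \<gamma> \<alpha>"
proof -
  note xl = low_lines[OF x]
  define s b where "s = ev x" and "b = fst x - s"
  have xx: "x = enter s b" using enter_ev[OF xl] by (simp add: s_def b_def)
  have b: "0 < b" "b < pi" using ev_lines[OF xl] by (auto simp: b_def s_def)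
  have low: "enter s d \<in> low" if "0 < d" "d \<le> b" for d using down[of s b d] x xx that b by auto
  let ?B = "proj (enter s 0)"
  have e0: "enter s 0 = (s, sh s)" by (simp add: enter_def)
  have B: "?B \<in> boundary0 \<gamma>"
  proof -
    have "line_through (\<gamma> (\<sigma> s)) (velocity \<gamma> (\<sigma> s)) = ?B"
      unfolding line_through_def vel_\<Psi> \<gamma>_\<sigma> e0
      by (simp add: proj_def sh_def inner_add_left mult.assoc[symmetric])
    then show ?thesis unfolding boundary0_def by (rule range_eqI[OF sym])
  qed
  have "?B \<notin> phase_cylinder \<gamma>" unfolding proj_cylinder_iff e0 by (simp add: lines_def)
  then have B\<alpha>: "?B \<notin> \<alpha>" using cyl by blast
  let ?C = "(\<lambda>d. proj (enter s d)) ` {0..b}"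
  have "connected ?C"
  proof (rule connected_continuous_image)
    show "continuous_on {0..b} (\<lambda>d. proj (enter s d))"
      unfolding proj_def enter_def fst_conv snd_conv by (intro continuous_intros)
  qed simp
  moreover have "?C \<subseteq> (phase_cylinder \<gamma> \<union> boundary0 \<gamma>) - \<alpha>"
  proof
    fix l assume "l \<in> ?C"
    then obtain d where d: "0 \<le> d" "d \<le> b" "l = proj (enter s d)" by auto
    show "l \<in> (phase_cylinder \<gamma> \<union> boundary0 \<gamma>) - \<alpha>"
    proof (cases "d = 0")
      case True then show ?thesis using d B B\<alpha> by simp
    next
      case False
      then have "enter s d \<in> low" using low d by simp
      then show ?thesis using \<alpha> proj_lines low_lines d(3) by blast
    qed
  qed
  moreover have "?B \<in> ?C" "proj x \<in> ?C" using b xx by auto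
  ultimately have "connected_component ((phase_cylinder \<gamma> \<union> boundary0 \<gamma>) - \<alpha>) ?B (proj x)"
    unfolding connected_component_def by blast
  then show ?thesis using B proj_lines[OF xl] by (auto simp: lower_domain_def)
qed

text \<open>The boundary point is determined by \<open>h\<close> and \<open>h'\<close>. In the axes
  of the ellipse it is \<open>(a\<^sup>2 cos u, b\<^sup>2 sin u) / h\<close> with
  \<open>u = s - s0\<close>, which is the ellipse parametrised by its normal angle.\<close>

lemma is_ellipse_range:
  assumes ab: "a > 0" "b > 0" and h2: "\<And>s. (sh s)\<^sup>2 = a\<^sup>2 * (cos (s - s0))\<^sup>2 + b\<^sup>2 * (sin (s - s0))\<^sup>2"
  shows "is_ellipse (range \<gamma>)"
proof -
  have hh1: "sh s * sh1 s = (b\<^sup>2 - a\<^sup>2) * sin (s - s0) * cos (s - s0)" for s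
  proof -
    have "((\<lambda>s. (sh s)\<^sup>2) has_real_derivative 2 * (sh s * sh1 s)) (at s)"
      by (auto intro!: derivative_eq_intros h_deriv[of s])
    moreover have "((\<lambda>s. (sh s)\<^sup>2) has_real_derivative 2 * ((b\<^sup>2 - a\<^sup>2) * sin (s - s0) * cos (s - s0))) (at s)"
      unfolding h2 by (auto intro!: derivative_eq_intros simp: algebra_simps)
    ultimately show ?thesis using DERIV_unique by fastforce
  qed
  have Gs: "G s = cis s0 * Complex (a\<^sup>2 * cos (s - s0) / sh s) (b\<^sup>2 * sin (s - s0) / sh s)" for s
  proof -
    define u where "u = s - s0"
    have hp: "sh s > 0" by (rule h_pos)
    have one: "(sin u)\<^sup>2 = 1 - (cos u)\<^sup>2" by (simp add: sin_squared_eq)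
    have "sh s * (sh s * cos u - sh1 s * sin u) = a\<^sup>2 * cos u"
    proof -
      have "sh s * (sh s * cos u - sh1 s * sin u) = (sh s)\<^sup>2 * cos u - (sh s * sh1 s) * sin u"
        by (simp add: power2_eq_square algebra_simps)
      also have "\<dots> = (a\<^sup>2 * (cos u)\<^sup>2 + b\<^sup>2 * (sin u)\<^sup>2) * cos u - (b\<^sup>2 - a\<^sup>2) * (sin u)\<^sup>2 * cos u"
        unfolding h2 hh1 u_def[symmetric] by (simp add: power2_eq_square algebra_simps)
      also have "\<dots> = a\<^sup>2 * cos u" unfolding one by (simp add: algebra_simps)
      finally show ?thesis .
    qed
    then have 1: "sh s * cos u - sh1 s * sin u = a\<^sup>2 * cos u / sh s" using hp by (simp add: field_simps)
    have "sh s * (sh s * sin u + sh1 s * cos u) = b\<^sup>2 * sin u"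
    proof -
      have "sh s * (sh s * sin u + sh1 s * cos u) = (sh s)\<^sup>2 * sin u + (sh s * sh1 s) * cos u"
        by (simp add: power2_eq_square algebra_simps)
      also have "\<dots> = (a\<^sup>2 * (cos u)\<^sup>2 + b\<^sup>2 * (sin u)\<^sup>2) * sin u + (b\<^sup>2 - a\<^sup>2) * (cos u)\<^sup>2 * sin u"
        unfolding h2 hh1 u_def[symmetric] by (simp add: power2_eq_square algebra_simps)
      also have "\<dots> = b\<^sup>2 * sin u" unfolding one by (simp add: algebra_simps)
      finally show ?thesis .
    qed
    then have 2: "sh s * sin u + sh1 s * cos u = b\<^sup>2 * sin u / sh s" using hp by (simp add: field_simps)
    have "cis s = cis s0 * cis u" by (simp add: cis_mult u_def)
    then have "G s = cis s0 * (Complex (sh s) (sh1 s) * cis u)" using G_h[of s] by (simp add: mult_ac)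
    also have "Complex (sh s) (sh1 s) * cis u = Complex (a\<^sup>2 * cos u / sh s) (b\<^sup>2 * sin u / sh s)"
      by (simp add: complex_eq_iff 1 2[symmetric])
    finally show ?thesis by (simp add: u_def)
  qed
  have "range \<gamma> = range (\<lambda>t. c + cis s0 * Complex (a * cos t) (b * sin t))"
  proof (intro set_eqI iffI)
    fix z assume "z \<in> range \<gamma>"
    then obtain s where s: "z = c + G s" using \<gamma>_G by auto
    have hp: "sh s > 0" by (rule h_pos)
    have "(a * cos (s - s0) / sh s)\<^sup>2 + (b * sin (s - s0) / sh s)\<^sup>2
        = (a\<^sup>2 * (cos (s - s0))\<^sup>2 + b\<^sup>2 * (sin (s - s0))\<^sup>2) / (sh s)\<^sup>2"
      by (simp only: power_divide power_mult_distrib add_divide_distrib)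
    also have "\<dots> = 1" using hp unfolding h2[of s, symmetric] by simp
    finally obtain t where t: "a * cos (s - s0) / sh s = cos t" "b * sin (s - s0) / sh s = sin t"
      by (rule sincos_total_2pi) blast
    have "a * cos t = a\<^sup>2 * cos (s - s0) / sh s" "b * sin t = b\<^sup>2 * sin (s - s0) / sh s"
      unfolding t[symmetric] by (simp_all add: power2_eq_square)
    then have "z = c + cis s0 * Complex (a * cos t) (b * sin t)" unfolding s Gs[of s] by (simp only:)
    then show "z \<in> range (\<lambda>t. c + cis s0 * Complex (a * cos t) (b * sin t))" by (rule range_eqI)
  next
    fix z assume "z \<in> range (\<lambda>t. c + cis s0 * Complex (a * cos t) (b * sin t))"
    then obtain t where t: "z = c + cis s0 * Complex (a * cos t) (b * sin t)" by blast
    \<comment> \<open>The outer normal of the ellipse at parameter \<open>t\<close> is along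
      \<open>(cos t / a, sin t / b)\<close>; \<open>M\<close> is the length of this vector and turns
      out to be \<open>1 / sh s\<close>.\<close>
    define M where "M = sqrt ((cos t / a)\<^sup>2 + (sin t / b)\<^sup>2)"
    have pos: "(cos t / a)\<^sup>2 + (sin t / b)\<^sup>2 > 0"
    proof -
      have "cos t \<noteq> 0 \<or> sin t \<noteq> 0" using sin_zero_abs_cos_one[of t] by auto
      then show ?thesis using ab by (auto simp: add_pos_nonneg add_nonneg_pos)
    qed
    then have M: "M > 0" "M\<^sup>2 = (cos t / a)\<^sup>2 + (sin t / b)\<^sup>2" by (auto simp: M_def)
    have "(cos t / a / M)\<^sup>2 + (sin t / b / M)\<^sup>2 = ((cos t / a)\<^sup>2 + (sin t / b)\<^sup>2) / M\<^sup>2"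
      by (simp only: power_divide[of _ M] add_divide_distrib)
    also have "\<dots> = 1" using M by (simp only: M(2)[symmetric]) simp
    finally obtain u where u: "cos t / a / M = cos u" "sin t / b / M = sin u"
      by (rule sincos_total_2pi) blast
    define s where "s = s0 + u"
    have cs: "a * cos u = cos t / M" "b * sin u = sin t / M" using ab unfolding u[symmetric] by auto
    have "(sh s)\<^sup>2 = (a * cos u)\<^sup>2 + (b * sin u)\<^sup>2" unfolding h2 by (simp add: s_def power_mult_distrib)
    also have "\<dots> = ((cos t)\<^sup>2 + (sin t)\<^sup>2) / M\<^sup>2" unfolding cs by (simp only: power_divide add_divide_distrib)
    also have "\<dots> = (1 / M)\<^sup>2" by (simp add: power_divide)
    finally have hs: "sh s = 1 / M" using M(1) h_pos[of s] by (simp add: power2_eq_iff_nonneg less_imp_le)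
    have "a\<^sup>2 * cos (s - s0) / sh s = a * (a * cos u) * M" "b\<^sup>2 * sin (s - s0) / sh s = b * (b * sin u) * M"
      unfolding hs by (simp_all add: s_def power2_eq_square)
    then have "a\<^sup>2 * cos (s - s0) / sh s = a * cos t" "b\<^sup>2 * sin (s - s0) / sh s = b * sin t"
      unfolding cs using M(1) by simp_all
    then have "z = \<gamma> (\<sigma> s)" unfolding t \<gamma>_\<sigma> Gs[of s] by simp
    then show "z \<in> range \<gamma>" by blast
  qed
  then show ?thesis unfolding is_ellipse_def using ab by blast
qed

section \<open>Derivatives in the cylinder and tangent vectors of the leaves\<close>

definition dproj :: "real \<times> real \<Rightarrow> real \<times> real \<Rightarrow> complex \<times> real" where
  "dproj x u = (fst u *\<^sub>R (\<i> * cis (fst x)), snd u + c \<bullet> (fst u *\<^sub>R (\<i> * cis (fst x))))"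

text \<open>A local inverse of \<open>proj\<close> near \<open>x\<close>; on the whole cylinder it is a right inverse.\<close>

definition chart :: "real \<times> real \<Rightarrow> complex \<times> real \<Rightarrow> real \<times> real" where
  "chart x l = (fst x + Im (Ln (fst l * cis (- fst x))), snd l - c \<bullet> fst l)"

definition dchart :: "real \<times> real \<Rightarrow> complex \<times> real \<Rightarrow> real \<times> real" where
  "dchart x v = (Im (fst v * cis (- fst x)), snd v - c \<bullet> fst v)"

lemma proj_has_derivative: "(proj has_derivative dproj x) (at x)"
proof -
  have "((\<lambda>x::real\<times>real. cis (fst x)) has_derivative (\<lambda>u. fst u *\<^sub>R (\<i> * cis (fst x)))) (at x)"
    by (rule has_derivative_cis[OF has_derivative_fst[OF has_derivative_ident]])
  from has_derivative_Pair[OF this has_derivative_add[OF has_derivative_snd[OF has_derivative_ident] has_derivative_inner_right[OF this]]]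
  show ?thesis unfolding proj_def[abs_def] dproj_def[abs_def] by simp
qed

lemma chart_has_derivative: "(chart x has_derivative dchart x) (at (proj x))"
proof -
  have 1: "((\<lambda>l::complex\<times>real. fst l * cis (- fst x)) has_derivative (\<lambda>v. fst v * cis (- fst x))) (at (proj x))"
    by (intro derivative_intros)
  have v: "fst (proj x) * cis (- fst x) = 1" by (simp add: proj_def cis_mult)
  have "(Ln has_field_derivative inverse 1) (at (fst (proj x) * cis (- fst x)))"
    unfolding v by (rule has_field_derivative_Ln) simp
  moreover have "(*) (inverse 1) = (\<lambda>h::complex. h)" by (simp add: fun_eq_iff)
  ultimately have "(Ln has_derivative (\<lambda>h. h)) (at (fst (proj x) * cis (- fst x)))"
    by (simp only: has_field_derivative_def)
  from has_derivative_compose[OF 1 this]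
  have "((\<lambda>l. Im (Ln (fst l * cis (- fst x)))) has_derivative (\<lambda>v. Im (fst v * cis (- fst x)))) (at (proj x))"
    by (rule bounded_linear.has_derivative[OF bounded_linear_Im])
  from has_derivative_Pair[OF has_derivative_add[OF has_derivative_const[of "fst x"] this]
      has_derivative_diff[OF has_derivative_snd[OF has_derivative_ident] has_derivative_inner_right[OF has_derivative_fst[OF has_derivative_ident]]]]
  show ?thesis unfolding chart_def[abs_def] dchart_def[abs_def] by simp
qed

lemma proj_chart: assumes "norm (fst l) = 1" shows "proj (chart x l) = l"
proof -
  let ?w = "fst l * cis (- fst x)"
  have n: "norm ?w = 1" using assms by (simp add: norm_mult)
  then have "?w \<noteq> 0" by auto
  then have "exp (Ln ?w) = ?w" "Re (Ln ?w) = 0" using n by (auto simp: Re_Ln)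
  then have "cis (Im (Ln ?w)) = ?w" by (metis exp_eq_polar exp_zero of_real_1 mult_1)
  then have "cis (fst x + Im (Ln ?w)) = fst l" by (simp add: cis_mult[symmetric]) (simp add: cis_mult mult.left_commute)
  then show ?thesis by (simp add: proj_def chart_def prod_eq_iff)
qed

lemma chart_proj: "chart x (proj x) = x"
proof -
  have "fst (proj x) * cis (- fst x) = 1" by (simp add: proj_def cis_mult)
  then show ?thesis by (simp add: chart_def) (simp add: proj_def prod_eq_iff)
qed

lemma dchart_dproj: "dchart x (dproj x u) = u"
  by (simp add: dchart_def dproj_def scaleR_conv_of_real mult.assoc cis_mult)

text \<open>\<open>chart\<close> is differentiable at \<open>proj x\<close> in the ambient space,
  and on the cylinder it is a right inverse of \<open>proj\<close>; so the iterate coincides there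
  with a composition of three differentiable maps.\<close>

lemma billiard_has_derivative:
  assumes x: "x \<in> lines"
  shows "((billiard_map \<gamma> ^^ n) has_derivative (\<lambda>v. dproj ((T ^^ n) x) (dTn n x (dchart x v)))) (at (proj x) within phase_cylinder \<gamma>)"
proof -
  have "((T ^^ n) has_derivative dTn n x) (at (chart x (proj x)))"
    unfolding chart_proj by (rule Tn_has_derivative[OF x])
  from has_derivative_compose[OF chart_has_derivative this]
  have "((\<lambda>l. (T ^^ n) (chart x l)) has_derivative (\<lambda>v. dTn n x (dchart x v))) (at (proj x))" .
  from has_derivative_compose[OF this proj_has_derivative]
  have "((\<lambda>l. proj ((T ^^ n) (chart x l))) has_derivative (\<lambda>v. dproj ((T ^^ n) x) (dTn n x (dchart x v)))) (at (proj x) within phase_cylinder \<gamma>)"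
    unfolding chart_proj by (rule has_derivative_at_withinI)
  then show ?thesis
  proof (rule has_derivative_transform[rotated 2])
    show "proj x \<in> phase_cylinder \<gamma>" by (rule proj_lines[OF x])
    fix l assume l: "l \<in> phase_cylinder \<gamma>"
    then have e: "proj (chart x l) = l" by (intro proj_chart) (simp add: phase_cylinder_def)
    then have "chart x l \<in> lines" using l proj_cylinder_iff by metis
    from billiard_proj_n[OF this, of n] show "(billiard_map \<gamma> ^^ n) l = proj ((T ^^ n) (chart x l))" unfolding e .
  qed
qed

lemma proj_curve_derivative:
  assumes "(y has_vector_derivative u) (at 0)" "y 0 = x"
  shows "((\<lambda>t. proj (y t)) has_vector_derivative dproj x u) (at (0::real))"
proof -
  have "(y has_derivative (\<lambda>s. s *\<^sub>R u)) (at 0)" using assms(1) by (simp add: has_vector_derivative_def)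
  from has_derivative_compose[OF this, of proj "dproj x"] proj_has_derivative[of x] assms(2)
  have "((\<lambda>t. proj (y t)) has_derivative (\<lambda>s. dproj x (s *\<^sub>R u))) (at 0)" by simp
  moreover have "dproj x (s *\<^sub>R u) = s *\<^sub>R dproj x u" for s
    using linear_scale[OF has_derivative_linear[OF proj_has_derivative[of x]]] .
  ultimately show ?thesis by (simp add: has_vector_derivative_def)
qed

lemma eventually_lines:
  assumes "x \<in> lines" "isCont y 0" "y 0 = x" shows "\<forall>\<^sub>F t in nhds (0::real). y t \<in> lines"
proof -
  have "(y \<longlongrightarrow> x) (nhds 0)"
    using assms(2) unfolding isCont_def tendsto_at_iff_tendsto_nhds unfolding assms(3) .
  then show ?thesis using assms(1) lines_open by (simp add: topological_tendstoD)
qed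

lemma tangent_phi_leaf:
  assumes x: "x \<in> lines" and u: "fst u = 0"
  shows "dproj x u \<in> tangent_vectors (phi_leaf \<gamma> (proj x)) (proj x)"
proof -
  let ?y = "\<lambda>t::real. x + t *\<^sub>R u"
  have d: "(?y has_vector_derivative u) (at 0)" by (auto intro!: derivative_eq_intros)
  have "\<forall>\<^sub>F t in nhds 0. ?y t \<in> lines"
    by (rule eventually_lines[OF x has_vector_derivative_continuous[OF d]]) simp
  then have "\<forall>\<^sub>F t in nhds 0. proj (?y t) \<in> phi_leaf \<gamma> (proj x)"
    by eventually_elim (use u in \<open>simp add: phi_leaf_def proj_lines\<close>, simp add: proj_def)
  then show ?thesis unfolding tangent_vectors_def
    using proj_curve_derivative[OF d] by (auto intro!: exI[of _ "\<lambda>t. proj (?y t)"])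
qed

text \<open>Vanishing \<open>dev\<close> makes \<open>u\<close> a multiple of
  \<open>pencil x\<close>, so the curve can be taken inside the pencil.\<close>

lemma tangent_s_leaf:
  assumes x: "x \<in> lines" and u: "dev x u = 0"
  shows "dproj x u \<in> tangent_vectors (s_leaf \<gamma> L (proj x)) (proj x)"
proof -
  define s b where "s = ev x" and "b = fst x - s"
  have xx: "enter s b = x" using enter_ev[OF x] by (simp add: s_def b_def)
  have b: "0 < b" "b < pi" using ev_lines[OF x] by (auto simp: b_def s_def)
  let ?y = "\<lambda>t. enter s (b + t * fst u)"
  have sin: "sin (fst x - ev x) > 0" using b by (intro sin_gt_zero) (auto simp: b_def s_def)
  then have u2: "snd u = q s (fst x) * fst u" using u r_pos[of "ev x"] by (auto simp: dev_def s_def)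
  have "((\<lambda>t. b + t * fst u) has_vector_derivative fst u) (at 0)"
    unfolding has_real_derivative_iff_has_vector_derivative[symmetric] by (auto intro!: derivative_eq_intros)
  from vector_diff_chain_at[OF this, of "enter s" "(1, q s (s + b))"] enter_has_vector_derivative[of s b]
  have "(?y has_vector_derivative fst u *\<^sub>R (1, q s (s + b))) (at 0)" by (simp add: o_def)
  moreover have "fst u *\<^sub>R (1, q s (s + b)) = u" using u2 by (simp add: prod_eq_iff b_def mult.commute)
  ultimately have d: "(?y has_vector_derivative u) (at 0)" by simp
  have "((\<lambda>t. b + t * fst u) \<longlongrightarrow> b + 0 * fst u) (nhds 0)" by (intro tendsto_intros filterlim_ident)
  then have t: "((\<lambda>t. b + t * fst u) \<longlongrightarrow> b) (nhds 0)" by simp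
  have "\<forall>\<^sub>F t in nhds 0. 0 < b + t * fst u" "\<forall>\<^sub>F t in nhds 0. b + t * fst u < pi"
    using order_tendstoD[OF t] b by auto
  then have "\<forall>\<^sub>F t in nhds 0. proj (?y t) \<in> s_leaf \<gamma> L (proj x)"
  proof eventually_elim
    case (elim t)
    note e = enter_lines[OF elim, of s]
    then show ?case using entry_parameter_cong[OF e(1) x] proj_lines[OF e(1)] by (simp add: s_leaf_def s_def)
  qed
  then show ?thesis unfolding tangent_vectors_def
    using proj_curve_derivative[OF d] xx by (auto intro!: exI[of _ "\<lambda>t. proj (?y t)"])
qed

lemma vertical_phi:
  assumes x: "x \<in> lines" and z: "fst (dTn n x (0, - 1)) = 0"
  shows "vertical_returns_to_vertical \<gamma> (phi_leaf \<gamma>) (proj x) n"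
  unfolding vertical_returns_to_vertical_def
proof (intro exI conjI)
  show "dproj x (0, - 1) \<noteq> 0" by (simp add: dproj_def zero_prod_def)
  show "dproj x (0, - 1) \<in> tangent_vectors (phi_leaf \<gamma> (proj x)) (proj x)"
    by (rule tangent_phi_leaf[OF x]) simp
  show "((billiard_map \<gamma> ^^ n) has_derivative (\<lambda>v. dproj ((T ^^ n) x) (dTn n x (dchart x v)))) (at (proj x) within phase_cylinder \<gamma>)"
    by (rule billiard_has_derivative[OF x])
  show "dproj ((T ^^ n) x) (dTn n x (dchart x (dproj x (0, - 1)))) \<in> tangent_vectors (phi_leaf \<gamma> ((billiard_map \<gamma> ^^ n) (proj x))) ((billiard_map \<gamma> ^^ n) (proj x))"
    unfolding dchart_dproj billiard_proj_n[OF x] by (rule tangent_phi_leaf[OF Tn_lines[OF x] z])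
qed

lemma vertical_s:
  assumes x: "x \<in> lines" and z: "dev ((T ^^ n) x) (dTn n x (pencil x)) = 0"
  shows "vertical_returns_to_vertical \<gamma> (s_leaf \<gamma> L) (proj x) n"
  unfolding vertical_returns_to_vertical_def
proof (intro exI conjI)
  show "dproj x (pencil x) \<noteq> 0" by (simp add: dproj_def pencil_def zero_prod_def)
  show "dproj x (pencil x) \<in> tangent_vectors (s_leaf \<gamma> L (proj x)) (proj x)"
    by (rule tangent_s_leaf[OF x]) (simp add: dev_def pencil_def)
  show "((billiard_map \<gamma> ^^ n) has_derivative (\<lambda>v. dproj ((T ^^ n) x) (dTn n x (dchart x v)))) (at (proj x) within phase_cylinder \<gamma>)"
    by (rule billiard_has_derivative[OF x])
  show "dproj ((T ^^ n) x) (dTn n x (dchart x (dproj x (pencil x)))) \<in> tangent_vectors (s_leaf \<gamma> L ((billiard_map \<gamma> ^^ n) (proj x))) ((billiard_map \<gamma> ^^ n) (proj x))"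
    unfolding dchart_dproj billiard_proj_n[OF x] by (rule tangent_s_leaf[OF Tn_lines[OF x] z])
qed

lemma parallel_beam:
  assumes x: "x \<in> lines" and z: "fst (dTn n x (0, - 1)) = 0"
  shows "((\<lambda>t. normal ((billiard_map \<gamma> ^^ n) (normal (proj x), snd (proj x) + t))) has_vector_derivative 0) (at 0)"
proof -
  let ?y = "\<lambda>t::real. x + t *\<^sub>R (0, 1)"
  have d: "(?y has_vector_derivative (0, 1)) (at 0)" by (auto intro!: derivative_eq_intros)
  then have "(?y has_derivative (\<lambda>s. s *\<^sub>R (0, 1))) (at 0)" by (simp add: has_vector_derivative_def)
  moreover have "((T ^^ n) has_derivative dTn n x) (at (?y 0))"
    using Tn_has_derivative[OF x, of n] by (simp add: zero_prod_def[symmetric])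
  ultimately have "((\<lambda>t. (T ^^ n) (?y t)) has_derivative (\<lambda>s. dTn n x (s *\<^sub>R (0, 1)))) (at 0)"
    by (rule has_derivative_compose)
  from has_derivative_cis[OF has_derivative_fst[OF this]]
  have "((\<lambda>t. cis (fst ((T ^^ n) (?y t)))) has_derivative (\<lambda>s. fst (dTn n x (s *\<^sub>R (0, 1))) *\<^sub>R (\<i> * cis (fst ((T ^^ n) (?y 0)))))) (at 0)" .
  moreover have "fst (dTn n x (s *\<^sub>R (0, 1))) = 0" for s
  proof -
    have "s *\<^sub>R (0, 1) = (- s) *\<^sub>R (0, - 1 :: real)" by simp
    then have "dTn n x (s *\<^sub>R (0, 1)) = (- s) *\<^sub>R dTn n x (0, - 1)"
      using linear_scale[OF has_derivative_linear[OF Tn_has_derivative[OF x, of n]], of "- s" "(0, - 1)"] by simp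
    then show ?thesis using z by simp
  qed
  ultimately have D: "((\<lambda>t. cis (fst ((T ^^ n) (?y t)))) has_vector_derivative 0) (at 0)"
    by (simp add: has_vector_derivative_def)
  have ev: "\<forall>\<^sub>F t in nhds 0. ?y t \<in> lines"
    by (rule eventually_lines[OF x has_vector_derivative_continuous[OF d]]) (simp add: zero_prod_def[symmetric])
  have "\<forall>\<^sub>F t in nhds 0. cis (fst ((T ^^ n) (?y t))) = normal ((billiard_map \<gamma> ^^ n) (normal (proj x), snd (proj x) + t))"
    using ev
  proof eventually_elim
    case (elim t)
    have "(normal (proj x), snd (proj x) + t) = proj (?y t)" by (simp add: proj_def)
    then have "(billiard_map \<gamma> ^^ n) (normal (proj x), snd (proj x) + t) = proj ((T ^^ n) (?y t))"
      using billiard_proj_n[OF elim, of n] by (simp only:)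
    then show ?case by (simp only:) (simp add: proj_def)
  qed
  then show ?thesis using D by (rule has_vector_derivative_transform_eventually_nhds)
qed

end

theorem corollary3p3:
  fixes \<gamma> :: "real \<Rightarrow> complex" and L :: real and \<alpha> :: "oriented_line set"
  assumes "simple_closed_C2_curve \<gamma> L"
    and "counterclockwise \<gamma> L"
    and "convex (table \<gamma>)"
    and "\<And>s. curvature \<gamma> s > 0"
    and "centrally_symmetric (range \<gamma>)"
    and "rotational_curve \<gamma> \<alpha>"
    and "billiard_map \<gamma> ` \<alpha> = \<alpha>"
    and "has_rotation_number \<gamma> L \<alpha> (1 / 4)"
    and "\<And>x. x \<in> \<alpha> \<Longrightarrow> (billiard_map \<gamma> ^^ 4) x = x"
    and "\<not> is_ellipse (range \<gamma>)"
  shows "(\<forall>leaf \<in> {s_leaf \<gamma> L, phi_leaf \<gamma>}.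
            \<exists>x \<in> lower_domain \<gamma> \<alpha>. \<exists>n>0. vertical_returns_to_vertical \<gamma> leaf x n) \<and>
         (\<exists>x \<in> lower_domain \<gamma> \<alpha>. \<exists>n>0.
            ((\<lambda>t. normal ((billiard_map \<gamma> ^^ n) (normal x, snd x + t)))
               has_vector_derivative 0) (at 0))"
proof -
  obtain c where "(\<lambda>z. 2 * c - z) ` range \<gamma> = range \<gamma>"
    using assms(5) by (auto simp: centrally_symmetric_def)
  then interpret symmetric_table \<gamma> L c
    using assms(1,3,4) by unfold_locales auto
  obtain g :: "real \<Rightarrow> real \<times> real" where g: "continuous_on UNIV g" "\<And>t. g t \<in> lines" "\<And>t. g (t + 1) = g t + (2 * pi, 0)"
    "inj g" "\<And>t. proj (g t) \<in> \<alpha>" "\<And>l. l \<in> \<alpha> \<Longrightarrow> \<exists>t. proj (g t) = l"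
    using lift_curve[OF assms(6)] by blast
  have per: "(T ^^ 4) (g t) = g t + (2 * pi, 0)" for t
    using period_one[OF g(2) assms(9)[OF g(5)]] assms(8) g(5) by (simp add: has_rotation_number_def)
  interpret Q: quarter_curve sh sh1 sr g
    by unfold_locales (use g per in auto)
  obtain R where R: "R > 0" "\<And>s. (sh s)\<^sup>2 + (sh (s + pi / 2))\<^sup>2 = R\<^sup>2"
    using Q.sum_squares_const by blast
  interpret O: quarter_oval sh sh1 sr R
    by unfold_locales (use R in auto)
  \<comment> \<open>A lift of a line of \<open>\<alpha>\<close> spans exactly a quarter turn, which
    the strict inequality of \<open>low\<close> excludes.\<close>
  have \<alpha>: "proj z \<notin> \<alpha>" if z: "z \<in> low" for z
  proof
    assume "proj z \<in> \<alpha>"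
    then obtain t where "proj (g t) = proj z" using g(6) by blast
    then obtain n :: int where "g t = z + (2 * pi * of_int n, 0)" using proj_eq_imp by blast
    then have "g t \<in> low" using z low_shift_int by simp
    then show False using Q.quarter_step[of t] by (simp add: low_def)
  qed
  have cyl: "\<alpha> \<subseteq> phase_cylinder \<gamma>" using assms(6) by (simp add: rotational_curve_def)
  have down: "enter s d' \<in> low" if "enter s d \<in> low" "0 < d'" "d' \<le> d" "d < pi" for s d d'
    using that O.enter_low_iff[of d s] O.enter_low_iff[of d' s] by auto
  have ne: "\<not> (\<exists>a>0. \<exists>b>0. \<exists>s0. \<forall>s. (sh s)\<^sup>2 = a\<^sup>2 * (cos (s - s0))\<^sup>2 + b\<^sup>2 * (sin (s - s0))\<^sup>2)"
    using is_ellipse_range assms(10) by blast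
  obtain x n where x: "x \<in> low" "n > 0" "fst (dTn n x (0, - 1)) = 0"
    using O.conjugate_points(1)[OF ne] by blast
  obtain x' n' where x': "x' \<in> low" "n' > 0" "dev ((T ^^ n') x') (dTn n' x' (pencil x')) = 0"
    using O.conjugate_points(2)[OF ne] by blast
  have ld: "proj z \<in> lower_domain \<gamma> \<alpha>" if "z \<in> low" for z
    by (rule lower_domain_proj[OF that cyl down \<alpha>])
  have "\<exists>x \<in> lower_domain \<gamma> \<alpha>. \<exists>n>0. vertical_returns_to_vertical \<gamma> (phi_leaf \<gamma>) x n"
    by (intro bexI[OF _ ld[OF x(1)]] exI conjI) (rule x(2), rule vertical_phi[OF low_lines[OF x(1)] x(3)])
  moreover have "\<exists>x \<in> lower_domain \<gamma> \<alpha>. \<exists>n>0. vertical_returns_to_vertical \<gamma> (s_leaf \<gamma> L) x n"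
    by (intro bexI[OF _ ld[OF x'(1)]] exI conjI) (rule x'(2), rule vertical_s[OF low_lines[OF x'(1)] x'(3)])
  moreover have "\<exists>x \<in> lower_domain \<gamma> \<alpha>. \<exists>n>0.
      ((\<lambda>t. normal ((billiard_map \<gamma> ^^ n) (normal x, snd x + t))) has_vector_derivative 0) (at 0)"
    by (intro bexI[OF _ ld[OF x(1)]] exI conjI) (rule x(2), rule parallel_beam[OF low_lines[OF x(1)] x(3)])
  ultimately show ?thesis by simp
qed

end
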